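(* Let $A$ be a $C^*$-algebra, and let $M\subset A$ be an abelian $C^*$-subalgebra. Suppose $F$ is a nonempty set of pure states on $M$ such that every $\phi\in F$ extends uniquely to a state $\phi^A$ on $A$ (which is necessarily pure). For $\phi \in F$ let $\pi_{\phi^A}$ denote the GNS representation of $A$ associated with $\phi^A$. (I) If the family of GNS representations $\{\pi_{\phi^A}\}_{\phi\in F}$ is jointly faithful on $A$, then: (i) a $*$-homomorphism $\rho:A\to B$ into a $C^*$-algebra $B$ is injective if and only if its restriction $\rho|_M$ is injective. (II) If the family of states $\{\phi^A\}_{\phi\in F}$ is jointly faithful on $A$, then, in addition to statement (i), the following are also true: (ii) the commutant $M'=\{a\in A : ab=ba\ \ \forall\, b\in M\}$ of $M$ in $A$ is a maximal abelian subalgebra (MASA) in $A$; (iii) for any intermediate abelian $C^*$-subalgebra $M\subset N\subset A$, the set $\{\phi^A|_N\}_{\phi\in F}$ is $w^*$-dense in $P(N)$, the set of all pure states on $N$.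
   Context: A collection $\{\rho_i:A\to B_i\}_{i\in I}$ of positive linear maps from a $C^*$-algebra $A$ to $C^*$-algebras $B_i$ is called jointly faithful if, whenever $a\in A$ satisfies $\rho_i(a^*a)=0$ for all $i\in I$, it follows that $a=0$. *)

theory Defs
  imports "HOL-Analysis.Analysis"
begin

(* No unit is assumed: real_normed_algebra and banach provide the additive group, the associative
   bilinear product, the submultiplicative norm and completeness. *)
class cstar_algebra = real_normed_algebra + banach +
  fixes scaleC :: "complex \<Rightarrow> 'a \<Rightarrow> 'a"
    and star :: "'a \<Rightarrow> 'a"
  assumes scaleR_scaleC: "scaleR r x = scaleC (complex_of_real r) x"
    and scaleC_add_right: "scaleC c (x + y) = scaleC c x + scaleC c y"
    and scaleC_add_left: "scaleC (c + d) x = scaleC c x + scaleC d x"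
    and scaleC_scaleC: "scaleC c (scaleC d x) = scaleC (c * d) x"
    and mult_scaleC_left: "scaleC c x * y = scaleC c (x * y)"
    and mult_scaleC_right: "x * scaleC c y = scaleC c (x * y)"
    and norm_scaleC: "norm (scaleC c x) = cmod c * norm x"
    and star_star: "star (star x) = x"
    and star_add: "star (x + y) = star x + star y"
    and star_scaleC: "star (scaleC c x) = scaleC (cnj c) (star x)"
    and star_mult: "star (x * y) = star y * star x"
    and cstar_identity: "norm (star x * x) = (norm x)\<^sup>2"

definition cstar_subalgebra :: "'a::cstar_algebra set \<Rightarrow> bool" where
  "cstar_subalgebra M \<longleftrightarrow>
     0 \<in> M \<and>
     (\<forall>a\<in>M. \<forall>b\<in>M. a + b \<in> M) \<and>
     (\<forall>c. \<forall>a\<in>M. scaleC c a \<in> M) \<and>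
     (\<forall>a\<in>M. \<forall>b\<in>M. a * b \<in> M) \<and>
     (\<forall>a\<in>M. star a \<in> M) \<and>
     closed M"

definition abelian_cstar_subalgebra :: "'a::cstar_algebra set \<Rightarrow> bool" where
  "abelian_cstar_subalgebra M \<longleftrightarrow>
     cstar_subalgebra M \<and> (\<forall>a\<in>M. \<forall>b\<in>M. a * b = b * a)"

definition commutant :: "'a::cstar_algebra set \<Rightarrow> 'a set" where
  "commutant M = {a. \<forall>b\<in>M. a * b = b * a}"

definition masa :: "'a::cstar_algebra set \<Rightarrow> bool" where
  "masa D \<longleftrightarrow>
     abelian_cstar_subalgebra D \<and>
     (\<forall>E. abelian_cstar_subalgebra E \<and> D \<subseteq> E \<longrightarrow> E = D)"

definition star_homomorphism :: "('a::cstar_algebra \<Rightarrow> 'b::cstar_algebra) \<Rightarrow> bool" where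
  "star_homomorphism \<rho> \<longleftrightarrow>
     (\<forall>a b. \<rho> (a + b) = \<rho> a + \<rho> b) \<and>
     (\<forall>c a. \<rho> (scaleC c a) = scaleC c (\<rho> a)) \<and>
     (\<forall>a b. \<rho> (a * b) = \<rho> a * \<rho> b) \<and>
     (\<forall>a. \<rho> (star a) = star (\<rho> a))"

(* A functional on a subalgebra M is a function that is "undefined" outside M, so that equality of
   functionals is equality on M.  A state is a positive linear functional of norm one; the bound is
   stated separately because Sup is unspecified on unbounded sets. *)
definition states :: "'a::cstar_algebra set \<Rightarrow> ('a \<Rightarrow> complex) set" where
  "states M = {\<phi>. \<phi> \<in> extensional M \<and>
     (\<forall>a\<in>M. \<forall>b\<in>M. \<phi> (a + b) = \<phi> a + \<phi> b) \<and>
     (\<forall>c. \<forall>a\<in>M. \<phi> (scaleC c a) = c * \<phi> a) \<and>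
     (\<forall>a\<in>M. \<phi> (star a * a) \<in> \<real>\<^sub>\<ge>\<^sub>0) \<and>
     bdd_above ((\<lambda>a. cmod (\<phi> a)) ` {a\<in>M. norm a \<le> 1}) \<and>
     (SUP a\<in>{a\<in>M. norm a \<le> 1}. cmod (\<phi> a)) = 1}"

(* The extreme points of the convex set of states. *)
definition pure_states :: "'a::cstar_algebra set \<Rightarrow> ('a \<Rightarrow> complex) set" where
  "pure_states M = {\<phi> \<in> states M.
     \<forall>\<psi>\<in>states M. \<forall>\<psi>'\<in>states M. \<forall>t. 0 < t \<and> t < 1 \<and>
       (\<forall>a\<in>M. \<phi> a = complex_of_real t * \<psi> a + complex_of_real (1 - t) * \<psi>' a)
       \<longrightarrow> \<psi> = \<phi> \<and> \<psi>' = \<phi>}"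

(* The topology of pointwise convergence on N. *)
definition pure_state_space :: "'a::cstar_algebra set \<Rightarrow> ('a \<Rightarrow> complex) topology" where
  "pure_state_space N = subtopology (product_topology (\<lambda>_. euclidean) N) (pure_states N)"

definition extends_to_state :: "'a::cstar_algebra set \<Rightarrow> ('a \<Rightarrow> complex) \<Rightarrow> ('a \<Rightarrow> complex) \<Rightarrow> bool"
  where "extends_to_state M \<phi> \<psi> \<longleftrightarrow> \<psi> \<in> states UNIV \<and> restrict \<psi> M = \<phi>"

(* Meaningful only when the extension exists and is unique. *)
definition state_extension :: "'a::cstar_algebra set \<Rightarrow> ('a \<Rightarrow> complex) \<Rightarrow> 'a \<Rightarrow> complex" where
  "state_extension M \<phi> = (THE \<psi>. extends_to_state M \<phi> \<psi>)"

(* The target algebras may differ with i and need not be types, so the zero element z i of the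
   i-th target is an argument. *)
definition jointly_faithful ::
    "'i set \<Rightarrow> ('i \<Rightarrow> 'a::cstar_algebra \<Rightarrow> 'b) \<Rightarrow> ('i \<Rightarrow> 'b) \<Rightarrow> bool" where
  "jointly_faithful I \<rho> z \<longleftrightarrow> (\<forall>a. (\<forall>i\<in>I. \<rho> i (star a * a) = z i) \<longrightarrow> a = 0)"

record 'h hilbert =
  hcarrier :: "'h set"
  hzero :: 'h
  hadd :: "'h \<Rightarrow> 'h \<Rightarrow> 'h"
  hscale :: "complex \<Rightarrow> 'h \<Rightarrow> 'h"
  hinner :: "'h \<Rightarrow> 'h \<Rightarrow> complex"

(* Operators are functions that are "undefined" outside the carrier. *)
definition zero_operator :: "'h hilbert \<Rightarrow> 'h \<Rightarrow> 'h" where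
  "zero_operator H = (\<lambda>x\<in>hcarrier H. hzero H)"

(* The seminorm of the form (a, b) \<mapsto> \<phi> (star b * a). *)
definition gns_seminorm :: "('a::cstar_algebra \<Rightarrow> complex) \<Rightarrow> 'a \<Rightarrow> real" where
  "gns_seminorm \<phi> a = sqrt (Re (\<phi> (star a * a)))"

definition gns_cauchy :: "('a::cstar_algebra \<Rightarrow> complex) \<Rightarrow> (nat \<Rightarrow> 'a) set" where
  "gns_cauchy \<phi> = {x. \<forall>e>0. \<exists>k. \<forall>m\<ge>k. \<forall>n\<ge>k. gns_seminorm \<phi> (x m - x n) < e}"

definition gns_rel :: "('a::cstar_algebra \<Rightarrow> complex) \<Rightarrow> ((nat \<Rightarrow> 'a) \<times> (nat \<Rightarrow> 'a)) set" where
  "gns_rel \<phi> = {(x, y). x \<in> gns_cauchy \<phi> \<and> y \<in> gns_cauchy \<phi> \<and>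
     (\<lambda>n. gns_seminorm \<phi> (x n - y n)) \<longlonglongrightarrow> 0}"

(* The completion of A / {a. \<phi> (star a * a) = 0}: Cauchy sequences for the seminorm modulo null
   sequences.  All operations are termwise, and independent of the representatives if \<phi> is a
   positive functional. *)
definition gns_space :: "('a::cstar_algebra \<Rightarrow> complex) \<Rightarrow> (nat \<Rightarrow> 'a) set hilbert" where
  "gns_space \<phi> = \<lparr>
     hcarrier = gns_cauchy \<phi> // gns_rel \<phi>,
     hzero = gns_rel \<phi> `` {\<lambda>_. 0},
     hadd = (\<lambda>X Y. \<Union>x\<in>X. \<Union>y\<in>Y. gns_rel \<phi> `` {\<lambda>n. x n + y n}),
     hscale = (\<lambda>c X. \<Union>x\<in>X. gns_rel \<phi> `` {\<lambda>n. scaleC c (x n)}),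
     hinner = (\<lambda>X Y. lim (\<lambda>n. \<phi> (star ((SOME y. y \<in> Y) n) * (SOME x. x \<in> X) n)))\<rparr>"

(* The continuous extension of left multiplication, b + L \<mapsto> a * b + L. *)
definition gns_rep ::
    "('a::cstar_algebra \<Rightarrow> complex) \<Rightarrow> 'a \<Rightarrow> (nat \<Rightarrow> 'a) set \<Rightarrow> (nat \<Rightarrow> 'a) set" where
  "gns_rep \<phi> a = (\<lambda>X\<in>hcarrier (gns_space \<phi>). \<Union>x\<in>X. gns_rel \<phi> `` {\<lambda>n. a * x n})"

end

(*
  A pure state of an abelian C*-algebra is a character.  Let \<phi> be a character of M with a unique
  extension \<omega> to A.

  If \<rho> is injective on M, it is isometric there, so \<phi> is dominated on M by the seminorm
  a \<mapsto> norm (\<rho> a).  By Hahn-Banach, carried out in the unitizations, \<phi> extends to a state dominated by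
  this seminorm; by uniqueness this is \<omega>, which therefore vanishes on the kernel of \<rho>.

  If a commutes with M, the positive functional x \<mapsto> \<omega> (star a * x * a) restricts to a multiple of \<phi>
  on M, hence is a multiple of \<omega>.  By polarization \<omega> (a * x) = \<omega> a * \<omega> x, so \<omega> is a character on
  the commutant of M.  Joint faithfulness then kills all commutators, and it turns the extensions
  into a separating, hence dense, family of characters of any abelian N between M and A.

  The only spectral theory needed is the norm bound for real polynomials in a selfadjoint h with
  norm h < 1.  Such an h is the real part of the unitary u = h + \<i> * sqrt (1 - h^2), so q h becomes, up
  to a power of u, a polynomial in u, and comparing norms of large powers yields the bound.
*)
theory Submission
  imports Defs
begin

section \<open>C*-algebra basics\<close>

text \<open>Neither A nor M is assumed to have a unit. Its place is taken by an element
  \<open>e\<close> of M on which a given state has the value 1, by an element \<open>u\<close> with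
  norm (a - u a) small for one given a, or by the unit of the unitization. The compression argument
  on the commutant rests on Cauchy-Schwarz: since \<phi> is a character, \<omega> vanishes on star z
  * z for z = m - \<phi> m, hence \<omega> (x * m) = \<omega> x * \<phi> m for all x in A and m in
  M. This identifies the restriction of the compressed functional to M. Hahn-Banach only yields a
  functional of norm one with value 1 at the unit. Its positivity depends on the positivity of star
  a * a. With norm intervals in place of spectra, nonnegativity of a selfadjoint d is expressed by
  norm (t - d) \<le> t. For GNS representations, vanishing of \<omega> on the kernel of \<rho> is
  enough because the kernel is an ideal. For states, the same vanishing is applied directly to star
  a * a.\<close>

lemma scaleC_scaleR: "scaleC c (r *\<^sub>R x) = r *\<^sub>R scaleC c (x::'a::cstar_algebra)"
  by (simp add: scaleR_scaleC scaleC_scaleC mult.commute)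

lemma scaleC_zero_left [simp]: "scaleC 0 (x::'a::cstar_algebra) = 0"
  using scaleR_scaleC[of 0 x] by simp

lemma scaleC_one [simp]: "scaleC 1 (x::'a::cstar_algebra) = x"
  using scaleR_scaleC[of 1 x] by simp

lemma scaleC_zero_right [simp]: "scaleC c (0::'a::cstar_algebra) = 0"
  using scaleC_add_right[of c 0 0] by simp

lemma scaleC_minus_right: "scaleC c (- x) = - scaleC c (x::'a::cstar_algebra)"
  using scaleC_add_right[of c x "- x"] by (simp add: eq_neg_iff_add_eq_0 add.commute)

lemma scaleC_minus_left: "scaleC (- c) x = - scaleC c (x::'a::cstar_algebra)"
  using scaleC_add_left[of c "- c" x] by (simp add: eq_neg_iff_add_eq_0 add.commute)

lemma scaleC_diff_right: "scaleC c (x - y) = scaleC c x - scaleC c (y::'a::cstar_algebra)"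
  using scaleC_add_right[of c x "- y"] by (simp add: scaleC_minus_right)

lemma star_zero [simp]: "star (0::'a::cstar_algebra) = 0"
  using star_add[of "0::'a" 0] by simp

lemma star_minus: "star (- x) = - star (x::'a::cstar_algebra)"
  using star_add[of x "- x"] by (simp add: eq_neg_iff_add_eq_0 add.commute)

lemma star_diff: "star (x - y) = star x - star (y::'a::cstar_algebra)"
  using star_add[of x "- y"] by (simp add: star_minus)

lemma star_scaleR: "star (r *\<^sub>R x) = r *\<^sub>R star (x::'a::cstar_algebra)"
  by (simp add: scaleR_scaleC star_scaleC)

lemma star_sum: "star (\<Sum>i\<in>I. f i) = (\<Sum>i\<in>I. star (f i :: 'a::cstar_algebra))"
  by (induction I rule: infinite_finite_induct) (auto simp: star_add)

text \<open>The C*-identity gives norm x ^ 2 \<le> norm (star x) * norm x; exchanging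
  \<open>x\<close> and \<open>star x\<close> gives the reverse inequality.\<close>

lemma norm_star [simp]: "norm (star x) = norm (x::'a::cstar_algebra)"
proof -
  have le: "norm x \<le> norm (star x)" for x :: 'a
  proof (cases "x = 0")
    case False
    have "norm x * norm x \<le> norm (star x) * norm x"
      using norm_mult_ineq[of "star x" x] by (simp add: cstar_identity power2_eq_square)
    with False show ?thesis by simp
  qed simp
  show ?thesis using le[of x] le[of "star x"] by (simp add: star_star)
qed

lemma cstar_identity': "norm (x * star x) = (norm (x::'a::cstar_algebra))\<^sup>2"
  using cstar_identity[of "star x"] by (simp add: star_star)

lemma star_mult_self_eq_0: "star x * x = 0 \<Longrightarrow> (x::'a::cstar_algebra) = 0"
  using cstar_identity[of x] by simp

lemma norm_selfadjoint_square: "star x = x \<Longrightarrow> norm (x * x) = (norm (x::'a::cstar_algebra))\<^sup>2"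
  using cstar_identity[of x] by simp

lemma bounded_linear_star: "bounded_linear (star :: 'a::cstar_algebra \<Rightarrow> 'a)"
  by (rule bounded_linear_intro[of _ 1]) (auto simp: star_add star_scaleR)

lemmas tendsto_star [tendsto_intros] = bounded_linear.tendsto[OF bounded_linear_star]
lemmas continuous_on_star [continuous_intros] = bounded_linear.continuous_on[OF bounded_linear_star]

lemma bounded_linear_scaleC: "bounded_linear (scaleC c :: 'a::cstar_algebra \<Rightarrow> 'a)"
  by (rule bounded_linear_intro[of _ "cmod c"])
     (auto simp: scaleC_add_right scaleC_scaleR norm_scaleC mult.commute)

lemma cstar_subalgebraD:
  assumes "cstar_subalgebra M"
  shows cstar_subalgebra_zero: "0 \<in> M"
    and cstar_subalgebra_add: "a \<in> M \<Longrightarrow> b \<in> M \<Longrightarrow> a + b \<in> M"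
    and cstar_subalgebra_scaleC: "a \<in> M \<Longrightarrow> scaleC c a \<in> M"
    and cstar_subalgebra_mult: "a \<in> M \<Longrightarrow> b \<in> M \<Longrightarrow> a * b \<in> M"
    and cstar_subalgebra_star: "a \<in> M \<Longrightarrow> star a \<in> M"
    and cstar_subalgebra_closed: "closed M"
  using assms by (auto simp: cstar_subalgebra_def)

lemma cstar_subalgebra_scaleR: "cstar_subalgebra M \<Longrightarrow> a \<in> M \<Longrightarrow> r *\<^sub>R a \<in> M"
  by (simp add: scaleR_scaleC cstar_subalgebra_scaleC)

lemma cstar_subalgebra_minus: "cstar_subalgebra M \<Longrightarrow> a \<in> M \<Longrightarrow> - a \<in> M"
  using cstar_subalgebra_scaleR[of M a "-1"] by simp

lemma cstar_subalgebra_diff: "cstar_subalgebra M \<Longrightarrow> a \<in> M \<Longrightarrow> b \<in> M \<Longrightarrow> a - b \<in> M"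
  using cstar_subalgebra_add[of M a "- b"] cstar_subalgebra_minus[of M b] by simp

lemma cstar_subalgebra_sum: "cstar_subalgebra M \<Longrightarrow> (\<And>i. i \<in> I \<Longrightarrow> f i \<in> M) \<Longrightarrow> sum f I \<in> M"
  by (induction I rule: infinite_finite_induct)
     (auto intro: cstar_subalgebra_add cstar_subalgebra_zero)

lemmas cstar_subalgebra_intros =
  cstar_subalgebra_zero cstar_subalgebra_add cstar_subalgebra_scaleC cstar_subalgebra_mult
  cstar_subalgebra_star cstar_subalgebra_scaleR cstar_subalgebra_minus cstar_subalgebra_diff
  cstar_subalgebra_sum

lemma cstar_subalgebra_UNIV [simp]: "cstar_subalgebra UNIV"
  by (simp add: cstar_subalgebra_def)

lemma star_homomorphismD:
  assumes "star_homomorphism \<rho>"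
  shows star_homomorphism_add: "\<rho> (a + b) = \<rho> a + \<rho> b"
    and star_homomorphism_scaleC: "\<rho> (scaleC c a) = scaleC c (\<rho> a)"
    and star_homomorphism_mult: "\<rho> (a * b) = \<rho> a * \<rho> b"
    and star_homomorphism_star: "\<rho> (star a) = star (\<rho> a)"
  using assms by (auto simp: star_homomorphism_def)

lemma star_homomorphism_linear:
  assumes "star_homomorphism \<rho>"
  shows "linear \<rho>"
  by (rule linearI) (auto simp: star_homomorphismD[OF assms] scaleR_scaleC)

text \<open>The square root of \<open>1 - x\<close> in an algebra without unit: \<open>y\<close> plays the role of
  \<open>1 - sqrt (1 - x)\<close>, a fixed point of \<open>y \<mapsto> (x + y\<^sup>2) / 2\<close>.\<close>
lemma sqrt_one_minus:
  fixes x :: "'a::cstar_algebra"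
  assumes N: "cstar_subalgebra N" and x: "x \<in> N" "star x = x" "norm x < 1"
  obtains y where "y \<in> N" "star y = y" "y + y = x + y * y"
    "\<And>z. z * x = x * z \<Longrightarrow> z * y = y * z"
proof -
  \<comment> \<open>\<open>r\<close> is the smaller root of 2 r = norm x + r^2, so the ball of
    radius \<open>r\<close> is invariant under \<open>f\<close>; since \<open>r\<close> < 1 it also
    serves as the contraction constant.\<close>
  define r where "r = 1 - sqrt (1 - norm x)"
  have r: "0 \<le> r" "r < 1" and rr: "norm x + r * r = 2 * r"
    using x(3) by (auto simp: r_def algebra_simps)
  \<comment> \<open>The last clause makes elements of \<open>S\<close> commute with each other: each
    commutes with \<open>x\<close>, hence with every other one. This is what lets f y - f z factor
    through y - z.\<close>
  define S where "S = {y \<in> N. star y = y \<and> norm y \<le> r \<and> (\<forall>z. z * x = x * z \<longrightarrow> z * y = y * z)}"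
  define f where "f y = (1/2) *\<^sub>R (x + y * y)" for y
  have clS: "closed S"
  proof -
    have eq: "S = N \<inter> {y. star y = y} \<inter> cball 0 r \<inter> (\<Inter>z\<in>{z. z * x = x * z}. {y. z * y = y * z})"
      by (auto simp: S_def)
    have "closed {y::'a. star y = y}"
      by (intro closed_Collect_eq continuous_intros)
    moreover have "closed {y::'a. z * y = y * z}" for z
      by (intro closed_Collect_eq continuous_intros)
    ultimately show ?thesis
      unfolding eq using cstar_subalgebra_closed[OF N] by (intro closed_Int closed_INT) auto
  qed
  have SD: "y \<in> N" "star y = y" "norm y \<le> r" "z * x = x * z \<Longrightarrow> z * y = y * z" if "y \<in> S" for y z
    using that unfolding S_def by blast+
  have fS: "f ` S \<subseteq> S"
  proof (rule image_subsetI)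
    fix y assume y: "y \<in> S"
    have "norm (f y) \<le> (1/2) * (norm x + norm y * norm y)"
      unfolding f_def using norm_triangle_ineq[of x "y * y"] norm_mult_ineq[of y y] by simp
    also have "\<dots> \<le> (1/2) * (norm x + r * r)"
      using SD(3)[OF y] r by (intro mult_left_mono add_left_mono mult_mono) auto
    finally have "norm (f y) \<le> r" by (simp add: rr)
    moreover have "z * f y = f y * z" if "z * x = x * z" for z
    proof -
      have zy: "z * y = y * z" using SD(4)[OF y that] .
      have "z * (y * y) = y * (y * z)" by (metis mult.assoc zy)
      then show ?thesis using that by (simp add: f_def distrib_left distrib_right mult.assoc)
    qed
    moreover have "f y \<in> N"
      using SD(1)[OF y] x unfolding f_def by (intro cstar_subalgebra_intros[OF N])
    moreover have "star (f y) = f y"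
      using SD(2)[OF y] x by (simp add: f_def star_scaleR star_add star_mult)
    ultimately show "f y \<in> S" unfolding S_def by blast
  qed
  have "0 \<in> S" using r cstar_subalgebra_zero[OF N] by (simp add: S_def)
  have lip: "dist (f y) (f z) \<le> r * dist y z" if "y \<in> S" "z \<in> S" for y z
  proof -
    have yx: "y * x = x * y" using SD(4)[OF that(1), of x] by simp
    have zy: "y * z = z * y" using SD(4)[OF that(2) yx] .
    have "f y - f z = (1/2) *\<^sub>R ((y + z) * (y - z))"
      by (simp add: f_def ring_distribs zy flip: scaleR_diff_right)
    then have "dist (f y) (f z) \<le> (1/2) * (norm (y + z) * norm (y - z))"
      using norm_mult_ineq[of "y + z" "y - z"] by (simp add: dist_norm)
    also have "\<dots> \<le> (1/2) * ((r + r) * norm (y - z))"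
      using SD(3)[OF that(1)] SD(3)[OF that(2)] norm_triangle_ineq[of y z]
      by (intro mult_left_mono mult_right_mono) auto
    finally show ?thesis by (simp add: dist_norm)
  qed
  have "\<exists>!y\<in>S. f y = y"
  proof (rule Banach_fix[OF _ _ r fS lip])
    show "complete S" using clS by (simp add: complete_eq_closed)
  qed (use \<open>0 \<in> S\<close> in auto)
  then obtain y where y: "y \<in> S" "f y = y" by auto
  have "y + y = 2 *\<^sub>R f y" using y(2) by (simp add: scaleR_2)
  also have "\<dots> = x + y * y" by (simp add: f_def)
  finally have "y + y = x + y * y" .
  with SD(1,2,4)[OF y(1)] show thesis using that by blast
qed

section \<open>Unitization\<close>

class cstar_algebra_1 = cstar_algebra + real_normed_algebra_1

text \<open>\<open>Unitize a c\<close> stands for a + c 1. A new unit is adjoined even to an algebra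
  that already has one, which avoids case distinctions later.\<close>

datatype 'a unitization = Unitize (elem: 'a) (scal: complex)

lemma unitization_eq_iff: "x = y \<longleftrightarrow> elem x = elem y \<and> scal x = scal y"
  by (auto intro: unitization.expand)

instantiation unitization :: (cstar_algebra) ring_1
begin

definition "0 = Unitize 0 0"
definition "1 = Unitize 0 1"
definition "x + y = Unitize (elem x + elem y) (scal x + scal y)"
definition "x - y = Unitize (elem x - elem y) (scal x - scal y)"
definition "- x = Unitize (- elem x) (- scal x)"
definition "x * y =
  Unitize (elem x * elem y + scaleC (scal x) (elem y) + scaleC (scal y) (elem x)) (scal x * scal y)"

instance
  by standard
     (auto simp: unitization_eq_iff zero_unitization_def one_unitization_def plus_unitization_def
       minus_unitization_def uminus_unitization_def times_unitization_def algebra_simps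
       scaleC_add_right scaleC_add_left scaleC_scaleC mult_scaleC_left mult_scaleC_right)

end

lemma unitization_ring_sel [simp]:
  "elem 0 = 0" "scal 0 = 0" "elem 1 = 0" "scal 1 = 1"
  "elem (x + y) = elem x + elem y" "scal (x + y) = scal x + scal y"
  "elem (x - y) = elem x - elem y" "scal (x - y) = scal x - scal y"
  "elem (- x) = - elem x" "scal (- x) = - scal x"
  "elem (x * y) = elem x * elem y + scaleC (scal x) (elem y) + scaleC (scal y) (elem x)"
  "scal (x * y) = scal x * scal y"
  by (simp_all add: zero_unitization_def one_unitization_def plus_unitization_def
       minus_unitization_def uminus_unitization_def times_unitization_def)

text \<open>The original algebra is an ideal of its unitization, and this is the left action of the
  unitization on that ideal; its operator norm enters the norm below.\<close>

definition left_mult :: "'a::cstar_algebra unitization \<Rightarrow> 'a \<Rightarrow> 'a" where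
  "left_mult y = (\<lambda>x. elem y * x + scaleC (scal y) x)"

lemma bounded_linear_left_mult: "bounded_linear (left_mult y)"
  unfolding left_mult_def
  by (intro bounded_linear_add bounded_linear_scaleC bounded_linear_mult_right)

lemma left_mult_mult: "left_mult (y * z) = left_mult y \<circ> left_mult z"
  by (auto simp: fun_eq_iff left_mult_def algebra_simps mult_scaleC_left mult_scaleC_right
        scaleC_add_right scaleC_scaleC)

lemma norm_left_mult_le: "norm (left_mult y x) \<le> onorm (left_mult y) * norm x"
  by (rule onorm[OF bounded_linear_left_mult])

text \<open>Testing on \<open>star a\<close> turns the C*-identity into the lower bound. Hence the
  embedding into the unitization is isometric.\<close>

lemma onorm_left_mult_embed: "onorm (left_mult (Unitize a 0)) = norm (a::'a::cstar_algebra)"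
proof (rule antisym)
  show "onorm (left_mult (Unitize a 0)) \<le> norm a"
    by (rule onorm_bound) (auto simp: left_mult_def norm_mult_ineq)
  have "norm a * norm a \<le> onorm (left_mult (Unitize a 0)) * norm a"
    using norm_left_mult_le[of "Unitize a 0" "star a"] cstar_identity'[of a]
    by (simp add: left_mult_def power2_eq_square)
  then show "norm a \<le> onorm (left_mult (Unitize a 0))"
    using onorm_pos_le[OF bounded_linear_left_mult, of "Unitize a 0"]
    by (cases "norm a = 0") auto
qed

instantiation unitization :: (cstar_algebra) real_algebra_1
begin

definition "r *\<^sub>R x = Unitize (r *\<^sub>R elem x) (complex_of_real r * scal x)"

instance
  by standard
     (auto simp: unitization_eq_iff scaleR_unitization_def scaleR_scaleC scaleC_scaleC
        scaleC_add_right scaleC_add_left mult_scaleC_left mult_scaleC_right ac_simps distrib_left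
        distrib_right)

end

lemma unitization_scaleR_sel [simp]:
  "elem (r *\<^sub>R x) = r *\<^sub>R elem x" "scal (r *\<^sub>R x) = complex_of_real r * scal x"
  by (simp_all add: scaleR_unitization_def)

text \<open>The maximum with \<open>cmod (scal x)\<close> makes this a norm even when the algebra already has a
  unit, in which case the operator norm alone is only a seminorm.\<close>
instantiation unitization :: (cstar_algebra) real_normed_algebra_1
begin

definition "norm x = max (onorm (left_mult x)) (cmod (scal x))"
definition "dist x y = norm (x - y)" for x :: "'a unitization"
definition "sgn x = x /\<^sub>R norm x" for x :: "'a unitization"
definition [code del]: "uniformity =
  (INF e\<in>{0 <..}. principal {(x :: 'a unitization, y). dist x y < e})"
definition [code del]: "open U \<longleftrightarrow>
  (\<forall>x\<in>U. eventually (\<lambda>(x', y). x' = x \<longrightarrow> y \<in> U) uniformity)" for U :: "'a unitization set"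

instance
proof
  fix x y :: "'a unitization" and r :: real
  show "norm x = 0 \<longleftrightarrow> x = 0"
  proof
    assume n: "norm x = 0"
    then have s: "scal x = 0" and o: "onorm (left_mult x) \<le> 0"
      by (simp_all add: norm_unitization_def max_def split: if_splits)
    have "x = Unitize (elem x) 0" using s by (simp add: unitization_eq_iff)
    then have "norm (elem x) \<le> 0" using o onorm_left_mult_embed[of "elem x"] by simp
    then show "x = 0" using s by (simp add: unitization_eq_iff)
  next
    assume "x = 0"
    then show "norm x = 0"
      by (simp add: norm_unitization_def left_mult_def[abs_def] onorm_zero)
  qed
  have "left_mult (x + y) = (\<lambda>z. left_mult x z + left_mult y z)"
    by (auto simp: left_mult_def fun_eq_iff algebra_simps scaleC_add_left)
  then have "onorm (left_mult (x + y)) \<le> onorm (left_mult x) + onorm (left_mult y)"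
    using onorm_triangle[OF bounded_linear_left_mult bounded_linear_left_mult] by simp
  then show "norm (x + y) \<le> norm x + norm y"
    using norm_triangle_ineq[of "scal x" "scal y"] unfolding norm_unitization_def by (simp add: max_def)
  have "left_mult (r *\<^sub>R x) = (\<lambda>z. r *\<^sub>R left_mult x z)"
    by (auto simp: left_mult_def fun_eq_iff scaleR_scaleC scaleC_scaleC scaleC_add_right mult_scaleC_left)
  then have "onorm (left_mult (r *\<^sub>R x)) = \<bar>r\<bar> * onorm (left_mult x)"
    using onorm_scaleR[OF bounded_linear_left_mult] by simp
  then show "norm (r *\<^sub>R x) = \<bar>r\<bar> * norm x"
    by (simp add: norm_unitization_def norm_mult max_mult_distrib_left)
  have "onorm (left_mult (x * y)) \<le> onorm (left_mult x) * onorm (left_mult y)"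
    unfolding left_mult_mult
    by (intro onorm_compose bounded_linear_left_mult)
  also have "\<dots> \<le> norm x * norm y"
    unfolding norm_unitization_def
    by (intro mult_mono) (auto simp: le_max_iff_disj onorm_pos_le bounded_linear_left_mult)
  finally have "onorm (left_mult (x * y)) \<le> norm x * norm y" .
  moreover have "cmod (scal (x * y)) \<le> norm x * norm y"
    unfolding norm_unitization_def unitization_ring_sel norm_mult
    by (intro mult_mono) (auto simp: le_max_iff_disj)
  ultimately show "norm (x * y) \<le> norm x * norm y"
    unfolding norm_unitization_def[of "x * y"] by simp
  have "left_mult (1 :: 'a unitization) = (\<lambda>z. z)"
    by (auto simp: left_mult_def)
  moreover have "onorm (\<lambda>z::'a. z) \<le> 1"
    by (rule onorm_bound) auto
  ultimately show "norm (1 :: 'a unitization) = 1"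
    by (simp add: norm_unitization_def)
qed (simp_all add: dist_unitization_def sgn_unitization_def uniformity_unitization_def
       open_unitization_def)

end

lemma norm_Unitize [simp]: "norm (Unitize a 0) = norm (a::'a::cstar_algebra)"
  by (simp add: norm_unitization_def onorm_left_mult_embed)

lemma norm_scal_le: "cmod (scal x) \<le> norm x"
  by (simp add: norm_unitization_def)

lemma norm_left_mult: "norm (left_mult y x) \<le> norm y * norm x"
proof -
  have "onorm (left_mult y) * norm x \<le> norm y * norm x"
    by (intro mult_right_mono) (auto simp: norm_unitization_def)
  with norm_left_mult_le[of y x] show ?thesis by linarith
qed

lemma norm_unit_part: "norm (Unitize 0 c :: 'a::cstar_algebra unitization) = cmod c"
proof -
  have "onorm (left_mult (Unitize 0 c :: 'a unitization)) \<le> cmod c"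
    by (rule onorm_bound) (auto simp: left_mult_def norm_scaleC)
  then show ?thesis by (simp add: norm_unitization_def)
qed

text \<open>With \<open>norm_scal_le\<close> and \<open>norm_unitization_le\<close> this shows the
  norm to be equivalent to norm (elem x) + cmod (scal x), so completeness is inherited from the two
  components.\<close>

lemma norm_elem_le: "norm (elem x) \<le> 2 * norm x"
proof -
  have "Unitize (elem x) 0 = x - Unitize 0 (scal x)"
    by (simp add: unitization_eq_iff)
  then have "norm (elem x) \<le> norm x + norm (Unitize 0 (scal x) :: 'a unitization)"
    using norm_triangle_ineq4[of x "Unitize 0 (scal x)"] norm_Unitize[of "elem x"] by simp
  then show ?thesis using norm_scal_le[of x] by (simp add: norm_unit_part)
qed

lemma norm_unitization_le: "norm x \<le> norm (elem x) + cmod (scal x)"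
proof -
  have "x = Unitize (elem x) 0 + Unitize 0 (scal x)"
    by (simp add: unitization_eq_iff)
  then show ?thesis
    using norm_triangle_ineq[of "Unitize (elem x) 0" "Unitize 0 (scal x)"]
    by (simp add: norm_unit_part)
qed

lemma bounded_linear_elem: "bounded_linear (elem :: 'a::cstar_algebra unitization \<Rightarrow> 'a)"
  by (rule bounded_linear_intro[of _ 2]) (auto simp: norm_elem_le mult.commute[of _ 2])

lemma bounded_linear_scal: "bounded_linear (scal :: 'a::cstar_algebra unitization \<Rightarrow> complex)"
  by (rule bounded_linear_intro[of _ 1]) (auto simp: norm_scal_le scaleR_conv_of_real[where 'a=complex])

instance unitization :: (cstar_algebra) banach
proof
  fix X :: "nat \<Rightarrow> 'a unitization" assume X: "Cauchy X"
  obtain a where a: "(\<lambda>n. elem (X n)) \<longlonglongrightarrow> a"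
    using bounded_linear.Cauchy[OF bounded_linear_elem X] Cauchy_convergent convergent_def by blast
  obtain c where c: "(\<lambda>n. scal (X n)) \<longlonglongrightarrow> c"
    using bounded_linear.Cauchy[OF bounded_linear_scal X] Cauchy_convergent convergent_def by blast
  have "(\<lambda>n. norm (elem (X n) - a) + cmod (scal (X n) - c)) \<longlonglongrightarrow> 0"
    using tendsto_add[OF tendsto_norm_zero[OF LIM_zero[OF a]] tendsto_norm_zero[OF LIM_zero[OF c]]]
    by simp
  then have "(\<lambda>n. norm (X n - Unitize a c)) \<longlonglongrightarrow> 0"
  proof (rule Lim_null_comparison[rotated])
    have "norm (norm (X n - Unitize a c)) \<le> norm (elem (X n) - a) + cmod (scal (X n) - c)" for n
      using norm_unitization_le[of "X n - Unitize a c"] by simp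
    then show "\<forall>\<^sub>F n in sequentially. norm (norm (X n - Unitize a c))
        \<le> norm (elem (X n) - a) + cmod (scal (X n) - c)"
      by (rule always_eventually[OF allI])
  qed
  then have "X \<longlonglongrightarrow> Unitize a c"
    by (rule LIM_zero_cancel[OF tendsto_norm_zero_cancel])
  then show "convergent X" by (auto simp: convergent_def)
qed

instantiation unitization :: (cstar_algebra) cstar_algebra_1
begin

definition "scaleC c x = Unitize (scaleC c (elem x)) (c * scal x)"
definition "star x = Unitize (star (elem x)) (cnj (scal x))"

instance
proof
  fix x y :: "'a unitization" and c d :: complex and r :: real
  show "r *\<^sub>R x = scaleC (complex_of_real r) x"
    by (simp add: unitization_eq_iff scaleC_unitization_def scaleR_scaleC)
  show "scaleC c (x + y) = scaleC c x + scaleC c y"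
    by (simp add: unitization_eq_iff scaleC_unitization_def scaleC_add_right algebra_simps)
  show "scaleC (c + d) x = scaleC c x + scaleC d x"
    by (simp add: unitization_eq_iff scaleC_unitization_def scaleC_add_left algebra_simps)
  show "scaleC c (scaleC d x) = scaleC (c * d) x"
    by (simp add: unitization_eq_iff scaleC_unitization_def scaleC_scaleC)
  show "scaleC c x * y = scaleC c (x * y)"
    by (simp add: unitization_eq_iff scaleC_unitization_def scaleC_add_right scaleC_scaleC
        mult_scaleC_left mult.commute)
  show "x * scaleC c y = scaleC c (x * y)"
    by (simp add: unitization_eq_iff scaleC_unitization_def scaleC_add_right scaleC_scaleC
        mult_scaleC_right mult.left_commute) (simp add: mult.commute)
  show "star (star x) = x"
    by (simp add: unitization_eq_iff star_unitization_def star_star)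
  show "star (x + y) = star x + star y"
    by (simp add: unitization_eq_iff star_unitization_def star_add)
  show "star (scaleC c x) = scaleC (cnj c) (star x)"
    by (simp add: unitization_eq_iff star_unitization_def scaleC_unitization_def star_scaleC)
  show "star (x * y) = star y * star x"
    by (simp add: unitization_eq_iff star_unitization_def star_mult star_add star_scaleC)
  have norm_scaleC_le: "norm (scaleC c x) \<le> cmod c * norm x" for c and x :: "'a unitization"
  proof -
    have "scaleC c x = Unitize 0 c * x"
      by (simp add: unitization_eq_iff scaleC_unitization_def)
    then show ?thesis using norm_mult_ineq[of "Unitize 0 c" x] by (simp add: norm_unit_part)
  qed
  show "norm (scaleC c x) = cmod c * norm x"
  proof (cases "c = 0")
    case False
    have "scaleC (inverse c) (scaleC c x) = x"
      using False by (simp add: unitization_eq_iff scaleC_unitization_def scaleC_scaleC)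
    then have "norm x \<le> inverse (cmod c) * norm (scaleC c x)"
      using norm_scaleC_le[of "inverse c" "scaleC c x"] by (simp add: norm_inverse)
    then show ?thesis using norm_scaleC_le[of c x] False by (simp add: field_simps)
  qed (simp add: scaleC_unitization_def flip: zero_unitization_def)
  define p where "p z = onorm (left_mult z)" for z :: "'a unitization"
  have p0: "0 \<le> p z" for z
    unfolding p_def by (rule onorm_pos_le[OF bounded_linear_left_mult])
  have pm: "p (z * w) \<le> p z * p w" for z w
    unfolding p_def left_mult_mult by (intro onorm_compose bounded_linear_left_mult)
  \<comment> \<open>The product star (z w) (z w) = star w ((star z z) w) lies in the original
    algebra for every \<open>w\<close> there, so the C*-identity of that algebra passes to the
    operator seminorm.\<close>
  have le: "(p z)\<^sup>2 \<le> p (star z * z)" for z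
  proof -
    have "norm (left_mult z w) \<le> sqrt (p (star z * z)) * norm w" for w
    proof -
      have "star (left_mult z w) * left_mult z w = star w * left_mult (star z * z) w"
        by (simp add: left_mult_def star_unitization_def star_add star_mult star_scaleC algebra_simps
            mult_scaleC_left mult_scaleC_right scaleC_scaleC scaleC_add_right)
      then have "(norm (left_mult z w))\<^sup>2 \<le> norm w * norm (left_mult (star z * z) w)"
        using norm_mult_ineq[of "star w" "left_mult (star z * z) w"]
        unfolding cstar_identity[symmetric] by simp
      also have "\<dots> \<le> norm w * (p (star z * z) * norm w)"
        unfolding p_def by (intro mult_left_mono norm_left_mult_le) auto
      also have "\<dots> = (sqrt (p (star z * z)) * norm w)\<^sup>2"
        using p0 by (simp add: power2_eq_square algebra_simps)
      finally show ?thesis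
        by (rule power2_le_imp_le) (use p0 in auto)
    qed
    then have "p z \<le> sqrt (p (star z * z))"
      unfolding p_def[of z] using p0 by (intro onorm_bound) auto
    from power_mono[OF this p0, of 2] show ?thesis using p0[of "star z * z"] by simp
  qed
  have star_le: "p z \<le> p (star z)" for z
  proof (cases "p z = 0")
    case False
    have "p z * p z \<le> p (star z) * p z"
      using le[of z] pm[of "star z" z] by (simp add: power2_eq_square)
    then show ?thesis using False p0[of z] by simp
  qed (use p0 in simp)
  have "p (star x) \<le> p x" using star_le[of "star x"]
    by (simp add: unitization_eq_iff star_unitization_def star_star)
  then have "p (star x * x) \<le> (p x)\<^sup>2"
    using pm[of "star x" x] p0[of x] mult_right_mono[of "p (star x)" "p x" "p x"]
    by (simp add: power2_eq_square)
  then have "p (star x * x) = (p x)\<^sup>2" using le by (simp add: antisym)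
  moreover have "cmod (scal (star x * x)) = (cmod (scal x))\<^sup>2"
    by (simp add: star_unitization_def norm_mult power2_eq_square)
  moreover have "max ((p x)\<^sup>2) ((cmod (scal x))\<^sup>2) = (max (p x) (cmod (scal x)))\<^sup>2"
    using p0[of x] power_mono[of "p x" "cmod (scal x)" 2] power_mono[of "cmod (scal x)" "p x" 2]
    by (auto simp: max_def)
  ultimately show "norm (star x * x) = (norm x)\<^sup>2"
    unfolding norm_unitization_def p_def by simp
qed

end

lemma unitization_cstar_sel [simp]:
  "elem (scaleC c x) = scaleC c (elem x)" "scal (scaleC c x) = c * scal x"
  "elem (star x) = star (elem x)" "scal (star x) = cnj (scal x)"
  by (simp_all add: scaleC_unitization_def star_unitization_def)

section \<open>Polynomials in a selfadjoint element\<close>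

text \<open>Horner evaluation with real coefficients at an element of a possibly noncommutative
  algebra; coefficients and argument have different types.\<close>

definition peval :: "real poly \<Rightarrow> 'a::real_algebra_1 \<Rightarrow> 'a" where
  "peval p x = fold_coeffs (\<lambda>a s. of_real a + x * s) p 0"

lemma peval_0 [simp]: "peval 0 x = 0"
  by (simp add: peval_def)

lemma peval_pCons [simp]: "peval (pCons a p) x = of_real a + x * peval p x"
  by (cases "p = 0 \<and> a = 0") (auto simp: peval_def)

lemma peval_1 [simp]: "peval 1 x = 1"
  by (simp add: one_pCons)

lemma peval_add: "peval (p + q) x = peval p x + peval q x"
  by (induction p q rule: poly_induct2) (simp_all add: algebra_simps)

lemma peval_smult: "peval (smult c p) x = c *\<^sub>R peval p x"
  by (induction p) (simp_all add: algebra_simps of_real_def)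

lemma peval_diff: "peval (p - q) x = peval p x - peval q x"
  using peval_add[of "p - q" q x] by simp

lemma peval_mult: "peval (p * q) x = peval p x * peval q x"
  by (induction p) (simp_all add: peval_add peval_smult algebra_simps of_real_def)

lemma peval_power: "peval (p ^ n) x = peval p x ^ n"
  by (induction n) (simp_all add: peval_mult)

lemma peval_monom: "peval (monom a n) x = a *\<^sub>R x ^ n"
  by (induction n) (simp_all add: monom_0 monom_Suc of_real_def)

lemma peval_sum: "peval (\<Sum>i\<in>I. f i) x = (\<Sum>i\<in>I. peval (f i) x)"
  by (induction I rule: infinite_finite_induct) (simp_all add: peval_add)

lemma peval_altdef:
  assumes "degree p \<le> n"
  shows "peval p x = (\<Sum>i\<le>n. coeff p i *\<^sub>R x ^ i)"
proof -
  have "p = (\<Sum>i\<le>n. monom (coeff p i) i)"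
    using poly_as_sum_of_monoms'[OF assms] by simp
  then have "peval p x = peval (\<Sum>i\<le>n. monom (coeff p i) i) x" by simp
  then show ?thesis by (simp add: peval_sum peval_monom)
qed

lemma peval_of_real: "peval p (of_real x) = of_real (poly p x)"
  by (induction p) simp_all

lemma peval_pcompose: "peval (pcompose p q) x = peval p (peval q x)"
  by (induction p) (simp_all add: pcompose_pCons peval_add peval_mult)

lemma peval_commute: "y * x = x * y \<Longrightarrow> y * peval p x = peval p x * y"
proof (induction p)
  case (pCons a p)
  have "y * (x * peval p x) = x * (peval p x * y)"
    using pCons by (metis mult.assoc)
  then show ?case by (simp add: distrib_left distrib_right mult.assoc of_real_def)
qed simp

lemma continuous_on_peval [continuous_intros]:
  "continuous_on S f \<Longrightarrow> continuous_on S (\<lambda>t. peval p (f t :: 'a::real_normed_algebra_1))"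
  by (induction p) (auto intro!: continuous_intros)

text \<open>The set \<open>S\<close> accommodates characters, which are multiplicative only on the
  unitization of a subalgebra; for homomorphisms it is the whole algebra.\<close>

lemma peval_homomorphism:
  fixes f :: "'a::real_algebra_1 \<Rightarrow> 'b::real_algebra_1"
  assumes S: "1 \<in> S" "\<And>a b. a \<in> S \<Longrightarrow> b \<in> S \<Longrightarrow> a + b \<in> S"
    "\<And>r a. a \<in> S \<Longrightarrow> r *\<^sub>R a \<in> S" "\<And>a b. a \<in> S \<Longrightarrow> b \<in> S \<Longrightarrow> a * b \<in> S"
    and f: "f 1 = 1" "\<And>a b. a \<in> S \<Longrightarrow> b \<in> S \<Longrightarrow> f (a + b) = f a + f b"
    "\<And>r a. a \<in> S \<Longrightarrow> f (r *\<^sub>R a) = r *\<^sub>R f a" "\<And>a b. a \<in> S \<Longrightarrow> b \<in> S \<Longrightarrow> f (a * b) = f a * f b"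
    and x: "x \<in> S"
  shows "peval p x \<in> S \<and> f (peval p x) = peval p (f x)"
proof (induction p)
  case 0
  have "0 \<in> S" using S(3)[OF S(1), of 0] by simp
  moreover have "f 0 = 0" using f(3)[OF S(1), of 0] by simp
  ultimately show ?case by simp
next
  case (pCons a p)
  then show ?case using x S f by (simp add: of_real_def)
qed

lemma star_one [simp]: "star 1 = (1::'a::cstar_algebra_1)"
  by (metis mult_1_right star_mult star_star)

lemma star_power: "star (x ^ n) = (star x :: 'a::cstar_algebra_1) ^ n"
  by (induction n) (simp_all add: star_mult power_commutes)

lemma star_peval: "star (peval p x) = peval p (star (x::'a::cstar_algebra_1))"
  by (induction p)
     (simp_all add: star_add star_mult star_scaleR of_real_def peval_commute[of x x] peval_commute)

text \<open>The last assumption says that k = 1 - y satisfies h^2 + k^2 = 1. Stated through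
  \<open>y\<close>, the data are equations without a unit, which any homomorphism preserves.\<close>

lemma unitary_of_selfadjoint:
  fixes h :: "'a::cstar_algebra_1"
  assumes h: "star h = h" and y: "star y = y" "h * y = y * h" "y + y = h * h + y * y"
  obtains u v where "u * v = 1" "v * u = 1" "norm u = 1" "norm v = 1" "h = (1/2) *\<^sub>R (u + v)"
proof -
  define k where "k = 1 - y"
  define u where "u = h + scaleC \<i> k"
  define v where "v = h - scaleC \<i> k"
  have hk: "h * k = k * h" by (simp add: k_def algebra_simps y(2))
  have "h * h + k * k = 1" using y(3) by (simp add: k_def algebra_simps)
  moreover have "u * v = h * h + k * k" "v * u = h * h + k * k"
    by (simp_all add: u_def v_def ring_distribs mult_scaleC_left mult_scaleC_right scaleC_scaleC hk
        scaleC_minus_left scaleC_add_right scaleC_diff_right)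
  ultimately have uv: "u * v = 1" "v * u = 1" by simp_all
  have "star k = k" by (simp add: k_def star_diff y)
  then have "star u = v"
    by (simp add: u_def v_def star_add star_scaleC h scaleC_minus_left)
  then have "norm u = 1" using cstar_identity[of u] uv norm_ge_zero[of u] by (auto simp: power2_eq_1_iff)
  moreover from this have "norm v = 1" using \<open>star u = v\<close> norm_star[of u] by simp
  moreover have "h = (1/2) *\<^sub>R (u + v)"
    by (simp add: u_def v_def flip: scaleR_2)
  ultimately show thesis using that uv by blast
qed

lemma selfadjoint_complement:
  fixes h :: "'a::cstar_algebra"
  assumes h: "star h = h" "norm h < 1"
  obtains y where "star y = y" "h * y = y * h" "y + y = h * h + y * y"
proof -
  have x: "star (h * h) = h * h" "norm (h * h) < 1"
    using h by (simp_all add: star_mult norm_selfadjoint_square power_less_one_iff)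
  obtain y where y: "star y = y" "y + y = h * h + y * y"
    and c: "\<And>z. z * (h * h) = h * h * z \<Longrightarrow> z * y = y * z"
    by (rule sqrt_one_minus[OF cstar_subalgebra_UNIV UNIV_I x]) (rule that)
  have "h * y = y * h" by (rule c) (simp add: mult.assoc)
  with y that show thesis by blast
qed

text \<open>The equations between \<open>h\<close> and its complement \<open>y\<close> are
  algebraic, so \<rho> carries them over and makes \<rho> h the real part of a unitary in the
  unitization. This bounds selfadjoint elements after scaling; the C*-identity does the
  rest.\<close>

lemma star_homomorphism_contractive:
  fixes \<rho> :: "'a::cstar_algebra \<Rightarrow> 'b::cstar_algebra"
  assumes \<rho>: "star_homomorphism \<rho>"
  shows "norm (\<rho> a) \<le> norm a"
proof -
  have 1: "norm (\<rho> h) \<le> 1" if h: "star h = h" "norm h < 1" for h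
  proof -
    obtain y where y: "star y = y" "h * y = y * h" "y + y = h * h + y * y"
      using selfadjoint_complement[OF h] .
    have "\<rho> h * \<rho> y = \<rho> y * \<rho> h" using y(2) by (metis star_homomorphism_mult[OF \<rho>])
    moreover have "\<rho> y + \<rho> y = \<rho> h * \<rho> h + \<rho> y * \<rho> y"
      using y(3) by (metis star_homomorphism_mult[OF \<rho>] star_homomorphism_add[OF \<rho>])
    moreover have "star (\<rho> h) = \<rho> h" "star (\<rho> y) = \<rho> y"
      using h y by (simp_all flip: star_homomorphism_star[OF \<rho>])
    ultimately have "star (Unitize (\<rho> h) 0) = Unitize (\<rho> h) 0" "star (Unitize (\<rho> y) 0) = Unitize (\<rho> y) 0"
      "Unitize (\<rho> h) 0 * Unitize (\<rho> y) 0 = Unitize (\<rho> y) 0 * Unitize (\<rho> h) 0"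
      "Unitize (\<rho> y) 0 + Unitize (\<rho> y) 0
        = Unitize (\<rho> h) 0 * Unitize (\<rho> h) 0 + Unitize (\<rho> y) 0 * Unitize (\<rho> y) 0"
      by (simp_all add: unitization_eq_iff)
    then obtain u v where uv: "norm u = 1" "norm v = 1" "Unitize (\<rho> h) 0 = (1/2) *\<^sub>R (u + v)"
      using unitary_of_selfadjoint by metis
    have "norm (\<rho> h) = norm ((1/2) *\<^sub>R (u + v))"
      using norm_Unitize[of "\<rho> h"] uv(3) by simp
    also have "\<dots> \<le> 1" using norm_triangle_ineq[of u v] uv by simp
    finally show ?thesis .
  qed
  have 2: "norm (\<rho> h) \<le> norm h" if h: "star h = h" for h
  proof (rule field_le_epsilon)
    fix e :: real assume e: "e > 0"
    have "norm h + e > 0" using e by (simp add: add_nonneg_pos)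
    then have "norm (\<rho> ((1 / (norm h + e)) *\<^sub>R h)) \<le> 1"
      using e by (intro 1) (simp_all add: star_scaleR h)
    then show "norm (\<rho> h) \<le> norm h + e"
      using \<open>norm h + e > 0\<close> linear_scale[OF star_homomorphism_linear[OF \<rho>]]
      by (simp add: field_simps)
  qed
  have "(norm (\<rho> a))\<^sup>2 \<le> (norm a)\<^sup>2"
    using 2[of "star a * a"]
    by (simp add: star_mult star_star star_homomorphismD[OF \<rho>] cstar_identity)
  then show ?thesis by (rule power2_le_imp_le) simp
qed

text \<open>Substituting \<open>(X + 1/X) / 2\<close> for the variable of \<open>q\<close> and multiplying by \<open>X ^ n\<close>.\<close>
definition joukowski :: "nat \<Rightarrow> real poly \<Rightarrow> real poly" where
  "joukowski n q = (\<Sum>i\<le>n. smult (coeff q i) (monom 1 (n - i) * [:1/2, 0, 1/2:] ^ i))"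

lemma degree_joukowski: "degree (joukowski n q) \<le> 2 * n"
  unfolding joukowski_def
proof (rule degree_sum_le)
  fix i assume i: "i \<in> {..n}"
  have "degree (monom 1 (n - i) * [:1/2, 0, 1/2:] ^ i :: real poly) \<le> (n - i) + 2 * i"
    by (intro order_trans[OF degree_mult_le] add_mono order_trans[OF degree_power_le])
       (auto simp: degree_monom_eq)
  then show "degree (smult (coeff q i) (monom 1 (n - i) * [:1/2, 0, 1/2:] ^ i)) \<le> 2 * n"
    using i by (intro order_trans[OF degree_smult_le]) auto
qed simp

text \<open>For h = (u + v) / 2 the product u h = (u^2 + 1) / 2 contains no inverse, and u^n h^i =
  u^(n-i) (u h)^i. The identity is applied both to a unitary of the algebra and to complex numbers
  on the unit circle.\<close>

lemma peval_joukowski: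
  fixes u v :: "'a::real_algebra_1"
  assumes uv: "u * v = 1" "v * u = 1" and n: "degree q \<le> n"
  shows "u ^ n * peval q ((1/2) *\<^sub>R (u + v)) = peval (joukowski n q) u"
proof -
  define h where "h = (1/2) *\<^sub>R (u + v)"
  have uh: "u * h = peval [:1/2, 0, 1/2:] u"
    by (simp add: h_def algebra_simps uv of_real_def)
  have c: "u * h = h * u" by (simp add: h_def algebra_simps uv)
  have pow: "u ^ i * h ^ i = (u * h) ^ i" for i
  proof (induction i)
    case (Suc i)
    have "u ^ Suc i * h ^ Suc i = u * (u ^ i * h) * h ^ i"
      by (simp add: mult.assoc)
    also have "u ^ i * h = h * u ^ i"
      using power_commuting_commutes[of u h i] c by simp
    also have "u * (h * u ^ i) * h ^ i = (u * h) * (u ^ i * h ^ i)"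
      by (simp add: mult.assoc)
    finally show ?case using Suc by simp
  qed simp
  have "u ^ n * peval q h = (\<Sum>i\<le>n. coeff q i *\<^sub>R (u ^ n * h ^ i))"
    by (simp add: peval_altdef[OF n] sum_distrib_left)
  also have "\<dots> = (\<Sum>i\<le>n. coeff q i *\<^sub>R (u ^ (n - i) * (u * h) ^ i))"
  proof (intro sum.cong refl)
    fix i assume "i \<in> {..n}"
    then have "u ^ n = u ^ (n - i) * u ^ i" by (simp flip: power_add)
    then show "coeff q i *\<^sub>R (u ^ n * h ^ i) = coeff q i *\<^sub>R (u ^ (n - i) * (u * h) ^ i)"
      using pow[of i] by (simp add: mult.assoc)
  qed
  also have "\<dots> = peval (joukowski n q) u"
    by (simp only: joukowski_def peval_sum peval_smult peval_mult peval_power peval_monom uh scaleR_one)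
  finally show ?thesis by (simp add: h_def)
qed

text \<open>Cauchy's coefficient estimate with the circle integral replaced by an exact average over
  the roots of unity of order \<open>N\<close> = degree Q + 1. Two exponents up to the degree differ
  by less than \<open>N\<close>, so every average except that of exponent \<open>j\<close>
  vanishes.\<close>

lemma coeff_le_circle_bound:
  assumes B: "\<And>z::complex. cmod z = 1 \<Longrightarrow> cmod (peval Q z) \<le> B"
  shows "\<bar>coeff Q j\<bar> \<le> B"
proof (cases "j \<le> degree Q")
  case True
  define n where "n = degree Q"
  define N where "N = Suc n"
  have N0: "N > 0" by (simp add: N_def)
  define w where "w i = cis (2 * pi * (real i - real j) / N)" for i
  have geo: "(\<Sum>k<N. w i ^ k) = (if i = j then of_nat N else 0)" if "i \<le> n" for i
  proof (cases "i = j")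
    case False
    have "w i \<noteq> 1"
    proof
      assume "w i = 1"
      then obtain m :: int where "2 * pi * ((real i - real j) / N) = 2 * pi * m"
        by (auto simp: w_def cis.ctr complex_eq_iff dest!: cos_one_2pi_int[THEN iffD1])
      then have "(real i - real j) / N = m" by (simp only: times_divide_eq_right[symmetric] mult_cancel_left) simp
      then have "real i - real j = m * real N" by (simp add: N_def field_simps)
      then have m: "int i - int j = m * int N" by (metis of_int_of_nat_eq of_int_diff of_int_eq_iff of_int_mult)
      have "\<bar>int i - int j\<bar> < int N" using that True by (simp add: N_def n_def)
      then have "m = 0" unfolding m abs_mult using mult_right_mono[of 1 "\<bar>m\<bar>" "int N"] by fastforce
      with m False show False by simp
    qed
    moreover have "w i ^ N = 1"
    proof -
      have "real N * (2 * pi * (real i - real j) / N) = 2 * pi * of_int (int i - int j)"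
        using N0 by simp
      then have "w i ^ N = cis (2 * pi * of_int (int i - int j))"
        by (simp only: w_def Complex.DeMoivre)
      then show ?thesis by (simp only: cis_multiple_2pi[OF Ints_of_int])
    qed
    ultimately show ?thesis using False by (simp add: geometric_sum)
  qed (simp add: w_def)
  define z where "z k = cis (2 * pi * real k / N)" for k
  have wz: "w i ^ k = z k ^ i * cnj (z k) ^ j" for i k
    by (simp add: w_def z_def Complex.DeMoivre cis_cnj cis_mult) (simp add: field_simps diff_divide_distrib)
  have "(\<Sum>k<N. peval Q (z k) * cnj (z k) ^ j) = (\<Sum>k<N. \<Sum>i\<le>n. of_real (coeff Q i) * w i ^ k)"
    by (simp add: peval_altdef[of Q n] n_def sum_distrib_right wz scaleR_conv_of_real mult.assoc)
  also have "\<dots> = (\<Sum>i\<le>n. of_real (coeff Q i) * (\<Sum>k<N. w i ^ k))"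
    by (subst sum.swap) (simp add: sum_distrib_left)
  also have "\<dots> = (\<Sum>i\<le>n. if i = j then of_real (coeff Q i) * of_nat N else 0)"
    by (intro sum.cong) (auto simp: geo)
  also have "\<dots> = of_real (coeff Q j) * of_nat N" using True by (simp add: n_def)
  finally have "real N * \<bar>coeff Q j\<bar> = cmod (\<Sum>k<N. peval Q (z k) * cnj (z k) ^ j)"
    by (simp add: norm_mult mult.commute)
  also have "\<dots> \<le> (\<Sum>k<N. cmod (peval Q (z k) * cnj (z k) ^ j))" by (rule norm_sum)
  also have "\<dots> \<le> (\<Sum>k<N. B)"
    by (intro sum_mono) (auto simp: norm_mult norm_power z_def intro: B)
  also have "\<dots> = real N * B" by simp
  finally show ?thesis by (simp add: N_def)
next
  case False
  have "0 \<le> B" using order_trans[OF norm_ge_zero B[of 1]] by simp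
  then show ?thesis using False by (simp add: coeff_eq_0)
qed

lemma norm_selfadjoint_power:
  fixes y :: "'a::cstar_algebra_1"
  assumes "star y = y"
  shows "norm (y ^ (2 ^ k)) = norm y ^ (2 ^ k)"
proof (induction k)
  case (Suc k)
  have "norm (y ^ 2 ^ k * y ^ 2 ^ k) = (norm (y ^ 2 ^ k))\<^sup>2"
    by (rule norm_selfadjoint_square) (simp add: star_power assms)
  then show ?case by (simp add: Suc power_mult power2_eq_square mult.commute flip: power_add mult_2)
qed simp

text \<open>If b > B, then (D n + 1) (B / b)^n tends to 0 along n = 2^k but stays at least 1. Only
  these exponents are assumed because iterating the C*-identity controls precisely them.\<close>

lemma le_of_power_le:
  fixes b B :: real
  assumes "0 \<le> b" "0 \<le> B" and le: "\<And>k. b ^ (2 ^ k) \<le> (real D * 2 ^ k + 1) * B ^ (2 ^ k)"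
  shows "b \<le> B"
proof (rule ccontr)
  assume "\<not> b \<le> B"
  then have b: "B < b" "0 < b" using assms by auto
  define c where "c = B / b"
  have c: "0 \<le> c" "c < 1" using b assms by (auto simp: c_def)
  have "(\<lambda>n. real D * (real n * c ^ n) + c ^ n) \<longlonglongrightarrow> real D * 0 + 0"
    using c by (intro tendsto_intros powser_times_n_limit_0 LIMSEQ_power_zero) auto
  moreover have "filterlim (\<lambda>k. 2 ^ k :: nat) sequentially sequentially"
    by (intro filterlim_subseq strict_monoI) auto
  ultimately have "(\<lambda>k. real D * (real (2 ^ k) * c ^ (2 ^ k)) + c ^ (2 ^ k)) \<longlonglongrightarrow> 0"
    using filterlim_compose by fastforce
  then have "\<forall>\<^sub>F k in sequentially. real D * (real (2 ^ k) * c ^ (2 ^ k)) + c ^ (2 ^ k) < 1"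
    by (rule order_tendstoD) simp
  then obtain k where k: "(real D * 2 ^ k + 1) * c ^ (2 ^ k) < 1"
    by (auto simp: eventually_sequentially algebra_simps)
  have "1 \<le> (real D * 2 ^ k + 1) * c ^ (2 ^ k)"
    using le[of k] b by (simp add: c_def power_divide field_simps)
  with k show False by simp
qed

text \<open>With n = m * degree q, the element u^n (q h)^m is a polynomial in \<open>u\<close> of
  degree at most 2 n. On the unit circle the same polynomial equals z^n (q (Re z))^m, so its
  coefficients are at most B^m. As norm u = 1, this gives norm ((q h)^m) \<le> (2 n + 1) B^m, and
  the factor linear in \<open>m\<close> disappears for large powers.\<close>

lemma norm_peval_le_1:
  fixes h :: "'a::cstar_algebra_1"
  assumes h: "star h = h" "norm h < 1" and B: "\<And>x. \<bar>x\<bar> \<le> 1 \<Longrightarrow> \<bar>poly q x\<bar> \<le> B"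
  shows "norm (peval q h) \<le> B"
proof -
  obtain y where y: "star y = y" "h * y = y * h" "y + y = h * h + y * y"
    using selfadjoint_complement[OF h] .
  obtain u v where uv: "u * v = 1" "v * u = 1" "norm u = 1" "norm v = 1" "h = (1/2) *\<^sub>R (u + v)"
    using unitary_of_selfadjoint[OF h(1) y] .
  have B0: "0 \<le> B" using order_trans[OF abs_ge_zero B[of 0]] by simp
  have bound: "norm (peval q h ^ m) \<le> (real (2 * degree q) * real m + 1) * B ^ m" for m
  proof -
    define n where "n = m * degree q"
    have deg: "degree (q ^ m) \<le> n" using degree_power_le[of q m] by (simp add: n_def mult.commute)
    define Q where "Q = joukowski n (q ^ m)"
    have Q: "u ^ n * peval q h ^ m = peval Q u"
      unfolding Q_def peval_joukowski[OF uv(1,2) deg, symmetric] by (simp add: uv(5) peval_power)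
    have co: "\<bar>coeff Q i\<bar> \<le> B ^ m" for i
    proof (rule coeff_le_circle_bound)
      fix z :: complex assume z: "cmod z = 1"
      then have zz: "z * cnj z = 1" by (simp add: complex_norm_square[symmetric])
      have re: "(1/2) *\<^sub>R (z + cnj z) = of_real (Re z)" by (simp add: complex_eq_iff)
      have "peval Q z = z ^ n * of_real (poly q (Re z) ^ m)"
        unfolding Q_def using peval_joukowski[OF zz _ deg] zz
        by (simp add: re peval_of_real mult.commute)
      then have "cmod (peval Q z) = \<bar>poly q (Re z)\<bar> ^ m"
        using z by (simp add: norm_mult norm_power)
      also have "\<dots> \<le> B ^ m"
        using abs_Re_le_cmod[of z] z by (intro power_mono B) auto
      finally show "cmod (peval Q z) \<le> B ^ m" .
    qed
    have un: "norm (x ^ i) \<le> 1" if "norm x = 1" for x :: 'a and i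
      using norm_power_ineq[of x i] that by simp
    have "v ^ n * u ^ n = 1"
    proof -
      have "v ^ i * u ^ i = 1" for i
      proof (induction i)
        case (Suc i)
        have "v ^ Suc i * u ^ Suc i = v * (v ^ i * u ^ i) * u"
          by (simp add: mult.assoc power_commutes)
        then show ?case using Suc uv by simp
      qed simp
      then show ?thesis .
    qed
    then have "peval q h ^ m = v ^ n * (u ^ n * peval q h ^ m)"
      by (simp flip: mult.assoc)
    also have "norm \<dots> \<le> 1 * norm (peval Q u)"
      unfolding Q by (intro order_trans[OF norm_mult_ineq] mult_right_mono un uv) auto
    also have "norm (peval Q u) = norm (\<Sum>i\<le>2*n. coeff Q i *\<^sub>R u ^ i)"
      using degree_joukowski[of n "q ^ m"] by (simp add: peval_altdef Q_def)
    also have "\<dots> \<le> (\<Sum>i\<le>2*n. B ^ m)"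
    proof (rule sum_norm_le)
      fix i
      have "\<bar>coeff Q i\<bar> * norm (u ^ i) \<le> B ^ m * 1"
        using co un[OF uv(3)] B0 by (intro mult_mono) auto
      then show "norm (coeff Q i *\<^sub>R u ^ i) \<le> B ^ m" by simp
    qed
    finally show ?thesis by (simp add: n_def algebra_simps)
  qed
  show ?thesis
  proof (rule le_of_power_le[of _ _ "2 * degree q"])
    fix k
    have "norm (peval q h) ^ 2 ^ k = norm (peval q h ^ 2 ^ k)"
      by (simp add: norm_selfadjoint_power star_peval h)
    also have "\<dots> \<le> (real (2 * degree q) * real (2 ^ k) + 1) * B ^ 2 ^ k" by (rule bound)
    finally show "norm (peval q h) ^ 2 ^ k \<le> (real (2 * degree q) * 2 ^ k + 1) * B ^ 2 ^ k" by simp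
  qed (use B0 in auto)
qed

text \<open>After rescaling the interval to [-1, 1], the element is shrunk by a factor c < 1 to meet
  the strict inequality required for the unitary; continuity as c tends to 1 recovers the closed
  case.\<close>

theorem norm_peval_le:
  fixes h :: "'a::cstar_algebra_1"
  assumes h: "star h = h" "norm h \<le> r" and B: "\<And>x. \<bar>x\<bar> \<le> r \<Longrightarrow> \<bar>poly q x\<bar> \<le> B"
  shows "norm (peval q h) \<le> B"
proof (cases "r > 0")
  case True
  have le: "norm (peval q (c *\<^sub>R h)) \<le> B" if c: "0 < c" "c < 1" for c
  proof -
    have "norm (peval (pcompose q [:0, r:]) ((c / r) *\<^sub>R h)) \<le> B"
    proof (rule norm_peval_le_1)
      have "norm ((c / r) *\<^sub>R h) \<le> c" using h(2) True c by (simp add: field_simps mult_left_mono)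
      then show "norm ((c / r) *\<^sub>R h) < 1" using c by simp
      fix x :: real assume "\<bar>x\<bar> \<le> 1"
      then show "\<bar>poly (pcompose q [:0, r:]) x\<bar> \<le> B"
        using True by (auto simp: poly_pcompose abs_mult intro!: B mult_left_le)
    qed (simp add: star_scaleR h)
    then show ?thesis using True by (simp add: peval_pcompose of_real_def)
  qed
  have "continuous_on UNIV (\<lambda>c::real. norm (peval q (c *\<^sub>R h)))"
    by (intro continuous_intros)
  then have "((\<lambda>c::real. norm (peval q (c *\<^sub>R h))) \<longlongrightarrow> norm (peval q (1 *\<^sub>R h))) (at 1)"
    unfolding continuous_on_def by blast
  then have "((\<lambda>c::real. norm (peval q (c *\<^sub>R h))) \<longlongrightarrow> norm (peval q (1 *\<^sub>R h))) (at_left 1)"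
    by (rule tendsto_mono[OF at_le[OF subset_UNIV]])
  moreover have "\<forall>\<^sub>F c in at_left (1::real). norm (peval q (c *\<^sub>R h)) \<le> B"
    using eventually_at_left_real[of 0 "1::real"] by (rule eventually_mono) (auto intro: le)
  ultimately show ?thesis
    using tendsto_upperbound[of _ _ "at_left (1::real)" B] by simp
next
  case False
  then have "norm h = 0" "r = 0" using h(2) norm_ge_zero[of h] by linarith+
  then have "h = of_real 0" "r = 0" by simp_all
  then show ?thesis using B[of 0] by (simp add: peval_of_real del: of_real_0)
qed

section \<open>Continuous functional calculus and positivity\<close>

lemma real_poly_approximation:
  fixes f :: "real \<Rightarrow> real"
  assumes "continuous_on {-r..r} f" "e > 0"
  obtains q where "\<And>x. \<bar>x\<bar> \<le> r \<Longrightarrow> \<bar>f x - poly q x\<bar> \<le> e"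
proof -
  obtain g where g: "real_polynomial_function g" "\<And>x. x \<in> {-r..r} \<Longrightarrow> \<bar>f x - g x\<bar> < e"
    using Stone_Weierstrass_real_polynomial_function[OF compact_Icc assms] by blast
  obtain a n where "g = (\<lambda>x. \<Sum>i\<le>n. a i * x ^ i)"
    using g(1) real_polynomial_function_iff_sum by blast
  then have "g x = poly (\<Sum>i\<le>n. monom (a i) i) x" for x
    by (simp add: poly_sum poly_monom)
  moreover have "\<bar>f x - g x\<bar> \<le> e" if "\<bar>x\<bar> \<le> r" for x
  proof -
    have "x \<in> {-r..r}" using that by auto
    from g(2)[OF this] show ?thesis by simp
  qed
  ultimately show thesis using that by metis
qed

lemma real_poly_approximation_seq:
  fixes f :: "real \<Rightarrow> real"
  assumes "continuous_on {-r..r} f"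
  obtains q where "\<forall>n x. \<bar>x\<bar> \<le> r \<longrightarrow> \<bar>f x - poly (q n) x\<bar> \<le> inverse (real (Suc n))"
proof -
  have "\<exists>q. \<forall>x. \<bar>x\<bar> \<le> r \<longrightarrow> \<bar>f x - poly q x\<bar> \<le> inverse (real (Suc n))" for n
    using real_poly_approximation[OF assms, of "inverse (real (Suc n))"] by auto
  then obtain q where "\<forall>n x. \<bar>x\<bar> \<le> r \<longrightarrow> \<bar>f x - poly (q n) x\<bar> \<le> inverse (real (Suc n))"
    using choice[of "\<lambda>n q. \<forall>x. \<bar>x\<bar> \<le> r \<longrightarrow> \<bar>f x - poly q x\<bar> \<le> inverse (real (Suc n))"] by blast
  then show thesis using that by blast
qed

text \<open>The continuous functional calculus of a selfadjoint element.  The interval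
  \<open>[-norm h, norm h]\<close> takes the place of the spectrum, so \<open>f \<mapsto> cfc h f\<close> is not injective.\<close>
definition cfc :: "'a::cstar_algebra_1 \<Rightarrow> (real \<Rightarrow> real) \<Rightarrow> 'a" where
  "cfc h f = (SOME z. \<forall>q e. (\<forall>x. \<bar>x\<bar> \<le> norm h \<longrightarrow> \<bar>f x - poly q x\<bar> \<le> e) \<longrightarrow> norm (z - peval q h) \<le> e)"

text \<open>This provides the element selected by \<open>SOME\<close>: approximating polynomials,
  evaluated at \<open>h\<close>, form a Cauchy sequence by \<open>norm_peval_le\<close>, and its
  limit satisfies the estimate for all \<open>q\<close> and \<open>e\<close> at once.\<close>

lemma cfc_approx:
  fixes h :: "'a::cstar_algebra_1"
  assumes h: "star h = h" and f: "continuous_on {-norm h..norm h} f"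
    and q: "\<And>x. \<bar>x\<bar> \<le> norm h \<Longrightarrow> \<bar>f x - poly q x\<bar> \<le> e"
  shows "norm (cfc h f - peval q h) \<le> e"
proof -
  obtain p where p: "\<forall>n x. \<bar>x\<bar> \<le> norm h \<longrightarrow> \<bar>f x - poly (p n) x\<bar> \<le> inverse (real (Suc n))"
    using real_poly_approximation_seq[OF f] .
  have bound: "norm (peval (p n) h - peval q h) \<le> inverse (real (Suc n)) + e"
    if "\<And>x. \<bar>x\<bar> \<le> norm h \<Longrightarrow> \<bar>f x - poly q x\<bar> \<le> e" for n q e
    unfolding peval_diff[symmetric]
  proof (rule norm_peval_le[OF h order_refl])
    fix x assume "\<bar>x\<bar> \<le> norm h"
    with p[rule_format, of x n] that[of x] show "\<bar>poly (p n - q) x\<bar> \<le> inverse (real (Suc n)) + e" by simp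
  qed
  have "Cauchy (\<lambda>n. peval (p n) h)"
  proof (rule CauchyI)
    fix e :: real assume "e > 0"
    then obtain N where N: "inverse (real (Suc N)) < e / 2"
      using reals_Archimedean[of "e / 2"] by auto
    have "norm (peval (p m) h - peval (p n) h) < e" if "m \<ge> N" "n \<ge> N" for m n
    proof -
      have "inverse (real (Suc k)) \<le> inverse (real (Suc N))" if "k \<ge> N" for k
        using that by (simp add: field_simps)
      from this[OF that(1)] this[OF that(2)] N
      have "inverse (real (Suc m)) + inverse (real (Suc n)) < e" by linarith
      moreover have "norm (peval (p m) h - peval (p n) h) \<le> inverse (real (Suc m)) + inverse (real (Suc n))"
        by (rule bound) (rule p[rule_format])
      ultimately show ?thesis by linarith
    qed
    then show "\<exists>M. \<forall>m\<ge>M. \<forall>n\<ge>M. norm (peval (p m) h - peval (p n) h) < e" by blast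
  qed
  then obtain z where z: "(\<lambda>n. peval (p n) h) \<longlonglongrightarrow> z"
    using Cauchy_convergent convergent_def by blast
  have "norm (z - peval q h) \<le> e" if "\<And>x. \<bar>x\<bar> \<le> norm h \<Longrightarrow> \<bar>f x - poly q x\<bar> \<le> e" for q e
  proof (rule LIMSEQ_le)
    show "(\<lambda>n. norm (peval (p n) h - peval q h)) \<longlonglongrightarrow> norm (z - peval q h)"
      by (intro tendsto_intros z)
    show "(\<lambda>n. inverse (real (Suc n)) + e) \<longlonglongrightarrow> e"
      using tendsto_add[OF LIMSEQ_inverse_real_of_nat tendsto_const[of e]] by simp
  qed (use bound[OF that] in auto)
  then have "\<exists>z. \<forall>q e. (\<forall>x. \<bar>x\<bar> \<le> norm h \<longrightarrow> \<bar>f x - poly q x\<bar> \<le> e) \<longrightarrow> norm (z - peval q h) \<le> e"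
    by blast
  from someI_ex[OF this, folded cfc_def] q show ?thesis by blast
qed

lemma tendsto_cfc:
  fixes h :: "'a::cstar_algebra_1"
  assumes h: "star h = h" and f: "continuous_on {-norm h..norm h} f"
    and q: "\<And>n x. \<bar>x\<bar> \<le> norm h \<Longrightarrow> \<bar>f x - poly (q n) x\<bar> \<le> e n" and e: "e \<longlonglongrightarrow> 0"
  shows "(\<lambda>n. peval (q n) h) \<longlonglongrightarrow> cfc h f"
proof (rule LIM_zero_cancel, rule Lim_null_comparison[OF always_eventually e], rule allI)
  show "norm (peval (q n) h - cfc h f) \<le> e n" for n
    using cfc_approx[OF h f q, of n] by (simp add: norm_minus_commute)
qed

lemma cfc_sequence:
  fixes h :: "'a::cstar_algebra_1"
  assumes h: "star h = h" and f: "continuous_on {-norm h..norm h} f"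
  obtains q where "(\<lambda>n. peval (q n) h) \<longlonglongrightarrow> cfc h f"
    "\<forall>n x. \<bar>x\<bar> \<le> norm h \<longrightarrow> \<bar>f x - poly (q n) x\<bar> \<le> inverse (real (Suc n))"
proof -
  obtain q where q: "\<forall>n x. \<bar>x\<bar> \<le> norm h \<longrightarrow> \<bar>f x - poly (q n) x\<bar> \<le> inverse (real (Suc n))"
    using real_poly_approximation_seq[OF f] .
  from that[OF tendsto_cfc[OF h f q[rule_format] LIMSEQ_inverse_real_of_nat] q] show thesis by assumption
qed

lemma norm_cfc_le:
  assumes "star h = h" "continuous_on {-norm h..norm h} f" "\<And>x. \<bar>x\<bar> \<le> norm h \<Longrightarrow> \<bar>f x\<bar> \<le> e"
  shows "norm (cfc h f) \<le> e"
  using cfc_approx[of h f 0 e] assms by simp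

lemma cfc_poly: "star h = h \<Longrightarrow> cfc h (poly q) = peval q h"
  using cfc_approx[of h "poly q" q 0] by (simp add: continuous_on_poly)

lemma cfc_ident: "star h = h \<Longrightarrow> cfc h (\<lambda>x. x) = h"
  using cfc_poly[of h "[:0, 1:]"] by (simp add: fun_eq_iff[THEN iffD2, of "poly [:0, 1:]" "\<lambda>x. x"])

lemma cfc_add:
  fixes h :: "'a::cstar_algebra_1"
  assumes h: "star h = h" and f: "continuous_on {-norm h..norm h} f"
    and g: "continuous_on {-norm h..norm h} g"
  shows "cfc h (\<lambda>x. f x + g x) = cfc h f + cfc h g"
proof -
  obtain p where p: "(\<lambda>n. peval (p n) h) \<longlonglongrightarrow> cfc h f"
    "\<forall>n x. \<bar>x\<bar> \<le> norm h \<longrightarrow> \<bar>f x - poly (p n) x\<bar> \<le> inverse (real (Suc n))"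
    using cfc_sequence[OF h f] .
  obtain q where q: "(\<lambda>n. peval (q n) h) \<longlonglongrightarrow> cfc h g"
    "\<forall>n x. \<bar>x\<bar> \<le> norm h \<longrightarrow> \<bar>g x - poly (q n) x\<bar> \<le> inverse (real (Suc n))"
    using cfc_sequence[OF h g] .
  have "(\<lambda>n. peval (p n + q n) h) \<longlonglongrightarrow> cfc h (\<lambda>x. f x + g x)"
  proof (rule tendsto_cfc[OF h])
    show "(\<lambda>n. 2 * inverse (real (Suc n))) \<longlonglongrightarrow> 0"
      using tendsto_mult_right_zero[OF LIMSEQ_inverse_real_of_nat] by simp
    fix n x assume "\<bar>x\<bar> \<le> norm h"
    from p(2)[rule_format, OF this, of n] q(2)[rule_format, OF this, of n]
    show "\<bar>f x + g x - poly (p n + q n) x\<bar> \<le> 2 * inverse (real (Suc n))" by simp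
  qed (intro continuous_intros f g)
  moreover have "(\<lambda>n. peval (p n + q n) h) \<longlonglongrightarrow> cfc h f + cfc h g"
    unfolding peval_add by (intro tendsto_intros p q)
  ultimately show ?thesis by (rule LIMSEQ_unique)
qed

lemma cfc_mult:
  fixes h :: "'a::cstar_algebra_1"
  assumes h: "star h = h" and f: "continuous_on {-norm h..norm h} f"
    and g: "continuous_on {-norm h..norm h} g"
  shows "cfc h (\<lambda>x. f x * g x) = cfc h f * cfc h g"
proof -
  obtain p where p: "(\<lambda>n. peval (p n) h) \<longlonglongrightarrow> cfc h f"
    "\<forall>n x. \<bar>x\<bar> \<le> norm h \<longrightarrow> \<bar>f x - poly (p n) x\<bar> \<le> inverse (real (Suc n))"
    using cfc_sequence[OF h f] .
  obtain q where q: "(\<lambda>n. peval (q n) h) \<longlonglongrightarrow> cfc h g"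
    "\<forall>n x. \<bar>x\<bar> \<le> norm h \<longrightarrow> \<bar>g x - poly (q n) x\<bar> \<le> inverse (real (Suc n))"
    using cfc_sequence[OF h g] .
  have "bounded (f ` {-norm h..norm h})" "bounded (g ` {-norm h..norm h})"
    by (intro compact_imp_bounded compact_continuous_image f g compact_Icc)+
  then obtain F G where "\<forall>x\<in>{-norm h..norm h}. \<bar>f x\<bar> \<le> F" "\<forall>x\<in>{-norm h..norm h}. \<bar>g x\<bar> \<le> G"
    unfolding bounded_iff by auto
  then have FG: "\<bar>f x\<bar> \<le> F" "\<bar>g x\<bar> \<le> G" if "\<bar>x\<bar> \<le> norm h" for x
    using that by (auto simp: abs_le_iff)
  have "(\<lambda>n. peval (p n * q n) h) \<longlonglongrightarrow> cfc h (\<lambda>x. f x * g x)"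
  proof (rule tendsto_cfc[OF h])
    show "(\<lambda>n. (F + G + 1) * inverse (real (Suc n))) \<longlonglongrightarrow> 0"
      using tendsto_mult_right_zero[OF LIMSEQ_inverse_real_of_nat] by simp
    fix n x assume x: "\<bar>x\<bar> \<le> norm h"
    define e where "e = inverse (real (Suc n))"
    have e: "0 \<le> e" "e \<le> 1" by (auto simp: e_def field_simps)
    have b: "\<bar>f x - poly (p n) x\<bar> \<le> e" "\<bar>g x - poly (q n) x\<bar> \<le> e" "\<bar>f x\<bar> \<le> F" "\<bar>g x\<bar> \<le> G"
      using p(2)[rule_format, OF x] q(2)[rule_format, OF x] FG[OF x] by (auto simp: e_def)
    have "f x * g x - poly (p n * q n) x
        = f x * (g x - poly (q n) x) + (f x - poly (p n) x) * poly (q n) x"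
      by (simp add: algebra_simps)
    also have "\<bar>\<dots>\<bar> \<le> \<bar>f x\<bar> * \<bar>g x - poly (q n) x\<bar> + \<bar>f x - poly (p n) x\<bar> * \<bar>poly (q n) x\<bar>"
      by (metis abs_mult abs_triangle_ineq)
    also have "\<dots> \<le> F * e + e * (G + 1)"
      using b e by (intro add_mono mult_mono) auto
    finally show "\<bar>f x * g x - poly (p n * q n) x\<bar> \<le> (F + G + 1) * inverse (real (Suc n))"
      by (simp add: e_def algebra_simps)
  qed (intro continuous_intros f g)
  moreover have "(\<lambda>n. peval (p n * q n) h) \<longlonglongrightarrow> cfc h f * cfc h g"
    unfolding peval_mult by (intro tendsto_intros p q)
  ultimately show ?thesis by (rule LIMSEQ_unique)
qed

lemma star_cfc:
  assumes h: "star h = h" and f: "continuous_on {-norm h..norm h} f"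
  shows "star (cfc h f) = cfc h f"
proof -
  obtain p where p: "(\<lambda>n. peval (p n) h) \<longlonglongrightarrow> cfc h f"
    using cfc_sequence[OF h f] .
  from tendsto_star[OF p] have "(\<lambda>n. peval (p n) h) \<longlonglongrightarrow> star (cfc h f)"
    by (simp add: star_peval h)
  from this p show ?thesis by (rule LIMSEQ_unique)
qed

lemma peval_mem:
  assumes N: "cstar_subalgebra N" and h: "h \<in> N" and q: "poly q 0 = 0"
  shows "peval q h \<in> N"
proof -
  have mem: "h * peval p h \<in> N" for p
  proof (induction p)
    case (pCons a p)
    have "a *\<^sub>R h + h * (h * peval p h) \<in> N"
      by (rule cstar_subalgebra_add[OF N cstar_subalgebra_scaleR[OF N h]
            cstar_subalgebra_mult[OF N h pCons.IH]])
    then show ?case by (simp add: distrib_left of_real_def)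
  qed (simp add: cstar_subalgebra_zero[OF N])
  show ?thesis
  proof (cases q)
    case (pCons a p)
    then show ?thesis using q mem[of p] by simp
  qed
qed

text \<open>\<open>N\<close> may lack the unit, so the constant terms of the approximating
  polynomials are subtracted. Since f 0 = 0 they are bounded by the approximation error, which at
  most doubles.\<close>

lemma cfc_mem:
  fixes h :: "'a::cstar_algebra_1"
  assumes N: "cstar_subalgebra N" and hN: "h \<in> N" and h: "star h = h"
    and f: "continuous_on {-norm h..norm h} f" "f 0 = 0"
  shows "cfc h f \<in> N"
proof -
  obtain q where q: "\<forall>n x. \<bar>x\<bar> \<le> norm h \<longrightarrow> \<bar>f x - poly (q n) x\<bar> \<le> inverse (real (Suc n))"
    using real_poly_approximation_seq[OF f(1)] .
  define p where "p n = q n - [:poly (q n) 0:]" for n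
  have "(\<lambda>n. peval (p n) h) \<longlonglongrightarrow> cfc h f"
  proof (rule tendsto_cfc[OF h f(1)])
    show "(\<lambda>n. 2 * inverse (real (Suc n))) \<longlonglongrightarrow> 0"
      using tendsto_mult_right_zero[OF LIMSEQ_inverse_real_of_nat] by simp
    fix n x assume "\<bar>x\<bar> \<le> norm h"
    from q[rule_format, OF this, of n] q[rule_format, of 0 n] f(2)
    show "\<bar>f x - poly (p n) x\<bar> \<le> 2 * inverse (real (Suc n))" by (simp add: p_def)
  qed
  moreover have "peval (p n) h \<in> N" for n
    by (rule peval_mem[OF N hN]) (simp add: p_def)
  ultimately show ?thesis
    using closed_sequentially[OF cstar_subalgebra_closed[OF N], of "\<lambda>n. peval (p n) h"] by simp
qed

text \<open>Contractivity enters twice: it makes \<rho> continuous, and it places the interval of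
  \<rho> h inside that of \<open>h\<close>, so one sequence of polynomials serves both
  sides.\<close>

lemma cfc_homomorphism:
  fixes \<rho> :: "'a::cstar_algebra_1 \<Rightarrow> 'b::cstar_algebra_1"
  assumes \<rho>: "star_homomorphism \<rho>" "\<rho> 1 = 1" and h: "star h = h"
    and f: "continuous_on {-norm h..norm h} f"
  shows "\<rho> (cfc h f) = cfc (\<rho> h) f"
proof -
  have blr: "bounded_linear \<rho>"
    using star_homomorphism_contractive[OF \<rho>(1)] linear_add[OF star_homomorphism_linear[OF \<rho>(1)]]
      linear_scale[OF star_homomorphism_linear[OF \<rho>(1)]]
    by (intro bounded_linear_intro[of _ 1]) auto
  obtain q where q: "(\<lambda>n. peval (q n) h) \<longlonglongrightarrow> cfc h f"
    "\<forall>n x. \<bar>x\<bar> \<le> norm h \<longrightarrow> \<bar>f x - poly (q n) x\<bar> \<le> inverse (real (Suc n))"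
    using cfc_sequence[OF h f] .
  have le: "norm (\<rho> h) \<le> norm h" by (rule star_homomorphism_contractive[OF \<rho>(1)])
  have hom: "\<rho> (peval p h) = peval p (\<rho> h)" for p
    using peval_homomorphism[of UNIV \<rho> h p] \<rho>(2) star_homomorphismD[OF \<rho>(1)]
      linear_scale[OF star_homomorphism_linear[OF \<rho>(1)]] by auto
  have "(\<lambda>n. peval (q n) (\<rho> h)) \<longlonglongrightarrow> \<rho> (cfc h f)"
    using bounded_linear.tendsto[OF blr q(1)] by (simp add: hom)
  moreover have "(\<lambda>n. peval (q n) (\<rho> h)) \<longlonglongrightarrow> cfc (\<rho> h) f"
  proof (rule tendsto_cfc)
    show "star (\<rho> h) = \<rho> h" using h by (simp flip: star_homomorphism_star[OF \<rho>(1)])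
    show "continuous_on {- norm (\<rho> h)..norm (\<rho> h)} f"
      using le by (intro continuous_on_subset[OF f]) auto
    show "\<bar>f x - poly (q n) x\<bar> \<le> inverse (real (Suc n))" if "\<bar>x\<bar> \<le> norm (\<rho> h)" for n x
      using that le by (intro q(2)[rule_format]) simp
  qed (rule LIMSEQ_inverse_real_of_nat)
  ultimately show ?thesis by (rule LIMSEQ_unique)
qed

text \<open>For selfadjoint \<open>d\<close>, the condition norm (t - d) \<le> t expresses that the
  spectrum lies in [0, 2 t]. The substitution x = t - y carries this interval to [-t, t].\<close>

lemma norm_peval_le_shifted:
  fixes d :: "'a::cstar_algebra_1"
  assumes d: "star d = d" "norm (of_real t - d) \<le> t"
    and B: "\<And>x. 0 \<le> x \<Longrightarrow> x \<le> 2 * t \<Longrightarrow> \<bar>poly q x\<bar> \<le> B"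
  shows "norm (peval q d) \<le> B"
proof -
  have "peval q d = peval (pcompose q [:t, -1:]) (of_real t - d)"
    by (simp add: peval_pcompose)
  also have "norm \<dots> \<le> B"
  proof (rule norm_peval_le[OF _ d(2)])
    show "star (of_real t - d) = of_real t - d"
      by (simp add: star_diff of_real_def star_scaleR d)
    show "\<bar>poly (pcompose q [:t, -1:]) x\<bar> \<le> B" if "\<bar>x\<bar> \<le> t" for x
      using that by (auto simp: poly_pcompose intro!: B)
  qed
  finally show ?thesis .
qed

lemma norm_of_real_minus_square:
  fixes x :: "'a::cstar_algebra_1"
  assumes "star x = x"
  shows "norm (of_real ((norm x)\<^sup>2) - x * x) \<le> (norm x)\<^sup>2"
proof -
  have "peval [:(norm x)\<^sup>2, 0, -1:] x = of_real ((norm x)\<^sup>2) - x * x"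
    by simp
  moreover have "norm (peval [:(norm x)\<^sup>2, 0, -1:] x) \<le> (norm x)\<^sup>2"
  proof (rule norm_peval_le[OF assms order_refl])
    fix y :: real assume "\<bar>y\<bar> \<le> norm x"
    then have "y\<^sup>2 \<le> (norm x)\<^sup>2" using abs_le_square_iff[of y "norm x"] by simp
    then show "\<bar>poly [:(norm x)\<^sup>2, 0, -1:] y\<bar> \<le> (norm x)\<^sup>2"
      by (simp add: power2_eq_square)
  qed
  ultimately show ?thesis by simp
qed

text \<open>The algebraic substitute for the agreement of the spectra of b * c and c * b away from
  0.\<close>

lemma peval_swap: "b * peval p (c * b) = peval p (b * c) * (b::'a::real_algebra_1)"
proof (induction p)
  case (pCons a p)
  have "b * (c * b * peval p (c * b)) = b * c * (b * peval p (c * b))" by (simp add: mult.assoc)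
  then show ?case by (simp add: distrib_left distrib_right of_real_def pCons mult.assoc)
qed simp

text \<open>The spectra of \<open>b * star b\<close> and \<open>star b * b\<close> agree up to \<open>0\<close>, so if one is nonnegative and
  the other nonpositive, both elements vanish.\<close>
lemma mult_star_opposite_signs:
  fixes b :: "'a::cstar_algebra_1"
  assumes pos: "norm (of_real t - b * star b) \<le> t" and neg: "norm (of_real s + star b * b) \<le> s"
  shows "b = 0"
proof -
  define d where "d = b * star b"
  define X where "X = star b * b"
  have sd: "star d = d" "star X = X" by (simp_all add: d_def X_def star_mult star_star)
  define K where "K = max (2 * t) (2 * s)"
  \<comment> \<open>The coefficients of the three errors below, which add up to
    \<open>\<delta>\<^sup>2 * C = e\<close>.\<close>
  define C where "C = 1 + K\<^sup>2 + (norm b)\<^sup>2 * K"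
  have t0: "0 \<le> t" using order_trans[OF norm_ge_zero pos] .
  then have K: "0 \<le> K" by (simp add: K_def)
  have C: "1 \<le> C" using K by (simp add: C_def)
  have "norm (d * d) \<le> 0"
  proof (rule field_le_epsilon)
    fix e :: real assume e: "e > 0"
    define \<delta> where "\<delta> = sqrt (e / C)"
    have \<delta>: "\<delta> > 0" "\<delta>\<^sup>2 * C = e" using e C by (auto simp: \<delta>_def)
    \<comment> \<open>A continuous cut-off of the positive half-line: it vanishes for x \<le> 0 and
      equals 1 from \<delta> on. Hence x^2 (1 - f x) is small on the side of \<open>d\<close>, while
      f is 0 on the side of \<open>X\<close>.\<close>
    define f where "f x = min 1 (max 0 (x / \<delta>))" for x :: real
    have "continuous_on {-K..K} f" unfolding f_def using \<delta> by (intro continuous_intros) auto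
    then obtain q where q: "\<And>x. \<bar>x\<bar> \<le> K \<Longrightarrow> \<bar>f x - poly q x\<bar> \<le> \<delta>\<^sup>2"
      using real_poly_approximation[of K f "\<delta>\<^sup>2"] \<delta> by auto
    have 1: "norm (peval ([:0, 0, 1:] * (1 - q)) d) \<le> \<delta>\<^sup>2 + K\<^sup>2 * \<delta>\<^sup>2"
    proof (rule norm_peval_le_shifted[OF sd(1) pos[folded d_def]])
      fix x :: real assume x: "0 \<le> x" "x \<le> 2 * t"
      then have xK: "x \<le> K" by (simp add: K_def)
      have fx: "x\<^sup>2 * (1 - f x) \<le> \<delta>\<^sup>2" "0 \<le> x\<^sup>2 * (1 - f x)"
      proof -
        show "0 \<le> x\<^sup>2 * (1 - f x)" by (intro mult_nonneg_nonneg) (auto simp: f_def)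
        show "x\<^sup>2 * (1 - f x) \<le> \<delta>\<^sup>2"
        proof (cases "x \<le> \<delta>")
          case True
          have "x\<^sup>2 * (1 - f x) \<le> \<delta>\<^sup>2 * 1"
            using x True \<delta> by (intro mult_mono power_mono) (auto simp: f_def)
          then show ?thesis by simp
        next
          case False
          then have "f x = 1" using \<delta> by (simp add: f_def)
          then show ?thesis by simp
        qed
      qed
      have "poly ([:0, 0, 1:] * (1 - q)) x = x\<^sup>2 * (1 - f x) + x\<^sup>2 * (f x - poly q x)"
        by (simp add: power2_eq_square algebra_simps)
      also have "\<bar>\<dots>\<bar> \<le> \<delta>\<^sup>2 + x\<^sup>2 * \<bar>f x - poly q x\<bar>"
        using fx by (intro order_trans[OF abs_triangle_ineq] add_mono) (auto simp: abs_mult)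
      also have "x\<^sup>2 * \<bar>f x - poly q x\<bar> \<le> K\<^sup>2 * \<delta>\<^sup>2"
        using x xK by (intro mult_mono power_mono q) auto
      finally show "\<bar>poly ([:0, 0, 1:] * (1 - q)) x\<bar> \<le> \<delta>\<^sup>2 + K\<^sup>2 * \<delta>\<^sup>2" by simp
    qed
    have 2: "norm (peval (pcompose (pCons 0 q) [:0, -1:]) (- X)) \<le> K * \<delta>\<^sup>2"
    proof (rule norm_peval_le_shifted)
      show "star (- X) = - X" by (simp add: star_minus sd)
      show "norm (of_real s - - X) \<le> s" using neg by (simp add: X_def)
      fix x :: real assume x: "0 \<le> x" "x \<le> 2 * s"
      then have xK: "x \<le> K" by (simp add: K_def)
      have "f (- x) = 0" using x \<delta> by (auto simp: f_def)
      then have "\<bar>poly q (- x)\<bar> \<le> \<delta>\<^sup>2" using q[of "- x"] x xK by simp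
      then have "x * \<bar>poly q (- x)\<bar> \<le> K * \<delta>\<^sup>2"
        using x xK by (intro mult_mono) auto
      then show "\<bar>poly (pcompose (pCons 0 q) [:0, -1:]) x\<bar> \<le> K * \<delta>\<^sup>2"
        using x by (simp add: poly_pcompose abs_mult)
    qed
    \<comment> \<open>The part of \<open>d * d\<close> kept by the cut-off is moved over to
      \<open>X\<close>, where \<open>q\<close> is small.\<close>
    have "d * d * peval q d = b * (X * peval q X) * star b"
    proof -
      have "d * peval q d = peval q d * d" by (rule peval_commute) simp
      also have "\<dots> = peval q (b * star b) * b * star b" by (simp only: d_def mult.assoc)
      also have "\<dots> = b * peval q X * star b" by (simp only: X_def peval_swap)
      finally have "d * (d * peval q d) = d * (b * peval q X * star b)" by simp
      then show ?thesis by (simp add: d_def X_def mult.assoc)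
    qed
    also have "norm \<dots> \<le> norm b * norm (X * peval q X) * norm b"
      using norm_mult_ineq[of "b * (X * peval q X)" "star b"]
        mult_right_mono[OF norm_mult_ineq[of b "X * peval q X"], of "norm b"] by simp
    also have "\<dots> \<le> norm b * (K * \<delta>\<^sup>2) * norm b"
      using 2 by (intro mult_right_mono mult_left_mono) (auto simp: peval_pcompose)
    finally have 3: "norm (d * d * peval q d) \<le> (norm b)\<^sup>2 * K * \<delta>\<^sup>2"
      by (simp add: power2_eq_square algebra_simps)
    have "d * d = peval ([:0, 0, 1:] * (1 - q)) d + d * d * peval q d"
      by (simp add: peval_mult peval_diff algebra_simps)
    also have "norm \<dots> \<le> (\<delta>\<^sup>2 + K\<^sup>2 * \<delta>\<^sup>2) + (norm b)\<^sup>2 * K * \<delta>\<^sup>2"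
      by (intro order_trans[OF norm_triangle_ineq] add_mono 1 3)
    also have "\<dots> = \<delta>\<^sup>2 * C" by (simp add: C_def algebra_simps)
    finally show "norm (d * d) \<le> 0 + e" using \<delta> by simp
  qed
  then have "(norm d)\<^sup>2 = 0" using norm_selfadjoint_square[OF sd(1)] by simp
  then show ?thesis by (simp add: d_def cstar_identity')
qed

text \<open>Positivity of star a * a in the form of a norm estimate. Let \<open>n\<close> be the
  negative part of h = star a * a and b = a n. Then star b * b = - n^3 is nonpositive, whereas b *
  star b, being (x^2 + y^2) / 2 - star b * b with selfadjoint \<open>x\<close> and \<open>y\<close>,
  is nonnegative. The two signs force b = 0, and then n = 0.\<close>

theorem norm_one_minus_star_mult:
  fixes a :: "'a::cstar_algebra_1"
  assumes a: "norm a \<le> 1"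
  shows "norm (1 - star a * a) \<le> 1"
proof -
  define h where "h = star a * a"
  define m where "m x = max (- x) 0" for x :: real
  define n where "n = cfc h m"
  define b where "b = a * n"
  have h: "star h = h" by (simp add: h_def star_mult star_star)
  have mc: "continuous_on S m" for S unfolding m_def by (intro continuous_intros)
  have n: "star n = n" unfolding n_def by (rule star_cfc[OF h mc])
  have hn: "cfc h (\<lambda>x. x * m x) = h * n"
    unfolding n_def by (subst cfc_mult) (auto intro!: continuous_intros mc simp: h cfc_ident)
  have X: "cfc h (\<lambda>x. m x * (x * m x)) = star b * b"
  proof -
    have "cfc h (\<lambda>x. m x * (x * m x)) = n * (h * n)"
      using cfc_mult[OF h mc, of "\<lambda>x. x * m x"] hn
      by (simp add: n_def continuous_on_mult continuous_on_id mc)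
    then show ?thesis by (simp add: b_def h_def star_mult n mult.assoc)
  qed
  \<comment> \<open>The values - (m x)^3 lie in [-R, 0], which turns nonpositivity of star b * b
    into a norm estimate.\<close>
  define R where "R = (norm h)^3"
  have "norm (star b * b - peval [:-R:] h) \<le> R"
    unfolding X[symmetric]
  proof (rule cfc_approx[OF h])
    fix x assume x: "\<bar>x\<bar> \<le> norm h"
    have "m x * (x * m x) = - (m x ^ 3)" by (simp add: m_def max_def power3_eq_cube)
    moreover have "0 \<le> m x ^ 3" "m x ^ 3 \<le> R"
      unfolding R_def using x by (auto intro!: power_mono simp: m_def)
    ultimately show "\<bar>m x * (x * m x) - poly [:-R:] x\<bar> \<le> R" by simp
  qed (intro continuous_intros mc)
  then have neg: "norm (of_real R + star b * b) \<le> R" by (simp add: add.commute)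
  define x where "x = b + star b"
  define y where "y = scaleC \<i> (b - star b)"
  have xy: "star x = x" "star y = y"
    by (simp_all add: x_def y_def star_add star_star star_scaleC star_diff scaleC_minus_left
        scaleC_diff_right)
  have "y * y = - ((b - star b) * (b - star b))"
    by (simp add: y_def mult_scaleC_left mult_scaleC_right scaleC_scaleC scaleC_minus_left)
  then have "x * x + y * y = 2 *\<^sub>R (b * star b + star b * b)"
    by (simp add: x_def algebra_simps scaleR_2)
  then have bb: "b * star b = (1/2) *\<^sub>R (x * x) + (1/2) *\<^sub>R (y * y) - star b * b"
    by (simp flip: scaleR_add_right)
  define t where "t = (1/2) * (norm x)\<^sup>2 + (1/2) * (norm y)\<^sup>2 + R"
  let ?P = "(1/2) *\<^sub>R (of_real ((norm x)\<^sup>2) - x * x)"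
  let ?Q = "(1/2) *\<^sub>R (of_real ((norm y)\<^sup>2) - y * y)"
  have "of_real t - b * star b = ?P + ?Q + (of_real R + star b * b)"
    unfolding bb t_def by (simp add: of_real_def algebra_simps)
  also have "norm \<dots> \<le> norm ?P + norm ?Q + norm (of_real R + star b * b)"
    using norm_triangle_ineq[of "?P + ?Q" "of_real R + star b * b"] norm_triangle_ineq[of ?P ?Q]
    by linarith
  also have "\<dots> \<le> (1/2) * (norm x)\<^sup>2 + (1/2) * (norm y)\<^sup>2 + R"
    using norm_of_real_minus_square[OF xy(1)] norm_of_real_minus_square[OF xy(2)] neg
    by (intro add_mono) simp_all
  finally have "norm (of_real t - b * star b) \<le> t" by (simp add: t_def)
  then have "b = 0" using neg by (rule mult_star_opposite_signs)
  have "n * n = 0"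
  proof -
    have "h * n = 0" using \<open>b = 0\<close> by (simp add: h_def b_def mult.assoc)
    moreover have "cfc h (\<lambda>x. m x * m x) = n * n"
      unfolding n_def by (rule cfc_mult[OF h mc mc])
    moreover have "cfc h (\<lambda>x. x * m x + m x * m x) = cfc h (\<lambda>x. x * m x) + cfc h (\<lambda>x. m x * m x)"
      by (rule cfc_add[OF h]) (intro continuous_intros mc)+
    moreover have "(\<lambda>x. x * m x + m x * m x) = poly 0" by (auto simp: m_def max_def)
    ultimately show ?thesis using hn cfc_poly[OF h, of 0] by simp
  qed
  then have "n = 0" using star_mult_self_eq_0[of n] n by simp
  \<comment> \<open>The function x + 2 m x is the absolute value. With n = 0 it gives back
    \<open>h\<close>, and it differs from 1 by at most 1 on [-1, 1].\<close>
  have "cfc h (\<lambda>x. x + (m x + m x)) = h + (n + n)"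
    unfolding n_def using cfc_add[OF h _ continuous_on_add[OF mc mc], of "\<lambda>x. x"] cfc_add[OF h mc mc]
    by (simp add: cfc_ident h)
  then have "cfc h (\<lambda>x. x + (m x + m x)) = h" using \<open>n = 0\<close> by simp
  moreover have "norm (cfc h (\<lambda>x. x + (m x + m x)) - peval 1 h) \<le> 1"
  proof (rule cfc_approx[OF h])
    have "norm h \<le> 1" using a by (simp add: h_def cstar_identity power_le_one)
    then show "\<bar>x + (m x + m x) - poly 1 x\<bar> \<le> 1" if "\<bar>x\<bar> \<le> norm h" for x
      using that by (auto simp: m_def max_def)
  qed (intro continuous_intros mc)
  ultimately show ?thesis by (simp add: h_def norm_minus_commute)
qed

section \<open>Positive functionals and states\<close>

lemma cstar_subalgebra_Unitize:
  assumes "cstar_subalgebra N"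
  shows "cstar_subalgebra ((\<lambda>a. Unitize a 0) ` N)"
proof -
  have eq: "(\<lambda>a. Unitize a 0) ` N = {x. elem x \<in> N \<and> scal x = 0}"
    by (auto simp: image_iff unitization_eq_iff)
  have "closed {x::'a unitization. elem x \<in> N}"
    using closed_vimage[OF cstar_subalgebra_closed[OF assms]
        linear_continuous_on[OF bounded_linear_elem]] by (simp add: vimage_def)
  moreover have "closed {x::'a unitization. scal x = 0}"
    by (intro closed_Collect_eq continuous_intros linear_continuous_on[OF bounded_linear_scal])
  ultimately have "closed {x::'a unitization. elem x \<in> N \<and> scal x = 0}"
    by (rule closed_Collect_conj)
  then show ?thesis
    unfolding eq by (auto simp: cstar_subalgebra_def intro: cstar_subalgebra_intros[OF assms])
qed

definition unitize_set :: "'a::cstar_algebra set \<Rightarrow> 'a unitization set" where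
  "unitize_set N = {x. elem x \<in> N}"

lemma cstar_subalgebra_unitize_set:
  assumes "cstar_subalgebra N"
  shows "cstar_subalgebra (unitize_set N)"
proof -
  have "closed {x::'a unitization. elem x \<in> N}"
    using closed_vimage[OF cstar_subalgebra_closed[OF assms]
        linear_continuous_on[OF bounded_linear_elem]] by (simp add: vimage_def)
  then show ?thesis
    by (auto simp: cstar_subalgebra_def unitize_set_def intro: cstar_subalgebra_intros[OF assms])
qed

lemma one_in_unitize_set: "cstar_subalgebra N \<Longrightarrow> 1 \<in> unitize_set N"
  by (simp add: unitize_set_def cstar_subalgebra_zero)

lemma Unitize_in_unitize_set [simp]: "Unitize a c \<in> unitize_set N \<longleftrightarrow> a \<in> N"
  by (simp add: unitize_set_def)

lemma star_Unitize: "star (Unitize a c) = Unitize (star a) (cnj c)"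
  by (simp add: unitization_eq_iff)

lemma Unitize_mult: "Unitize a 0 * Unitize b 0 = Unitize (a * b) 0"
  by (simp add: unitization_eq_iff)

lemma Unitize_diff: "Unitize a c - Unitize b d = Unitize (a - b) (c - d)"
  by (simp add: unitization_eq_iff)

text \<open>\<open>u\<close> is g (a * star a), and g 0 = 0 keeps it in \<open>N\<close>. For z = (1
  - u) a, the element z * star z is the function (1 - g x)^2 x of a * star a. It is at most d^2 in
  norm, since 1 - g vanishes for \<bar>x\<bar> \<ge> d^2; the absolute value in \<open>g\<close>
  covers the whole symmetric interval.\<close>

lemma approximate_unit:
  assumes N: "cstar_subalgebra N" and a: "a \<in> N" and d: "d > 0"
  obtains u where "u \<in> N" "star u = u" "norm u \<le> 1" "norm (a - u * a) \<le> d"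
proof -
  define h where "h = Unitize (a * star a) 0"
  define g where "g x = min 1 (\<bar>x\<bar> / d\<^sup>2)" for x :: real
  define U where "U = cfc h g"
  define V where "V = cfc h (\<lambda>x. 1 - g x)"
  have h: "star h = h" by (simp add: h_def star_Unitize star_mult star_star)
  have g: "continuous_on S g" for S unfolding g_def using d by (intro continuous_intros) auto
  have "U \<in> (\<lambda>a. Unitize a 0) ` N"
    unfolding U_def
    by (rule cfc_mem[OF cstar_subalgebra_Unitize[OF N] _ h g])
       (auto simp: h_def g_def intro!: cstar_subalgebra_intros[OF N] a)
  then obtain u where u: "u \<in> N" "U = Unitize u 0" by auto
  have "star U = U" unfolding U_def by (rule star_cfc[OF h g])
  then have "star u = u" by (simp add: u star_Unitize)
  moreover have "norm U \<le> 1" unfolding U_def by (rule norm_cfc_le[OF h g]) (simp add: g_def)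
  then have "norm u \<le> 1" by (simp add: u)
  moreover have "norm (a - u * a) \<le> d"
  proof -
    have Vc: "continuous_on S (\<lambda>x. 1 - g x)" for S by (intro continuous_intros g)
    have "cfc h (\<lambda>x. (1 - g x) + g x) = V + U"
      unfolding V_def U_def by (rule cfc_add[OF h Vc g])
    moreover have "(\<lambda>x. (1 - g x) + g x) = poly 1" by auto
    ultimately have "V + U = 1" using cfc_poly[OF h, of 1] by simp
    then have V: "V = 1 - U" by (simp add: algebra_simps)
    have Vs: "star V = V" unfolding V_def by (rule star_cfc[OF h Vc])
    define z where "z = V * Unitize a 0"
    have z: "z = Unitize (a - u * a) 0" by (simp add: z_def V u unitization_eq_iff)
    have "cfc h (\<lambda>x. (1 - g x) * x) = V * h"
      unfolding V_def using cfc_mult[OF h Vc, of "\<lambda>x. x"] by (simp add: cfc_ident h)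
    then have "cfc h (\<lambda>x. (1 - g x) * x * (1 - g x)) = V * h * V"
      using cfc_mult[OF h _ Vc, of "\<lambda>x. (1 - g x) * x"]
      by (simp add: V_def continuous_on_mult continuous_on_id Vc)
    also have "\<dots> = z * star z"
      by (simp add: z_def star_mult Vs h_def star_Unitize mult.assoc flip: Unitize_mult)
    finally have zz: "cfc h (\<lambda>x. (1 - g x) * x * (1 - g x)) = z * star z" .
    have "norm (z * star z) \<le> d\<^sup>2"
      unfolding zz[symmetric]
    proof (rule norm_cfc_le[OF h])
      show "continuous_on {-norm h..norm h} (\<lambda>x. (1 - g x) * x * (1 - g x))"
        by (intro continuous_intros g)
      fix x :: real
      show "\<bar>(1 - g x) * x * (1 - g x)\<bar> \<le> d\<^sup>2"
      proof (cases "\<bar>x\<bar> \<ge> d\<^sup>2")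
        case True
        then have "g x = 1" using d by (simp add: g_def)
        then show ?thesis by simp
      next
        case False
        have "0 \<le> 1 - g x" "1 - g x \<le> 1" by (auto simp: g_def)
        then have "\<bar>1 - g x\<bar> * \<bar>x\<bar> * \<bar>1 - g x\<bar> \<le> 1 * d\<^sup>2 * 1"
          using False by (intro mult_mono) auto
        then show ?thesis by (simp add: abs_mult)
      qed
    qed
    then have "(norm z)\<^sup>2 \<le> d\<^sup>2" by (simp add: cstar_identity')
    then have "norm z \<le> d" by (rule power2_le_imp_le) (use d in simp)
    then show ?thesis by (simp add: z)
  qed
  ultimately show thesis using that u(1) by blast
qed

section \<open>Positive functionals and the Cauchy-Schwarz inequality\<close>

definition positive_functional :: "'a::cstar_algebra set \<Rightarrow> ('a \<Rightarrow> complex) \<Rightarrow> bool" where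
  "positive_functional N f \<longleftrightarrow> (\<forall>a\<in>N. \<forall>b\<in>N. f (a + b) = f a + f b) \<and>
     (\<forall>c. \<forall>a\<in>N. f (scaleC c a) = c * f a) \<and> (\<forall>a\<in>N. f (star a * a) \<in> \<real>\<^sub>\<ge>\<^sub>0)"

lemma positive_functionalD:
  assumes "positive_functional N f"
  shows positive_functional_add: "a \<in> N \<Longrightarrow> b \<in> N \<Longrightarrow> f (a + b) = f a + f b"
    and positive_functional_scaleC: "a \<in> N \<Longrightarrow> f (scaleC c a) = c * f a"
    and positive_functional_nonneg: "a \<in> N \<Longrightarrow> f (star a * a) \<in> \<real>\<^sub>\<ge>\<^sub>0"
  using assms by (auto simp: positive_functional_def)

lemma positive_functional_scaleR:
  "positive_functional N f \<Longrightarrow> a \<in> N \<Longrightarrow> f (r *\<^sub>R a) = of_real r * f a"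
  by (simp add: scaleR_scaleC positive_functional_scaleC)

lemma positive_functional_diff:
  assumes "cstar_subalgebra N" "positive_functional N f" "a \<in> N" "b \<in> N"
  shows "f (a - b) = f a - f b"
  using positive_functional_add[OF assms(2,3), of "(-1) *\<^sub>R b"]
    positive_functional_scaleR[OF assms(2,4), of "-1"] cstar_subalgebra_minus[OF assms(1,4)]
  by simp

lemma positive_functional_zero: "cstar_subalgebra N \<Longrightarrow> positive_functional N f \<Longrightarrow> f 0 = 0"
  using positive_functional_scaleC[of N f 0 0] cstar_subalgebra_zero[of N] by simp

text \<open>The form is hermitian because its values on a + b and a + \<i> b are real, which fixes
  the imaginary and the real parts of the mixed terms.\<close>

lemma positive_functional_star_mult:
  assumes N: "cstar_subalgebra N" and f: "positive_functional N f" and ab: "a \<in> N" "b \<in> N"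
  shows "f (star b * a) = cnj (f (star a * b))"
proof -
  have expand: "f (star (a + scaleC t b) * (a + scaleC t b)) = f (star a * a) + t * f (star a * b)
      + cnj t * f (star b * a) + cnj t * t * f (star b * b)" for t
  proof -
    have "star (a + scaleC t b) * (a + scaleC t b) = star a * a + scaleC t (star a * b)
      + scaleC (cnj t) (star b * a) + scaleC (cnj t * t) (star b * b)"
      by (simp add: star_add star_scaleC distrib_left distrib_right mult_scaleC_left
          mult_scaleC_right scaleC_scaleC scaleC_add_right mult.commute)
    then show ?thesis
      using ab by (simp add: positive_functionalD[OF f] cstar_subalgebra_intros[OF N])
  qed
  have "Im (f (star (a + scaleC t b) * (a + scaleC t b))) = 0" for t
    using positive_functional_nonneg[OF f, of "a + scaleC t b"] ab
    by (auto simp: cstar_subalgebra_intros[OF N] complex_nonneg_Reals_iff)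
  from this[of 1] this[of \<i>] show ?thesis
    using positive_functional_nonneg[OF f ab(1)] positive_functional_nonneg[OF f ab(2)]
    unfolding expand by (simp add: complex_eq_iff complex_nonneg_Reals_iff)
qed

lemma cmod_mult_self: "cmod z * cmod z = Re z * Re z + Im z * Im z"
  using cmod_power2[of z] by (simp add: power2_eq_square)

lemma positive_functional_Cauchy_Schwarz:
  assumes N: "cstar_subalgebra N" and f: "positive_functional N f" and ab: "a \<in> N" "b \<in> N"
  shows "(cmod (f (star a * b)))\<^sup>2 \<le> Re (f (star a * a)) * Re (f (star b * b))"
proof -
  define w where "w = f (star a * b)"
  define A where "A = Re (f (star a * a))"
  define B where "B = Re (f (star b * b))"
  have AB: "f (star a * a) = of_real A" "f (star b * b) = of_real B" "0 \<le> A" "0 \<le> B"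
    using positive_functional_nonneg[OF f ab(1)] positive_functional_nonneg[OF f ab(2)]
    by (auto simp: A_def B_def complex_nonneg_Reals_iff complex_eq_iff)
  have quad: "0 \<le> A - 2 * s * (cmod w)\<^sup>2 + s\<^sup>2 * (cmod w)\<^sup>2 * B" for s :: real
  proof -
    \<comment> \<open>The phase of cnj w makes both mixed terms equal to - s \<bar>w\<bar>^2, which
      leaves a real quadratic in \<open>s\<close>.\<close>
    define t where "t = - of_real s * cnj w"
    have "star (a + scaleC t b) * (a + scaleC t b) = star a * a + scaleC t (star a * b)
      + scaleC (cnj t) (star b * a) + scaleC (cnj t * t) (star b * b)"
      by (simp add: star_add star_scaleC distrib_left distrib_right mult_scaleC_left
          mult_scaleC_right scaleC_scaleC scaleC_add_right mult.commute)
    then have "f (star (a + scaleC t b) * (a + scaleC t b))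
        = of_real A + t * w + cnj t * cnj w + cnj t * t * of_real B"
      using ab positive_functional_star_mult[OF N f ab]
      by (simp add: positive_functionalD[OF f] cstar_subalgebra_intros[OF N] AB w_def)
    also have "\<dots> = complex_of_real (A - 2 * s * (cmod w)\<^sup>2 + s\<^sup>2 * (cmod w)\<^sup>2 * B)"
      by (simp add: t_def complex_eq_iff power2_eq_square cmod_mult_self algebra_simps)
    finally have "complex_of_real (A - 2 * s * (cmod w)\<^sup>2 + s\<^sup>2 * (cmod w)\<^sup>2 * B) \<in> \<real>\<^sub>\<ge>\<^sub>0"
      using positive_functional_nonneg[OF f, of "a + scaleC t b"] ab
      by (simp only: cstar_subalgebra_add[OF N] cstar_subalgebra_scaleC[OF N])
    then show ?thesis by (simp only: nonneg_Reals_of_real_iff)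
  qed
  show ?thesis
  proof (cases "B = 0")
    case True
    have "w = 0"
    proof (rule ccontr)
      assume "w \<noteq> 0"
      \<comment> \<open>With B = 0 the quadratic is affine in \<open>s\<close>; at this value of
        \<open>s\<close> it equals -1.\<close>
      then show False using quad[of "(A + 1) / (2 * (cmod w)\<^sup>2)"] True by simp
    qed
    then show ?thesis using True by (simp add: w_def B_def)
  next
    case False
    then have "B > 0" using AB by simp
    then have "(cmod w)\<^sup>2 \<le> A * B" using quad[of "1 / B"]
      by (simp add: field_simps power2_eq_square)
    then show ?thesis by (simp add: w_def A_def B_def)
  qed
qed

text \<open>The compression of \<open>f\<close> by \<open>w\<close> is bounded by its value at the
  unit. For norm x < r, a square root of 1 - star x * x / r^2 writes star w * w - star (x w) * (x w)
  / r^2 as star v * v, and Cauchy-Schwarz concludes. Taking w = 1 bounds \<open>f\<close>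
  itself.\<close>

lemma positive_functional_compress_le:
  assumes S: "cstar_subalgebra S" "1 \<in> S" and f: "positive_functional S (f :: 'a::cstar_algebra_1 \<Rightarrow> complex)"
    and wx: "w \<in> S" "x \<in> S"
  shows "cmod (f (star w * (x * w))) \<le> Re (f (star w * w)) * norm x"
proof -
  define T where "T = Re (f (star w * w))"
  have T: "0 \<le> T"
    using positive_functional_nonneg[OF f wx(1)] by (auto simp: T_def complex_nonneg_Reals_iff)
  have le: "Re (f (star (x * w) * (x * w))) \<le> r\<^sup>2 * T" if r: "norm x < r" for r
  proof -
    have r0: "r > 0" using r norm_ge_zero[of x] by linarith
    define h where "h = (1 / r\<^sup>2) *\<^sub>R (star x * x)"
    have "(norm x)\<^sup>2 < r\<^sup>2" using r by (intro power_strict_mono) auto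
    then have hn: "norm h < 1" using r0 by (simp add: h_def cstar_identity)
    have hs: "star h = h" by (simp add: h_def star_scaleR star_mult star_star)
    have hS: "h \<in> S" unfolding h_def by (intro cstar_subalgebra_intros[OF S(1)] wx)
    obtain y where y: "y \<in> S" "star y = y" "y + y = h + y * y"
      by (rule sqrt_one_minus[OF S(1) hS hs hn]) (rule that)
    define v where "v = (1 - y) * w"
    have v: "v \<in> S" unfolding v_def by (intro cstar_subalgebra_intros[OF S(1)] S wx y)
    have yy: "(1 - y) * (1 - y) = 1 - h" using y(3) by (simp add: algebra_simps)
    have "star v * v = star w * ((1 - y) * (1 - y)) * w"
      by (simp add: v_def star_mult star_diff y mult.assoc)
    also have "\<dots> = star w * w - (1 / r\<^sup>2) *\<^sub>R (star (x * w) * (x * w))"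
      unfolding yy h_def by (simp add: algebra_simps star_mult mult.assoc)
    finally have "star v * v = star w * w - (1 / r\<^sup>2) *\<^sub>R (star (x * w) * (x * w))" .
    then have "f (star v * v) = f (star w * w) - of_real (1 / r\<^sup>2) * f (star (x * w) * (x * w))"
      using wx by (simp add: positive_functional_diff[OF S(1) f] positive_functional_scaleR[OF f]
          cstar_subalgebra_intros[OF S(1)])
    then have "0 \<le> T - (1 / r\<^sup>2) * Re (f (star (x * w) * (x * w)))"
      using positive_functional_nonneg[OF f v] by (auto simp: T_def complex_nonneg_Reals_iff)
    then show ?thesis using r0 by (simp add: field_simps)
  qed
  have le2: "cmod (f (star w * (x * w))) \<le> T * r" if r: "norm x < r" for r
  proof -
    have "(cmod (f (star w * (x * w))))\<^sup>2 \<le> T * Re (f (star (x * w) * (x * w)))"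
      unfolding T_def using wx
      by (intro positive_functional_Cauchy_Schwarz[OF S(1) f]) (auto intro: cstar_subalgebra_intros[OF S(1)])
    also have "\<dots> \<le> T * (r\<^sup>2 * T)" by (intro mult_left_mono le r T)
    also have "\<dots> = (T * r)\<^sup>2" by (simp add: power2_eq_square)
    finally show ?thesis
      by (rule power2_le_imp_le) (use T r norm_ge_zero[of x] in \<open>intro mult_nonneg_nonneg; linarith\<close>)
  qed
  have "(\<lambda>n. T * (norm x + inverse (real (Suc n)))) \<longlonglongrightarrow> T * (norm x + 0)"
    by (intro tendsto_intros LIMSEQ_inverse_real_of_nat)
  then have "cmod (f (star w * (x * w))) \<le> T * (norm x + 0)"
    by (rule LIMSEQ_le_const) (auto intro!: le2)
  then show ?thesis by (simp add: T_def)
qed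

lemma states_positive: "\<phi> \<in> states N \<Longrightarrow> positive_functional N \<phi>"
  by (simp add: states_def positive_functional_def)

lemma states_norm_le:
  assumes N: "cstar_subalgebra N" and \<phi>: "\<phi> \<in> states N" and a: "a \<in> N"
  shows "cmod (\<phi> a) \<le> norm a"
proof (cases "a = 0")
  case True
  then show ?thesis using positive_functional_zero[OF N states_positive[OF \<phi>]] by simp
next
  case False
  define b where "b = (1 / norm a) *\<^sub>R a"
  have "b \<in> {a \<in> N. norm a \<le> 1}"
    using False by (simp add: b_def cstar_subalgebra_scaleR[OF N a])
  then have "cmod (\<phi> b) \<le> 1"
    using \<phi> cSUP_upper[of b "{a \<in> N. norm a \<le> 1}" "\<lambda>a. cmod (\<phi> a)"]
    by (auto simp: states_def)
  moreover have "\<phi> b = of_real (1 / norm a) * \<phi> a"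
    unfolding b_def by (rule positive_functional_scaleR[OF states_positive[OF \<phi>] a])
  ultimately show ?thesis using False by (simp add: norm_mult norm_divide field_simps)
qed

lemma states_norm_attained:
  assumes N: "cstar_subalgebra N" and \<phi>: "\<phi> \<in> states N" and e: "e > 0"
  obtains a where "a \<in> N" "norm a \<le> 1" "1 - e < cmod (\<phi> a)"
proof -
  have "(SUP a\<in>{a\<in>N. norm a \<le> 1}. cmod (\<phi> a)) = 1"
    "bdd_above ((\<lambda>a. cmod (\<phi> a)) ` {a\<in>N. norm a \<le> 1})"
    using \<phi> by (simp_all add: states_def)
  moreover have "{a\<in>N. norm a \<le> 1} \<noteq> {}" using cstar_subalgebra_zero[OF N] by auto
  ultimately obtain a where "a \<in> {a\<in>N. norm a \<le> 1}" "1 - e < cmod (\<phi> a)"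
    using less_cSUP_iff[of "{a\<in>N. norm a \<le> 1}" "\<lambda>a. cmod (\<phi> a)" "1 - e"] e by auto
  then show thesis using that by auto
qed

lemma statesI:
  assumes N: "cstar_subalgebra N" and f: "f \<in> extensional N" "positive_functional N f"
    and le: "\<And>a. a \<in> N \<Longrightarrow> cmod (f a) \<le> norm a"
    and ge: "\<And>e. e > 0 \<Longrightarrow> \<exists>a\<in>N. norm a \<le> 1 \<and> 1 - e < cmod (f a)"
  shows "f \<in> states N"
proof -
  have ne: "{a\<in>N. norm a \<le> 1} \<noteq> {}" using cstar_subalgebra_zero[OF N] by auto
  have le1: "cmod (f a) \<le> 1" if "a \<in> {a\<in>N. norm a \<le> 1}" for a
    using le[of a] that by auto
  then have bdd: "bdd_above ((\<lambda>a. cmod (f a)) ` {a\<in>N. norm a \<le> 1})"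
    by (auto simp: bdd_above_def)
  have "(SUP a\<in>{a\<in>N. norm a \<le> 1}. cmod (f a)) = 1"
  proof (rule antisym)
    show "(SUP a\<in>{a\<in>N. norm a \<le> 1}. cmod (f a)) \<le> 1"
      by (rule cSUP_least[OF ne le1])
    show "1 \<le> (SUP a\<in>{a\<in>N. norm a \<le> 1}. cmod (f a))"
    proof (rule field_le_epsilon)
      fix e :: real assume "e > 0"
      then obtain a where a: "a \<in> {a\<in>N. norm a \<le> 1}" "1 - e < cmod (f a)"
        using ge by blast
      with cSUP_upper[OF a(1) bdd] show "1 \<le> (SUP a\<in>{a\<in>N. norm a \<le> 1}. cmod (f a)) + e"
        by linarith
    qed
  qed
  then show ?thesis using f bdd by (simp add: states_def positive_functional_def)
qed

text \<open>Norm one comes for free: the supremum is already approached on \<open>M\<close>, where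
  \<open>f\<close> agrees with a state.\<close>

lemma states_extensionI:
  assumes N: "cstar_subalgebra N" and M: "cstar_subalgebra M" and MN: "M \<subseteq> N"
    and f: "f \<in> extensional N" "positive_functional N f" "\<And>a. a \<in> N \<Longrightarrow> cmod (f a) \<le> norm a"
    and \<phi>: "\<phi> \<in> states M" "\<And>m. m \<in> M \<Longrightarrow> f m = \<phi> m"
  shows "f \<in> states N"
proof (rule statesI[OF N f])
  fix e :: real assume "e > 0"
  then obtain a where "a \<in> M" "norm a \<le> 1" "1 - e < cmod (\<phi> a)"
    using states_norm_attained[OF M \<phi>(1)] by blast
  then show "\<exists>a\<in>N. norm a \<le> 1 \<and> 1 - e < cmod (f a)" using MN \<phi>(2) by (intro bexI[of _ a]) auto
qed

text \<open>Such an \<open>e\<close> replaces the unit in later arguments about characters.\<close>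

lemma states_one:
  assumes N: "cstar_subalgebra N" and \<phi>: "\<phi> \<in> states N"
  obtains e where "e \<in> N" "\<phi> e = 1"
proof -
  obtain a where a: "a \<in> N" "1 - 1 < cmod (\<phi> a)"
    using states_norm_attained[OF N \<phi>, of 1] by auto
  then have "\<phi> (scaleC (1 / \<phi> a) a) = 1"
    by (auto simp: positive_functional_scaleC[OF states_positive[OF \<phi>]])
  then show thesis using that a cstar_subalgebra_scaleC[OF N] by blast
qed

text \<open>Hermitian symmetry is known for products only, so \<open>a\<close> is approximated by u
  * a.\<close>

lemma states_star:
  assumes N: "cstar_subalgebra N" and \<phi>: "\<phi> \<in> states N" and a: "a \<in> N"
  shows "\<phi> (star a) = cnj (\<phi> a)"
proof -
  have "cmod (\<phi> (star a) - cnj (\<phi> a)) \<le> 0"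
  proof (rule field_le_epsilon)
    fix e :: real assume "e > 0"
    then obtain u where u: "u \<in> N" "star u = u" "norm (a - u * a) \<le> e / 2"
      using approximate_unit[OF N a, of "e / 2"] by auto
    have uaN: "u * a \<in> N" "star a * u \<in> N" "star a \<in> N"
      by (intro cstar_subalgebra_intros[OF N] a u)+
    have "star (a - u * a) = star a - star a * u" by (simp add: star_diff star_mult u)
    then have n: "norm (star a - star a * u) \<le> e / 2" using u(3) by (metis norm_star)
    have "\<phi> (star a) - \<phi> (star a * u) = \<phi> (star a - star a * u)"
      using uaN by (simp add: positive_functional_diff[OF N states_positive[OF \<phi>]])
    also have "cmod \<dots> \<le> e / 2"
      using n uaN by (intro order_trans[OF states_norm_le[OF N \<phi>]] cstar_subalgebra_diff[OF N])
    finally have 1: "cmod (\<phi> (star a) - \<phi> (star a * u)) \<le> e / 2" .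
    have "\<phi> a - \<phi> (u * a) = \<phi> (a - u * a)"
      using uaN a by (simp add: positive_functional_diff[OF N states_positive[OF \<phi>]])
    also have "cmod \<dots> \<le> e / 2"
      using u(3) uaN a by (intro order_trans[OF states_norm_le[OF N \<phi>]] cstar_subalgebra_diff[OF N])
    finally have "cmod (\<phi> a - \<phi> (u * a)) \<le> e / 2" .
    then have 2: "cmod (cnj (\<phi> a) - cnj (\<phi> (u * a))) \<le> e / 2"
      unfolding complex_cnj_diff[symmetric] complex_mod_cnj .
    have "cnj (\<phi> (u * a)) = \<phi> (star a * u)"
      using positive_functional_star_mult[OF N states_positive[OF \<phi>] u(1) a] u(2) by simp
    then show "cmod (\<phi> (star a) - cnj (\<phi> a)) \<le> 0 + e"
      using norm_triangle_ineq4[of "\<phi> (star a) - \<phi> (star a * u)" "cnj (\<phi> a) - cnj (\<phi> (u * a))"] 1 2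
      by simp
  qed
  then show ?thesis by simp
qed

text \<open>Cauchy-Schwarz against the unit, with the unit replaced by an approximate one, for which
  \<phi> (star u * u) \<le> 1.\<close>

lemma states_Kadison:
  assumes N: "cstar_subalgebra N" and \<phi>: "\<phi> \<in> states N" and a: "a \<in> N"
  shows "(cmod (\<phi> a))\<^sup>2 \<le> Re (\<phi> (star a * a))"
proof -
  define T where "T = Re (\<phi> (star a * a))"
  have T: "0 \<le> T"
    using positive_functional_nonneg[OF states_positive[OF \<phi>] a] by (auto simp: T_def complex_nonneg_Reals_iff)
  have "cmod (\<phi> a) \<le> sqrt T"
  proof (rule field_le_epsilon)
    fix e :: real assume "e > 0"
    then obtain u where u: "u \<in> N" "star u = u" "norm u \<le> 1" "norm (a - u * a) \<le> e"
      using approximate_unit[OF N a] by blast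
    have uN: "u * a \<in> N" "star u * u \<in> N" by (intro cstar_subalgebra_intros[OF N] a u)+
    have "(norm u)\<^sup>2 \<le> 1" using u(3) by (simp add: power_le_one)
    then have "Re (\<phi> (star u * u)) \<le> 1"
      using states_norm_le[OF N \<phi> uN(2)] complex_Re_le_cmod[of "\<phi> (star u * u)"]
      by (simp add: cstar_identity)
    then have "Re (\<phi> (star u * u)) * T \<le> 1 * T" using T by (rule mult_right_mono)
    then have "(cmod (\<phi> (u * a)))\<^sup>2 \<le> T"
      using positive_functional_Cauchy_Schwarz[OF N states_positive[OF \<phi>] u(1) a] u(2)
      by (simp add: T_def)
    then have "cmod (\<phi> (u * a)) \<le> sqrt T" by (rule real_le_rsqrt)
    moreover have "\<phi> a - \<phi> (u * a) = \<phi> (a - u * a)"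
      using uN a by (simp add: positive_functional_diff[OF N states_positive[OF \<phi>]])
    moreover have "cmod (\<phi> (a - u * a)) \<le> e"
      using u(4) uN a by (intro order_trans[OF states_norm_le[OF N \<phi>]] cstar_subalgebra_diff[OF N])
    ultimately show "cmod (\<phi> a) \<le> sqrt T + e"
      using norm_triangle_ineq2[of "\<phi> a" "\<phi> (u * a)"] by simp
  qed
  then have "(cmod (\<phi> a))\<^sup>2 \<le> (sqrt T)\<^sup>2" by (intro power_mono) auto
  then show ?thesis using T by (simp add: T_def)
qed

definition unitize_fun :: "('a \<Rightarrow> complex) \<Rightarrow> 'a unitization \<Rightarrow> complex" where
  "unitize_fun \<phi> x = \<phi> (elem x) + scal x"

text \<open>On star x * x with x = a + l the value is \<phi> (star a * a) + 2 Re (cnj l * \<phi> a)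
  + \<bar>l\<bar>^2. By the Kadison inequality this is at least (\<bar>l\<bar> - \<bar>\<phi>
  a\<bar>)^2.\<close>

lemma positive_functional_unitize:
  assumes N: "cstar_subalgebra N" and \<phi>: "\<phi> \<in> states N"
  shows "positive_functional (unitize_set N) (unitize_fun \<phi>)"
  unfolding positive_functional_def
proof (intro conjI ballI allI)
  note pos = states_positive[OF \<phi>]
  fix x y :: "'a unitization" and c assume xy: "x \<in> unitize_set N"
  show "unitize_fun \<phi> (scaleC c x) = c * unitize_fun \<phi> x"
    using xy by (simp add: unitize_fun_def unitize_set_def positive_functional_scaleC[OF pos] algebra_simps)
  show "unitize_fun \<phi> (x + y) = unitize_fun \<phi> x + unitize_fun \<phi> y" if "y \<in> unitize_set N"
    using xy that by (simp add: unitize_fun_def unitize_set_def positive_functional_add[OF pos])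
  define a where "a = elem x"
  define l where "l = scal x"
  define T where "T = Re (\<phi> (star a * a))"
  have a: "a \<in> N" using xy by (simp add: a_def unitize_set_def)
  have T: "\<phi> (star a * a) = of_real T"
    using positive_functional_nonneg[OF pos a] by (auto simp: T_def complex_nonneg_Reals_iff complex_eq_iff)
  have "unitize_fun \<phi> (star x * x) = \<phi> (star a * a + scaleC (cnj l) a + scaleC l (star a)) + cnj l * l"
    by (simp add: unitize_fun_def a_def l_def)
  also have "\<dots> = of_real T + cnj l * \<phi> a + l * cnj (\<phi> a) + cnj l * l"
    using a by (simp add: positive_functionalD[OF pos] cstar_subalgebra_intros[OF N] T states_star[OF N \<phi>])
  also have "\<dots> = of_real (T + 2 * Re (cnj l * \<phi> a) + (cmod l)\<^sup>2)"
    by (simp add: complex_eq_iff power2_eq_square cmod_mult_self)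
  finally have eq: "unitize_fun \<phi> (star x * x) = of_real (T + 2 * Re (cnj l * \<phi> a) + (cmod l)\<^sup>2)" .
  have "- Re (cnj l * \<phi> a) \<le> cmod l * cmod (\<phi> a)"
    using abs_Re_le_cmod[of "cnj l * \<phi> a"] by (simp add: norm_mult)
  moreover have "0 \<le> (cmod l - cmod (\<phi> a))\<^sup>2" by simp
  ultimately have "0 \<le> T + 2 * Re (cnj l * \<phi> a) + (cmod l)\<^sup>2"
    using states_Kadison[OF N \<phi> a] by (simp add: T_def power2_diff)
  then show "unitize_fun \<phi> (star x * x) \<in> \<real>\<^sub>\<ge>\<^sub>0"
    unfolding eq by (simp only: nonneg_Reals_of_real_iff)
qed

section \<open>Pure states of abelian subalgebras\<close>

text \<open>The defect \<open>D\<close> is sesquilinear and vanishes on the diagonal, hence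
  everywhere. Applied with one entry acting as a unit, the conclusion becomes
  multiplicativity.\<close>

lemma compression_polarization:
  assumes A: "cstar_subalgebra A" and f: "positive_functional A f"
    and N: "cstar_subalgebra N" "N \<subseteq> A" and x: "x \<in> A"
    and diag: "\<And>c. c \<in> N \<Longrightarrow> f (star c * (x * c)) = f (star c * c) * k"
    and ab: "a \<in> N" "b \<in> N"
  shows "f (star a * (x * b)) = f (star a * b) * k"
proof -
  define D where "D c d = f (star c * (x * d)) - f (star c * d) * k" for c d
  have expand: "D (a + scaleC t b) (a + scaleC t b) = D a a + t * D a b + cnj t * D b a + cnj t * t * D b b" for t
  proof -
    have abA: "a \<in> A" "b \<in> A" using ab N by auto
    have e1: "star (a + scaleC t b) * (y * (a + scaleC t b)) = star a * (y * a) + scaleC t (star a * (y * b))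
      + scaleC (cnj t) (star b * (y * a)) + scaleC (cnj t * t) (star b * (y * b))" for y
      by (simp add: star_add star_scaleC distrib_left distrib_right mult_scaleC_left
          mult_scaleC_right scaleC_scaleC scaleC_add_right mult.commute)
    have e2: "star (a + scaleC t b) * (a + scaleC t b) = star a * a + scaleC t (star a * b)
      + scaleC (cnj t) (star b * a) + scaleC (cnj t * t) (star b * b)"
      by (simp add: star_add star_scaleC distrib_left distrib_right mult_scaleC_left
          mult_scaleC_right scaleC_scaleC scaleC_add_right mult.commute)
    show ?thesis
      unfolding D_def e1 e2 using abA x
      by (simp add: positive_functionalD[OF f] cstar_subalgebra_intros[OF A] algebra_simps)
  qed
  have D0: "D c c = 0" if "c \<in> N" for c using diag[OF that] by (simp add: D_def)
  have "t * D a b + cnj t * D b a = 0" for t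
    using expand[of t] D0[of a] D0[of b] D0[of "a + scaleC t b"] ab
    by (simp add: cstar_subalgebra_intros[OF N(1)])
  from this[of 1] this[of \<i>] have "D a b = 0"
    by (simp add: complex_eq_iff)
  then show ?thesis by (simp add: D_def)
qed

lemma state_compress_le:
  assumes N: "cstar_subalgebra N" and \<phi>: "\<phi> \<in> states N" and w: "w \<in> unitize_set N" and x: "x \<in> N"
  shows "cmod (unitize_fun \<phi> (star w * (Unitize x 0 * w))) \<le> Re (unitize_fun \<phi> (star w * w)) * norm x"
  using positive_functional_compress_le[OF cstar_subalgebra_unitize_set[OF N] one_in_unitize_set[OF N]
      positive_functional_unitize[OF N \<phi>] w, of "Unitize x 0"] x by simp

lemma unitize_fun_le:
  assumes N: "cstar_subalgebra N" and \<phi>: "\<phi> \<in> states N" and x: "x \<in> unitize_set N"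
  shows "cmod (unitize_fun \<phi> x) \<le> norm x"
  using positive_functional_compress_le[OF cstar_subalgebra_unitize_set[OF N] one_in_unitize_set[OF N]
      positive_functional_unitize[OF N \<phi>] one_in_unitize_set[OF N] x]
    positive_functional_zero[OF N states_positive[OF \<phi>]]
  by (simp add: unitize_fun_def)

text \<open>The two norm bounds add up to the norm of \<phi>, so \<open>f\<close> has norm exactly
  \<open>t\<close>.\<close>

lemma state_of_summand:
  assumes M: "cstar_subalgebra M" and \<phi>: "\<phi> \<in> states M"
    and f: "positive_functional M f" and le: "\<And>x. x \<in> M \<Longrightarrow> cmod (f x) \<le> t * norm x"
    and le': "\<And>x. x \<in> M \<Longrightarrow> cmod (\<phi> x - f x) \<le> (1 - t) * norm x" and t: "0 < t" "t \<le> 1"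
  shows "restrict (\<lambda>x. f x / of_real t) M \<in> states M"
proof (rule statesI[OF M])
  show "positive_functional M (restrict (\<lambda>x. f x / of_real t) M)"
    unfolding positive_functional_def
  proof (intro conjI ballI allI)
    fix a assume a: "a \<in> M"
    have "f (star a * a) \<in> \<real>\<^sub>\<ge>\<^sub>0" by (rule positive_functional_nonneg[OF f a])
    moreover have "1 / complex_of_real t \<in> \<real>\<^sub>\<ge>\<^sub>0"
      using t by (simp add: complex_nonneg_Reals_iff Re_divide_of_real Im_divide_of_real)
    ultimately have "f (star a * a) * (1 / complex_of_real t) \<in> \<real>\<^sub>\<ge>\<^sub>0"
      by (rule nonneg_Reals_mult_I)
    then show "restrict (\<lambda>x. f x / of_real t) M (star a * a) \<in> \<real>\<^sub>\<ge>\<^sub>0"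
      using a by (simp add: cstar_subalgebra_intros[OF M])
  qed (simp_all add: cstar_subalgebra_intros[OF M] positive_functionalD[OF f] add_divide_distrib)
  show "cmod (restrict (\<lambda>x. f x / of_real t) M a) \<le> norm a" if "a \<in> M" for a
    using le[OF that] that t by (simp add: norm_divide field_simps)
  fix e :: real assume e: "e > 0"
  obtain a where a: "a \<in> M" "norm a \<le> 1" "1 - e * t < cmod (\<phi> a)"
    using states_norm_attained[OF M \<phi>, of "e * t"] e t by auto
  have "cmod (\<phi> a - f a) \<le> 1 - t"
    using le'[OF a(1)] mult_left_mono[OF a(2), of "1 - t"] t by simp
  then have "t - e * t < cmod (f a)"
    using a(3) norm_triangle_ineq2[of "\<phi> a" "\<phi> a - f a"] norm_triangle_ineq[of "\<phi> a - f a" "f a"] by simp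
  then have "1 - e < cmod (f a) / t" using t by (simp add: field_simps)
  then show "\<exists>a\<in>M. norm a \<le> 1 \<and> 1 - e < cmod (restrict (\<lambda>x. f x / of_real t) M a)"
    using a t by (intro bexI[of _ a]) (simp_all add: norm_divide)
qed simp

text \<open>Purity is applied to the convex combination of f / t and (\<phi> - f) / (1 - t). At t =
  0 and t = 1, where one of the quotients degenerates, the norm bounds alone decide.\<close>

lemma pure_state_summand:
  assumes M: "cstar_subalgebra M" and \<phi>: "\<phi> \<in> pure_states M"
    and f: "positive_functional M f" "positive_functional M (\<lambda>x. \<phi> x - f x)"
    and le: "\<And>x. x \<in> M \<Longrightarrow> cmod (f x) \<le> t * norm x"
      "\<And>x. x \<in> M \<Longrightarrow> cmod (\<phi> x - f x) \<le> (1 - t) * norm x"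
    and t: "0 \<le> t" "t \<le> 1" and x: "x \<in> M"
  shows "f x = of_real t * \<phi> x"
proof -
  have st: "\<phi> \<in> states M" using \<phi> by (simp add: pure_states_def)
  consider "t = 0" | "t = 1" | "0 < t" "t < 1" using t by linarith
  then show ?thesis
  proof cases
    case 1
    then show ?thesis using le(1)[OF x] by simp
  next
    case 2
    then show ?thesis using le(2)[OF x] by simp
  next
    case 3
    have 1: "restrict (\<lambda>x. f x / of_real t) M \<in> states M"
      by (rule state_of_summand[OF M st f(1) le]) (use 3 in auto)
    have 2: "restrict (\<lambda>x. (\<phi> x - f x) / of_real (1 - t)) M \<in> states M"
      by (rule state_of_summand[OF M st f(2)]) (use 3 le in auto)
    have "\<forall>a\<in>M. \<phi> a = complex_of_real t * restrict (\<lambda>x. f x / of_real t) M a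
        + complex_of_real (1 - t) * restrict (\<lambda>x. (\<phi> x - f x) / of_real (1 - t)) M a"
      using 3 by (simp add: field_simps)
    then have "restrict (\<lambda>x. f x / of_real t) M = \<phi>"
      using \<phi> 1 2 3 unfolding pure_states_def by blast
    then have "f x / of_real t = \<phi> x" using x by (metis restrict_apply')
    then show ?thesis using 3 by (simp add: field_simps)
  qed
qed

text \<open>With h = star c * c, the compressions of \<phi> by \<open>c\<close> and by sqrt (1 - h)
  are positive and, by commutativity, sum to \<phi>. Their norms are at most \<phi> h and 1 - \<phi>
  h, so purity makes the first a multiple of \<phi>.\<close>

lemma pure_state_compress:
  assumes M: "abelian_cstar_subalgebra M" and \<phi>: "\<phi> \<in> pure_states M"
    and c: "c \<in> M" "norm c < 1" and x: "x \<in> M"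
  shows "\<phi> (star c * (x * c)) = \<phi> (star c * c) * \<phi> x"
proof -
  have N: "cstar_subalgebra M" and comm: "\<And>a b. a \<in> M \<Longrightarrow> b \<in> M \<Longrightarrow> a * b = b * a"
    using M by (auto simp: abelian_cstar_subalgebra_def)
  have st: "\<phi> \<in> states M" using \<phi> by (simp add: pure_states_def)
  note pos = states_positive[OF st]
  note mem = cstar_subalgebra_intros[OF N]
  define h where "h = star c * c"
  have hM: "h \<in> M" unfolding h_def by (intro mem c)
  have hs: "star h = h" by (simp add: h_def star_mult star_star)
  have hn: "norm h < 1" using c by (simp add: h_def cstar_identity power_less_one_iff)
  obtain y where y: "y \<in> M" "star y = y" "y + y = h + y * y"
    by (rule sqrt_one_minus[OF N hM hs hn]) (rule that)
  \<comment> \<open>\<open>w\<close> is 1 - y, the square root of 1 - h.\<close>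
  define w where "w = Unitize (- y) 1"
  have w: "w \<in> unitize_set M" using y by (simp add: w_def mem)
  define f where "f z = \<phi> (star c * (z * c))" for z
  have f_eq: "f z = \<phi> (h * z)" if "z \<in> M" for z
    using comm[OF that c(1)] by (simp add: f_def h_def mult.assoc)
  have diff_eq: "\<phi> z - f z = unitize_fun \<phi> (star w * (Unitize z 0 * w))" if z: "z \<in> M" for z
  proof -
    have "h * z = (y + y) * z - y * (y * z)" using y(3) by (simp add: algebra_simps)
    also have "\<dots> = y * z + z * y - y * (z * y)"
      using comm[OF y(1) z] by (simp add: distrib_right)
    finally have "elem (star w * (Unitize z 0 * w)) = z - h * z"
      using y(2) by (simp add: w_def star_Unitize star_minus algebra_simps)
    moreover have "scal (star w * (Unitize z 0 * w)) = 0" by (simp add: w_def)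
    ultimately show ?thesis
      using z hM by (simp add: unitize_fun_def f_eq positive_functional_diff[OF N pos] mem)
  qed
  define t where "t = Re (\<phi> h)"
  have th: "\<phi> h = of_real t" "0 \<le> t"
    using positive_functional_nonneg[OF pos c(1)] by (auto simp: t_def h_def complex_nonneg_Reals_iff complex_eq_iff)
  have "f x = of_real t * \<phi> x"
  proof (rule pure_state_summand[OF N \<phi> _ _ _ _ _ _ x])
    show "positive_functional M f"
      unfolding positive_functional_def
    proof (intro conjI ballI allI)
      fix a assume a: "a \<in> M"
      have "f (star a * a) = \<phi> (star (a * c) * (a * c))" by (simp add: f_def star_mult mult.assoc)
      then show "f (star a * a) \<in> \<real>\<^sub>\<ge>\<^sub>0"
        using positive_functional_nonneg[OF pos, of "a * c"] a c by (simp add: mem)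
    qed (simp_all add: f_def distrib_left distrib_right mult_scaleC_left mult_scaleC_right
          positive_functionalD[OF pos] mem c)
    then show "positive_functional M (\<lambda>x. \<phi> x - f x)"
      unfolding positive_functional_def
    proof (intro conjI ballI allI)
      fix a assume a: "a \<in> M"
      have "star w * (Unitize (star a * a) 0 * w) = star (Unitize a 0 * w) * (Unitize a 0 * w)"
        by (simp add: star_mult star_Unitize mult.assoc flip: Unitize_mult)
      then show "\<phi> (star a * a) - f (star a * a) \<in> \<real>\<^sub>\<ge>\<^sub>0"
        using positive_functional_nonneg[OF positive_functional_unitize[OF N st], of "Unitize a 0 * w"] a w
        by (simp add: diff_eq mem cstar_subalgebra_mult[OF cstar_subalgebra_unitize_set[OF N]])
    qed (simp_all add: positive_functionalD[OF pos] algebra_simps)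
    show "cmod (f z) \<le> t * norm z" if z: "z \<in> M" for z
      using state_compress_le[OF N st, of "Unitize c 0" z] z c
      by (simp add: star_Unitize Unitize_mult unitize_fun_def f_def t_def h_def)
    show "cmod (\<phi> z - f z) \<le> (1 - t) * norm z" if z: "z \<in> M" for z
    proof -
      have "elem (star w * w) = - h"
        using y(2,3) by (simp add: w_def star_Unitize star_minus algebra_simps)
      moreover have "\<phi> (- h) = - \<phi> h"
        using positive_functional_scaleR[OF pos hM, of "-1"] by simp
      ultimately have "Re (unitize_fun \<phi> (star w * w)) = 1 - t"
        by (simp add: unitize_fun_def t_def w_def)
      then show ?thesis using state_compress_le[OF N st w z] by (simp add: diff_eq[OF z])
    qed
    show "t \<le> 1"
      using states_norm_le[OF N st hM] hn complex_Re_le_cmod[of "\<phi> h"] by (simp add: t_def)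
  qed (rule th)
  then show ?thesis using th by (simp add: f_def h_def)
qed

text \<open>Scaling extends \<open>pure_state_compress\<close> to all \<open>c\<close>; polarization
  then yields \<phi> (u * (a * b)) = \<phi> (u * b) * \<phi> a, from which an approximate unit
  \<open>u\<close> for \<open>b\<close> is removed.\<close>

lemma pure_state_multiplicative:
  assumes M: "abelian_cstar_subalgebra M" and \<phi>: "\<phi> \<in> pure_states M" and ab: "a \<in> M" "b \<in> M"
  shows "\<phi> (a * b) = \<phi> a * \<phi> b"
proof -
  have N: "cstar_subalgebra M" and comm: "\<And>a b. a \<in> M \<Longrightarrow> b \<in> M \<Longrightarrow> a * b = b * a"
    using M by (auto simp: abelian_cstar_subalgebra_def)
  have st: "\<phi> \<in> states M" using \<phi> by (simp add: pure_states_def)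
  note pos = states_positive[OF st]
  note mem = cstar_subalgebra_intros[OF N]
  have diag: "\<phi> (star c * (a * c)) = \<phi> (star c * c) * \<phi> a" if c: "c \<in> M" for c
  proof -
    define r where "r = norm c + 1"
    have r: "r > 0" using norm_ge_zero[of c] by (simp add: r_def add_nonneg_pos)
    define d where "d = (1 / r) *\<^sub>R c"
    have "norm d < 1" "d \<in> M" "c = r *\<^sub>R d" using r c by (simp_all add: d_def r_def mem)
    then show ?thesis
      using pure_state_compress[OF M \<phi> _ _ ab(1), of d] ab
      by (simp add: star_scaleR positive_functional_scaleR[OF pos] mem)
  qed
  have "cmod (\<phi> (a * b) - \<phi> a * \<phi> b) \<le> 0"
  proof (rule field_le_epsilon)
    fix e :: real assume "e > 0"
    define \<delta> where "\<delta> = e / (2 * (norm a + 1))"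
    have na: "norm a + 1 > 0" using norm_ge_zero[of a] by linarith
    then have "\<delta> > 0" using \<open>e > 0\<close> by (simp add: \<delta>_def)
    then obtain u where u: "u \<in> M" "star u = u" "norm (b - u * b) \<le> \<delta>"
      using approximate_unit[OF N ab(2)] by blast
    have "\<phi> (star u * (a * b)) = \<phi> (star u * b) * \<phi> a"
      by (rule compression_polarization[OF N pos N subset_refl ab(1) diag u(1) ab(2)])
    then have eq: "\<phi> (a * (u * b)) = \<phi> (u * b) * \<phi> a"
      using comm[OF u(1) ab(1)] u(2) by (simp flip: mult.assoc)
    have "\<phi> (a * b) - \<phi> a * \<phi> b = \<phi> (a * (b - u * b)) - \<phi> a * \<phi> (b - u * b)"
      using ab u by (simp add: right_diff_distrib positive_functional_diff[OF N pos] mem eq)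
    also have "cmod \<dots> \<le> norm (a * (b - u * b)) + norm a * norm (b - u * b)"
      using ab u
      by (intro order_trans[OF norm_triangle_ineq4] add_mono states_norm_le[OF N st])
         (auto simp: norm_mult mem intro!: mult_mono states_norm_le[OF N st])
    also have "\<dots> \<le> 2 * (norm a * \<delta>)"
      using norm_mult_ineq[of a "b - u * b"] mult_left_mono[OF u(3), of "norm a"] by simp
    also have "\<dots> \<le> 2 * ((norm a + 1) * \<delta>)"
      using \<open>\<delta> > 0\<close> by (intro mult_left_mono mult_right_mono) auto
    also have "\<dots> = e" using na by (simp add: \<delta>_def field_simps)
    finally show "cmod (\<phi> (a * b) - \<phi> a * \<phi> b) \<le> 0 + e" by simp
  qed
  then show ?thesis by simp
qed

text \<open>If \<phi> a = 0 then \<phi> (star a * a) = 0, so each convex component vanishes at star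
  a * a and, by Kadison, at \<open>a\<close>. The kernel of \<phi> has codimension one in
  \<open>N\<close>, so a component is a multiple of \<phi>, and equality of norms makes the factor
  1.\<close>

lemma multiplicative_state_pure:
  assumes N: "cstar_subalgebra N" and \<phi>: "\<phi> \<in> states N"
    and mult: "\<And>a b. a \<in> N \<Longrightarrow> b \<in> N \<Longrightarrow> \<phi> (a * b) = \<phi> a * \<phi> b"
  shows "\<phi> \<in> pure_states N"
proof -
  note mem = cstar_subalgebra_intros[OF N]
  obtain e where e: "e \<in> N" "\<phi> e = 1" using states_one[OF N \<phi>] .
  have eq: "\<psi> = \<phi>" if \<psi>: "\<psi> \<in> states N" "\<psi>' \<in> states N" and t: "0 < t" "t < 1"
    and cvx: "\<forall>a\<in>N. \<phi> a = complex_of_real t * \<psi> a + complex_of_real (1 - t) * \<psi>' a" for \<psi> \<psi>' t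
  proof -
    have null: "\<psi> a = 0" if a: "a \<in> N" "\<phi> a = 0" for a
    proof -
      have "\<phi> (star a * a) = 0" using a mult[of "star a" a] by (simp add: mem)
      moreover have aa: "star a * a \<in> N" by (intro mem a)
      moreover have "Re (\<phi> (star a * a)) = t * Re (\<psi> (star a * a)) + (1 - t) * Re (\<psi>' (star a * a))"
        using cvx[rule_format, OF aa] by simp
      ultimately have "t * Re (\<psi> (star a * a)) + (1 - t) * Re (\<psi>' (star a * a)) = 0" by simp
      moreover have "0 \<le> Re (\<psi> (star a * a))" "0 \<le> Re (\<psi>' (star a * a))"
        using positive_functional_nonneg[OF states_positive[OF \<psi>(1)] a(1)]
          positive_functional_nonneg[OF states_positive[OF \<psi>(2)] a(1)]
        by (auto simp: complex_nonneg_Reals_iff)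
      ultimately have "t * Re (\<psi> (star a * a)) \<le> 0"
        using t mult_nonneg_nonneg[of "1 - t" "Re (\<psi>' (star a * a))"] by linarith
      then have "Re (\<psi> (star a * a)) \<le> 0" using t by (simp add: mult_le_0_iff)
      then have "(cmod (\<psi> a))\<^sup>2 \<le> 0" using states_Kadison[OF N \<psi>(1) a(1)] by linarith
      then show ?thesis by simp
    qed
    have mul: "\<psi> a = \<phi> a * \<psi> e" if a: "a \<in> N" for a
    proof -
      have "\<psi> (a - scaleC (\<phi> a) e) = 0"
        using a e by (intro null) (simp_all add: mem positive_functional_diff[OF N states_positive[OF \<phi>]]
            positive_functional_scaleC[OF states_positive[OF \<phi>]])
      then show ?thesis
        using a e by (simp add: mem positive_functional_diff[OF N states_positive[OF \<psi>(1)]]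
            positive_functional_scaleC[OF states_positive[OF \<psi>(1)]])
    qed
    \<comment> \<open>Replacing \<open>e\<close> by star e * e shows that the factor \<psi> e is
      nonnegative; comparing norms alone would leave its phase open.\<close>
    have "\<phi> (star e * e) = 1" using e mult[of "star e" e] states_star[OF N \<phi> e(1)] by (simp add: mem)
    then have "\<psi> e = \<psi> (star e * e)" using mul[of "star e * e"] e by (simp add: mem)
    then have ce: "\<psi> e \<in> \<real>\<^sub>\<ge>\<^sub>0"
      using positive_functional_nonneg[OF states_positive[OF \<psi>(1)] e(1)] by simp
    define c where "c = cmod (\<psi> e)"
    have pe: "\<psi> e = of_real c"
      using ce by (auto simp: c_def complex_nonneg_Reals_iff complex_eq_iff cmod_eq_Re)
    have "c \<le> 1"
    proof (rule field_le_epsilon)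
      fix \<epsilon> :: real assume \<epsilon>: "\<epsilon> > 0"
      show "c \<le> 1 + \<epsilon>"
      proof (rule ccontr)
        assume "\<not> c \<le> 1 + \<epsilon>"
        then have c: "c > 1 + \<epsilon>" by simp
        obtain a where a: "a \<in> N" "norm a \<le> 1" "1 - (1 - 1 / c) < cmod (\<phi> a)"
          using states_norm_attained[OF N \<phi>, of "1 - 1 / c"] c \<epsilon> by auto
        have "1 < cmod (\<phi> a) * c" using a(3) c \<epsilon> by (simp add: field_simps)
        also have "\<dots> = cmod (\<psi> a)" using mul[OF a(1)] by (simp add: norm_mult c_def)
        also have "\<dots> \<le> 1" using states_norm_le[OF N \<psi>(1) a(1)] a(2) by simp
        finally show False by simp
      qed
    qed
    moreover have "1 \<le> c"
    proof (rule field_le_epsilon)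
      fix \<epsilon> :: real assume \<epsilon>: "\<epsilon> > 0"
      obtain a where a: "a \<in> N" "norm a \<le> 1" "1 - \<epsilon> < cmod (\<psi> a)"
        using states_norm_attained[OF N \<psi>(1) \<epsilon>] .
      have "cmod (\<psi> a) = cmod (\<phi> a) * c" using mul[OF a(1)] by (simp add: norm_mult c_def)
      also have "\<dots> \<le> 1 * c"
        using states_norm_le[OF N \<phi> a(1)] a(2) by (intro mult_right_mono) (auto simp: c_def)
      finally show "1 \<le> c + \<epsilon>" using a(3) by simp
    qed
    ultimately have "c = 1" by simp
    then have "\<psi> a = \<phi> a" if "a \<in> N" for a using mul[OF that] pe by simp
    moreover have "\<psi> \<in> extensional N" "\<phi> \<in> extensional N" using \<psi>(1) \<phi> by (auto simp: states_def)
    ultimately show ?thesis by (intro extensionalityI)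
  qed
  show ?thesis
    unfolding pure_states_def
  proof (intro CollectI conjI ballI allI impI \<phi>)
    fix \<psi> \<psi>' t assume s: "\<psi> \<in> states N" "\<psi>' \<in> states N"
      and t: "0 < t \<and> t < 1 \<and> (\<forall>a\<in>N. \<phi> a = complex_of_real t * \<psi> a + complex_of_real (1 - t) * \<psi>' a)"
    show "\<psi> = \<phi>" using eq[OF s, of t] t by blast
    show "\<psi>' = \<phi>" using eq[OF s(2,1), of "1 - t"] t by (simp add: add.commute)
  qed
qed

section \<open>Extension of states\<close>

definition sublinear :: "('a::real_vector \<Rightarrow> real) \<Rightarrow> bool" where
  "sublinear p \<longleftrightarrow> (\<forall>x y. p (x + y) \<le> p x + p y) \<and> (\<forall>r\<ge>0. \<forall>x. p (r *\<^sub>R x) = r * p x)"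

lemma sublinearD:
  assumes "sublinear p"
  shows sublinear_add: "p (x + y) \<le> p x + p y"
    and sublinear_scaleR: "0 \<le> r \<Longrightarrow> p (r *\<^sub>R x) = r * p x"
    and sublinear_zero: "p 0 = 0"
    and sublinear_minus: "- p (- x) \<le> p x"
proof -
  show 1: "p (x + y) \<le> p x + p y" "0 \<le> r \<Longrightarrow> p (r *\<^sub>R x) = r * p x" for x y r
    using assms by (auto simp: sublinear_def)
  show 2: "p 0 = 0" using 1(2)[of 0 0] by simp
  show "- p (- x) \<le> p x" using 1(1)[of x "- x"] 2 by simp
qed

text \<open>Enlarging the epigraph of \<open>p\<close> by a convex cone of vectors \<open>s\<close> with prescribed lower bounds
  \<open>c\<close>.  Used both to put a given functional below \<open>p\<close> and to see that minimal sublinear functionals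
  are linear.\<close>
lemma sublinear_cone_inf:
  assumes p: "sublinear p" and K0: "(0, 0) \<in> K"
    and K_add: "\<And>s c s' c'. (s, c) \<in> K \<Longrightarrow> (s', c') \<in> K \<Longrightarrow> (s + s', c + c') \<in> K"
    and K_scale: "\<And>s c r. (s, c) \<in> K \<Longrightarrow> 0 \<le> r \<Longrightarrow> (r *\<^sub>R s, r * c) \<in> K"
    and le: "\<And>s c. (s, c) \<in> K \<Longrightarrow> c \<le> p s"
  obtains q where "sublinear q" "\<And>x. q x \<le> p x" "\<And>x s c. (s, c) \<in> K \<Longrightarrow> q x \<le> p (x + s) - c"
proof -
  define q where "q x = (INF (s, c)\<in>K. p (x + s) - c)" for x
  \<comment> \<open>The assumption c \<le> p s keeps the infimum finite: every term is at least - p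
    (- x).\<close>
  have bdd: "bdd_below ((\<lambda>(s, c). p (x + s) - c) ` K)" for x
  proof -
    have "- p (- x) \<le> p (x + s) - c" if "(s, c) \<in> K" for s c
      using le[OF that] sublinear_add[OF p, of "x + s" "- x"] by simp
    then show ?thesis by (intro bdd_belowI2[of _ "- p (- x)"]) auto
  qed
  have qle: "q x \<le> p (x + s) - c" if "(s, c) \<in> K" for x s c
    unfolding q_def using cINF_lower[OF bdd that, of x] by simp
  have qge: "m \<le> q x" if "\<And>s c. (s, c) \<in> K \<Longrightarrow> m \<le> p (x + s) - c" for m x
    unfolding q_def using K0 that by (intro cINF_greatest) auto
  have qp: "q x \<le> p x" for x using qle[OF K0, of x] by simp
  have add: "q (x + y) \<le> q x + q y" for x y
  proof -
    have 1: "q (x + y) \<le> (p (x + s) - c) + (p (y + s') - c')" if "(s, c) \<in> K" "(s', c') \<in> K" for s c s' c'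
    proof -
      have "q (x + y) \<le> p ((x + s) + (y + s')) - (c + c')"
        using qle[OF K_add[OF that], of "x + y"] by (simp add: algebra_simps)
      then show ?thesis using sublinear_add[OF p, of "x + s" "y + s'"] by simp
    qed
    have "q (x + y) - (p (x + s) - c) \<le> q y" if "(s, c) \<in> K" for s c
      using 1[OF that] by (intro qge) (simp add: algebra_simps)
    then have "q (x + y) - q y \<le> q x" by (intro qge) (simp add: algebra_simps)
    then show ?thesis by simp
  qed
  have scale_le: "q (r *\<^sub>R x) \<le> r * q x" if r: "r > 0" for r x
  proof -
    have "q (r *\<^sub>R x) / r \<le> q x"
    proof (rule qge)
      fix s c assume "(s, c) \<in> K"
      then have "q (r *\<^sub>R x) \<le> p (r *\<^sub>R x + r *\<^sub>R s) - r * c" using r by (intro qle K_scale) auto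
      also have "\<dots> = r * (p (x + s) - c)"
        using r sublinear_scaleR[OF p, of r "x + s"] by (simp add: algebra_simps)
      finally show "q (r *\<^sub>R x) / r \<le> p (x + s) - c" using r by (simp add: field_simps)
    qed
    then show ?thesis using r by (simp add: field_simps)
  qed
  have scale: "q (r *\<^sub>R x) = r * q x" if r: "r \<ge> 0" for r x
  proof (cases "r = 0")
    case True
    have "q 0 \<ge> 0" using le by (intro qge) simp
    moreover have "q 0 \<le> 0" using qp[of 0] sublinear_zero[OF p] by simp
    ultimately show ?thesis using True by simp
  next
    case False
    then have r: "r > 0" using r by simp
    have "q ((1 / r) *\<^sub>R (r *\<^sub>R x)) \<le> (1 / r) * q (r *\<^sub>R x)" using r by (intro scale_le) simp
    then have "r * q x \<le> q (r *\<^sub>R x)" using r by (simp add: field_simps)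
    then show ?thesis using scale_le[OF r, of x] by simp
  qed
  have "sublinear q" using add scale by (auto simp: sublinear_def)
  then show thesis using that qp qle by blast
qed

text \<open>Zorn's lemma for the reversed order. Pointwise infima of chains are finite since all
  members are at least - p (- x), and subadditivity survives because, of two members of a chain, the
  smaller one bounds both terms.\<close>

lemma minimal_sublinear_exists:
  assumes p: "sublinear p"
  obtains q where "sublinear q" "q \<le> p" "\<And>r. sublinear r \<Longrightarrow> r \<le> q \<Longrightarrow> r = q"
proof -
  define A where "A = {q. sublinear q \<and> q \<le> p}"
  have "\<exists>m\<in>A. \<forall>a\<in>A. a \<le> m \<longrightarrow> a = m"
  proof (rule predicate_Zorn)
    show "partial_order_on A (relation_of (\<lambda>x y. y \<le> x) A)"
      by (rule partial_order_on_relation_ofI) auto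
    fix C assume C: "C \<in> Chains (relation_of (\<lambda>x y. y \<le> x) A)"
    then have CA: "q \<in> A" if "q \<in> C" for q
      using that by (auto simp: Chains_def relation_of_def)
    have Cc: "q \<le> r \<or> r \<le> q" if "q \<in> C" "r \<in> C" for q r
      using C that by (auto simp: Chains_def relation_of_def)
    show "\<exists>u\<in>A. \<forall>a\<in>C. u \<le> a"
    proof (cases "C = {}")
      case True
      then show ?thesis using p by (auto simp: A_def)
    next
      case False
      define u where "u x = (INF q\<in>C. q x)" for x
      have lower: "- p (- x) \<le> q x" if "q \<in> C" for q x
      proof -
        have q: "sublinear q" "q \<le> p" using CA[OF that] by (auto simp: A_def)
        then show ?thesis
          using sublinear_minus[OF q(1), of x] le_funD[OF q(2), of "- x"] by linarith
      qed
      have bdd: "bdd_below ((\<lambda>q. q x) ` C)" for x using lower by (auto simp: bdd_below_def)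
      have ule: "u x \<le> q x" if "q \<in> C" for q x unfolding u_def by (rule cINF_lower[OF bdd that])
      have uge: "m \<le> u x" if "\<And>q. q \<in> C \<Longrightarrow> m \<le> q x" for m x
        unfolding u_def by (rule cINF_greatest[OF False that])
      have "u (x + y) \<le> u x + u y" for x y
      proof -
        have 1: "u (x + y) \<le> q x + r y" if qr: "q \<in> C" "r \<in> C" for q r
        proof -
          have sq: "sublinear q" "sublinear r" using CA qr by (auto simp: A_def)
          from Cc[OF qr] show ?thesis
          proof
            assume "q \<le> r"
            then show ?thesis
              using ule[OF qr(1), of "x + y"] sublinear_add[OF sq(1), of x y] le_funD[of q r y] by linarith
          next
            assume "r \<le> q"
            then show ?thesis
              using ule[OF qr(2), of "x + y"] sublinear_add[OF sq(2), of x y] le_funD[of r q x] by linarith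
          qed
        qed
        have "u (x + y) - q x \<le> u y" if "q \<in> C" for q
          using 1[OF that] by (intro uge) (simp add: algebra_simps)
        then have "u (x + y) - u y \<le> u x" by (intro uge) (simp add: algebra_simps)
        then show ?thesis by simp
      qed
      moreover have "u (r *\<^sub>R x) = r * u x" if r: "r \<ge> 0" for r x
      proof -
        have eq: "q (r *\<^sub>R x) = r * q x" if "q \<in> C" for q
          using CA[OF that] r by (auto simp: A_def sublinear_scaleR)
        show ?thesis
        proof (cases "r = 0")
          case True
          have q0: "q 0 = 0" if "q \<in> C" for q
            using CA[OF that] sublinear_zero by (auto simp: A_def)
          obtain q where qC: "q \<in> C" using False by blast
          then have "u 0 \<le> 0" using ule[OF qC, of 0] q0[OF qC] by simp
          moreover have "0 \<le> u 0" by (rule uge) (use q0 in fastforce)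
          ultimately show ?thesis using True by simp
        next
          case False
          then have r0: "r > 0" using r by simp
          show ?thesis
          proof (rule antisym)
            have "u (r *\<^sub>R x) / r \<le> u x"
              using ule[of _ "r *\<^sub>R x"] r0 by (intro uge) (simp add: eq field_simps)
            then show "u (r *\<^sub>R x) \<le> r * u x" using r0 by (simp add: field_simps)
            show "r * u x \<le> u (r *\<^sub>R x)"
              using ule[of _ x] r0 by (intro uge) (simp add: eq)
          qed
        qed
      qed
      ultimately have "sublinear u" by (auto simp: sublinear_def)
      moreover have "u \<le> p"
      proof (rule le_funI)
        fix x
        obtain q where qC: "q \<in> C" using False by blast
        then have "q \<le> p" using CA by (auto simp: A_def)
        then show "u x \<le> p x" using ule[OF qC, of x] le_funD[of q p x] by linarith
      qed
      ultimately have "u \<in> A" by (simp add: A_def)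
      then show ?thesis using ule by (auto simp: le_fun_def)
    qed
  qed
  then obtain m where m: "m \<in> A" "\<And>a. a \<in> A \<Longrightarrow> a \<le> m \<Longrightarrow> a = m" by blast
  show thesis
  proof (rule that)
    show "sublinear m" "m \<le> p" using m(1) by (auto simp: A_def)
    then show "r = m" if "sublinear r" "r \<le> m" for r
      using that order_trans[of r m p] by (intro m(2)) (auto simp: A_def)
  qed
qed

text \<open>Lowering \<open>q\<close> along the ray through \<open>y\<close> gives a sublinear
  functional below \<open>q\<close>, so by minimality nothing is lowered. This says q x \<le> q (x +
  y) - q y, the missing half of additivity.\<close>

lemma minimal_sublinear_linear:
  assumes q: "sublinear q" and min: "\<And>r. sublinear r \<Longrightarrow> r \<le> q \<Longrightarrow> r = q"
  shows "linear q"
proof -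
  have add: "q (x + y) = q x + q y" for x y
  proof -
    define K where "K = {(t *\<^sub>R y, t * q y) | t. 0 \<le> t}"
    obtain r where r: "sublinear r" "\<And>x. r x \<le> q x" "\<And>x s c. (s, c) \<in> K \<Longrightarrow> r x \<le> q (x + s) - c"
    proof (rule sublinear_cone_inf[OF q, of K])
      show "(0, 0) \<in> K" by (auto simp: K_def intro!: exI[of _ 0])
      show "(s + s', c + c') \<in> K" if K: "(s, c) \<in> K" "(s', c') \<in> K" for s c s' c'
      proof -
        from K obtain t t' where "s = t *\<^sub>R y" "c = t * q y" "0 \<le> t" "s' = t' *\<^sub>R y" "c' = t' * q y" "0 \<le> t'"
          by (auto simp: K_def)
        then show ?thesis unfolding K_def
          by (intro CollectI exI[of _ "t + t'"]) (simp add: algebra_simps)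
      qed
      show "(r *\<^sub>R s, r * c) \<in> K" if K: "(s, c) \<in> K" and r: "0 \<le> r" for s c r
      proof -
        from K obtain t where "s = t *\<^sub>R y" "c = t * q y" "0 \<le> t" by (auto simp: K_def)
        then show ?thesis using r unfolding K_def
          by (intro CollectI exI[of _ "r * t"]) simp
      qed
      show "c \<le> q s" if "(s, c) \<in> K" for s c
        using that by (auto simp: K_def sublinear_scaleR[OF q])
    qed blast
    have "r = q" by (rule min[OF r(1)]) (simp add: le_fun_def r(2))
    moreover have "(y, q y) \<in> K" unfolding K_def by (intro CollectI exI[of _ 1]) simp
    ultimately have "q x \<le> q (x + y) - q y" using r(3) by blast
    then show ?thesis using sublinear_add[OF q, of x y] by simp
  qed
  have minus: "q (- x) = - q x" for x using add[of x "- x"] sublinear_zero[OF q] by simp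
  have "q (r *\<^sub>R x) = r * q x" for r x
  proof (cases "r \<ge> 0")
    case False
    then show ?thesis using sublinear_scaleR[OF q, of "- r" x] minus[of "r *\<^sub>R x"] by simp
  qed (simp add: sublinear_scaleR[OF q])
  with add show ?thesis by (intro linearI) auto
qed

text \<open>With the graph of \<open>f\<close> as the cone, \<open>p\<close> is lowered to a
  functional that is at most \<open>f\<close> on \<open>S\<close>. A linear functional below it is
  also at most \<open>f\<close> there, and on a subspace this forces equality.\<close>

theorem Hahn_Banach_sublinear:
  fixes p :: "'a::real_vector \<Rightarrow> real"
  assumes p: "sublinear p" and S: "subspace S"
    and f_add: "\<And>x y. x \<in> S \<Longrightarrow> y \<in> S \<Longrightarrow> f (x + y) = f x + f y"
    and f_scale: "\<And>x r. x \<in> S \<Longrightarrow> f (r *\<^sub>R x) = r * f x"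
    and f_le: "\<And>x. x \<in> S \<Longrightarrow> f x \<le> p x"
  obtains g where "linear g" "\<And>x. g x \<le> p x" "\<And>x. x \<in> S \<Longrightarrow> g x = f x"
proof -
  have f_minus: "f (- x) = - f x" if "x \<in> S" for x using f_scale[OF that, of "-1"] by simp
  define K where "K = (\<lambda>s. (s, f s)) ` S"
  obtain q where q: "sublinear q" "\<And>x. q x \<le> p x" "\<And>x s c. (s, c) \<in> K \<Longrightarrow> q x \<le> p (x + s) - c"
  proof (rule sublinear_cone_inf[OF p, of K])
    have "f 0 = 0" using f_scale[OF subspace_0[OF S], of 0] by simp
    then show "(0, 0) \<in> K" using subspace_0[OF S] by (auto simp: K_def image_iff intro!: bexI[of _ 0])
  qed (auto simp: K_def f_add f_scale f_le subspace_add[OF S] subspace_scale[OF S])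
  obtain g where g: "sublinear g" "g \<le> q" "\<And>r. sublinear r \<Longrightarrow> r \<le> g \<Longrightarrow> r = g"
    using minimal_sublinear_exists[OF q(1)] by blast
  have lin: "linear g" by (rule minimal_sublinear_linear[OF g(1,3)])
  have gle: "g x \<le> f x" if x: "x \<in> S" for x
  proof -
    have "(- x, f (- x)) \<in> K" using subspace_neg[OF S x] by (auto simp: K_def)
    from q(3)[OF this, of x] have "q x \<le> f x" using f_minus[OF x] sublinear_zero[OF p] by simp
    then show ?thesis using le_funD[OF g(2), of x] by linarith
  qed
  have "g x = f x" if x: "x \<in> S" for x
    using gle[OF x] gle[OF subspace_neg[OF S x]] f_minus[OF x] linear_neg[OF lin, of x] by simp
  moreover have "g x \<le> p x" for x using le_funD[OF g(2), of x] q(2)[of x] by linarith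
  ultimately show thesis using that lin by blast
qed

section \<open>Extending characters along homomorphisms that are injective on a subalgebra\<close>

definition unitize_hom :: "('a::cstar_algebra \<Rightarrow> 'b::cstar_algebra) \<Rightarrow> 'a unitization \<Rightarrow> 'b unitization" where
  "unitize_hom \<rho> x = Unitize (\<rho> (elem x)) (scal x)"

lemma star_homomorphism_zero: "star_homomorphism \<rho> \<Longrightarrow> \<rho> 0 = 0"
  by (rule linear_0[OF star_homomorphism_linear])

lemma star_homomorphism_diff: "star_homomorphism \<rho> \<Longrightarrow> \<rho> (a - b) = \<rho> a - \<rho> b"
  by (rule linear_diff[OF star_homomorphism_linear])

lemma star_homomorphism_unitize:
  "star_homomorphism \<rho> \<Longrightarrow> star_homomorphism (unitize_hom \<rho>)"
  by (auto simp: star_homomorphism_def unitize_hom_def unitization_eq_iff)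

lemma unitize_hom_one: "star_homomorphism \<rho> \<Longrightarrow> unitize_hom \<rho> 1 = 1"
  by (simp add: unitize_hom_def unitization_eq_iff star_homomorphism_zero)

text \<open>For selfadjoint \<open>h\<close> and s = norm (\<rho> h), the function f x = x - max (-
  s) (min s x) vanishes on [-s, s], so \<rho> kills f h. Injectivity gives f h = 0, which makes
  \<open>h\<close> equal to its truncation at \<open>s\<close>.\<close>

theorem injective_star_homomorphism_isometric:
  assumes \<rho>: "star_homomorphism \<rho>" and M: "cstar_subalgebra M" and inj: "inj_on \<rho> M" and m: "m \<in> M"
  shows "norm (\<rho> m) = norm m"
proof -
  have sa: "norm h \<le> norm (\<rho> h)" if h: "h \<in> M" "star h = h" for h
  proof -
    define s where "s = norm (\<rho> h)"
    define H where "H = Unitize h 0"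
    define f where "f x = x - max (- s) (min s x)" for x :: real
    have f: "continuous_on S f" for S unfolding f_def by (intro continuous_intros)
    have s0: "0 \<le> s" by (simp add: s_def)
    have H: "star H = H" by (simp add: H_def star_Unitize h)
    have "cfc H f \<in> (\<lambda>a. Unitize a 0) ` M"
      using h s0 by (intro cfc_mem[OF cstar_subalgebra_Unitize[OF M] _ H f]) (auto simp: H_def f_def)
    then obtain g where g: "g \<in> M" "cfc H f = Unitize g 0" by auto
    have rH: "unitize_hom \<rho> H = Unitize (\<rho> h) 0" by (simp add: unitize_hom_def H_def)
    have "unitize_hom \<rho> (cfc H f) = cfc (unitize_hom \<rho> H) f"
      by (rule cfc_homomorphism[OF star_homomorphism_unitize[OF \<rho>] unitize_hom_one[OF \<rho>] H f])
    moreover have "norm (cfc (Unitize (\<rho> h) 0) f) \<le> 0"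
    proof (rule norm_cfc_le[OF _ f])
      show "star (Unitize (\<rho> h) 0) = Unitize (\<rho> h) 0"
        using h by (simp add: star_Unitize flip: star_homomorphism_star[OF \<rho>])
    qed (auto simp: f_def s_def)
    ultimately have "norm (\<rho> g) \<le> 0" by (simp add: g rH) (simp add: unitize_hom_def unitization_eq_iff)
    then have "\<rho> g = \<rho> 0" by (simp add: star_homomorphism_zero[OF \<rho>])
    then have "g = 0" using inj g(1) cstar_subalgebra_zero[OF M] by (auto dest: inj_onD)
    moreover have "norm (cfc H f - peval [:0, 1:] H) \<le> s"
      by (rule cfc_approx[OF H f]) (use s0 in \<open>auto simp: f_def\<close>)
    ultimately have "norm (Unitize 0 0 - H) \<le> s" by (simp add: g)
    then show ?thesis by (simp add: H_def s_def Unitize_diff)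
  qed
  have "(norm m)\<^sup>2 \<le> (norm (\<rho> m))\<^sup>2"
    using sa[of "star m * m"] m
    by (simp add: cstar_subalgebra_intros[OF M] star_mult star_star star_homomorphismD[OF \<rho>] cstar_identity)
  then have "norm m \<le> norm (\<rho> m)" by (rule power2_le_imp_le) simp
  then show ?thesis using star_homomorphism_contractive[OF \<rho>, of m] by simp
qed

text \<open>For selfadjoint \<open>k\<close> the element k + \<i> s has squared norm at most norm k
  ^ 2 + s^2, which excludes an imaginary part of f k as \<open>s\<close> varies. The real part is
  nonnegative because 1 - star b * b has norm at most 1 after scaling \<open>a\<close> to
  \<open>b\<close>.\<close>

lemma contractive_functional_positive:
  fixes f :: "'a::cstar_algebra_1 \<Rightarrow> complex"
  assumes add: "\<And>x y. f (x + y) = f x + f y" and scale: "\<And>c x. f (scaleC c x) = c * f x"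
    and le: "\<And>x. cmod (f x) \<le> norm x" and one: "f 1 = 1"
  shows "f (star a * a) \<in> \<real>\<^sub>\<ge>\<^sub>0"
proof -
  have scaleR: "f (r *\<^sub>R x) = of_real r * f x" for r x by (simp add: scaleR_scaleC scale)
  have diff: "f (x - y) = f x - f y" for x y
    using add[of x "(-1) *\<^sub>R y"] scaleR[of "-1" y] by simp
  define k where "k = star a * a"
  have k: "star k = k" by (simp add: k_def star_mult star_star)
  have "Im (f k) = 0"
  proof (rule ccontr)
    assume im: "Im (f k) \<noteq> 0"
    have bound: "(Im (f k) + s)\<^sup>2 \<le> (norm k)\<^sup>2 + s\<^sup>2" for s
    proof -
      define z where "z = k + scaleC (\<i> * of_real s) 1"
      have ii: "\<i> * of_real s * (\<i> * of_real s) = - (of_real s * of_real s :: complex)"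
        by (simp add: complex_eq_iff)
      have "star z * z = k * k + s\<^sup>2 *\<^sub>R 1"
        by (simp add: z_def star_add star_scaleC k distrib_left distrib_right mult_scaleC_left
            mult_scaleC_right scaleC_scaleC scaleC_minus_left scaleR_scaleC power2_eq_square
            left_diff_distrib scaleC_diff_right ii)
      then have "(norm z)\<^sup>2 = norm (k * k + s\<^sup>2 *\<^sub>R 1)" by (metis cstar_identity)
      also have "\<dots> \<le> (norm k)\<^sup>2 + s\<^sup>2"
        using norm_triangle_ineq[of "k * k" "s\<^sup>2 *\<^sub>R 1"] norm_selfadjoint_square[OF k] by simp
      finally have nz: "(norm z)\<^sup>2 \<le> (norm k)\<^sup>2 + s\<^sup>2" .
      have "f z = f k + \<i> * of_real s" by (simp add: z_def add scale one)
      then have "\<bar>Im (f k) + s\<bar> \<le> cmod (f z)" using abs_Im_le_cmod[of "f z"] by simp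
      then have "\<bar>Im (f k) + s\<bar>\<^sup>2 \<le> (norm z)\<^sup>2" using le[of z] by (intro power_mono) auto
      then show ?thesis using nz by simp
    qed
    have "Im (f k) * (2 * s) \<le> (norm k)\<^sup>2" for s
    proof -
      have "(Im (f k))\<^sup>2 + Im (f k) * (2 * s) \<le> (norm k)\<^sup>2"
        using bound[of s] by (simp add: power2_eq_square algebra_simps)
      then show ?thesis using zero_le_power2[of "Im (f k)"] by linarith
    qed
    \<comment> \<open>At this \<open>s\<close> the left side equals norm k ^ 2 + 1.\<close>
    from this[of "((norm k)\<^sup>2 + 1) / (2 * Im (f k))"] im show False by simp
  qed
  moreover have "0 \<le> Re (f k)"
  proof (cases "a = 0")
    case True
    then show ?thesis using scaleR[of 0 0] by (simp add: k_def)
  next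
    case False
    define b where "b = (1 / norm a) *\<^sub>R a"
    have "norm b \<le> 1" using False by (simp add: b_def)
    then have "norm (1 - star b * b) \<le> 1" by (rule norm_one_minus_star_mult)
    then have "cmod (1 - f (star b * b)) \<le> 1"
      using le[of "1 - star b * b"] by (simp add: diff one)
    then have "Re (1 - f (star b * b)) \<le> 1" using complex_Re_le_cmod order_trans by blast
    moreover have "star b * b = (1 / (norm a)\<^sup>2) *\<^sub>R k"
      by (simp add: b_def k_def star_scaleR power2_eq_square)
    ultimately have "0 \<le> (1 / (norm a)\<^sup>2) * Re (f k)" by (simp add: scaleR)
    then show ?thesis using False by (simp add: zero_le_divide_iff)
  qed
  ultimately show ?thesis by (simp add: k_def complex_nonneg_Reals_iff)
qed

text \<open>\<open>y\<close> is tested on x in \<open>M\<close> with \<bar>\<phi> x\<bar> close to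
  1: multiplicativity extracts the value at \<open>y\<close>, and the product y x lies in
  \<open>M\<close>, where \<rho> is isometric.\<close>

lemma unitize_fun_le_unitize_hom:
  assumes M: "cstar_subalgebra M" and \<phi>: "\<phi> \<in> states M"
    and mult: "\<And>a b. a \<in> M \<Longrightarrow> b \<in> M \<Longrightarrow> \<phi> (a * b) = \<phi> a * \<phi> b"
    and \<rho>: "star_homomorphism \<rho>" and inj: "inj_on \<rho> M" and y: "y \<in> unitize_set M"
  shows "cmod (unitize_fun \<phi> y) \<le> norm (unitize_hom \<rho> y)"
proof (rule field_le_epsilon)
  fix e :: real assume e: "e > 0"
  define t where "t = cmod (unitize_fun \<phi> y)"
  define d where "d = e / (t + 1)"
  have t: "0 \<le> t" by (simp add: t_def)
  then have d: "d > 0" using e by (simp add: d_def)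
  obtain x where x: "x \<in> M" "norm x \<le> 1" "1 - d < cmod (\<phi> x)"
    using states_norm_attained[OF M \<phi> d] .
  have yM: "elem y \<in> M" using y by (simp add: unitize_set_def)
  have lM: "left_mult y x \<in> M" unfolding left_mult_def by (intro cstar_subalgebra_intros[OF M] yM x)
  have "\<phi> (left_mult y x) = unitize_fun \<phi> y * \<phi> x"
    using yM x by (simp add: left_mult_def unitize_fun_def positive_functionalD[OF states_positive[OF \<phi>]]
        cstar_subalgebra_intros[OF M] mult algebra_simps)
  then have "t * cmod (\<phi> x) \<le> norm (left_mult y x)"
    using states_norm_le[OF M \<phi> lM] by (simp add: t_def norm_mult)
  also have "\<dots> = norm (\<rho> (left_mult y x))"
    by (rule injective_star_homomorphism_isometric[OF \<rho> M inj lM, symmetric])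
  also have "\<rho> (left_mult y x) = left_mult (unitize_hom \<rho> y) (\<rho> x)"
    by (simp add: left_mult_def unitize_hom_def star_homomorphismD[OF \<rho>])
  also have "norm \<dots> \<le> norm (unitize_hom \<rho> y) * norm (\<rho> x)" by (rule norm_left_mult)
  also have "\<dots> \<le> norm (unitize_hom \<rho> y) * 1"
    using star_homomorphism_contractive[OF \<rho>, of x] x by (intro mult_left_mono) auto
  finally have "t * cmod (\<phi> x) \<le> norm (unitize_hom \<rho> y)" by simp
  moreover have "t * (1 - d) \<le> t * cmod (\<phi> x)" using x t by (intro mult_left_mono) auto
  moreover have "t * d \<le> e" using t e by (simp add: d_def field_simps)
  ultimately show "t \<le> norm (unitize_hom \<rho> y) + e" by (simp add: algebra_simps)
qed

text \<open>Domination by \<open>P\<close> forces vanishing on the kernel of \<rho>, and P \<le>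
  norm bounds the extension. The unitization is used because there the bound together with the value
  1 at the unit yields positivity.\<close>

theorem character_extension_vanishing_on_kernel:
  assumes M: "cstar_subalgebra M" and \<phi>: "\<phi> \<in> states M"
    and mult: "\<And>a b. a \<in> M \<Longrightarrow> b \<in> M \<Longrightarrow> \<phi> (a * b) = \<phi> a * \<phi> b"
    and \<rho>: "star_homomorphism \<rho>" and inj: "inj_on \<rho> M"
  obtains \<psi> where "extends_to_state M \<phi> \<psi>" "\<And>a. \<rho> a = 0 \<Longrightarrow> \<psi> a = 0"
proof -
  define S where "S = unitize_set M"
  define P where "P x = norm (unitize_hom \<rho> x)" for x
  define f where "f x = Re (unitize_fun \<phi> x)" for x
  have S: "cstar_subalgebra S" unfolding S_def by (rule cstar_subalgebra_unitize_set[OF M])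
  note pos = positive_functional_unitize[OF M \<phi>, folded S_def]
  have lin: "linear (unitize_hom \<rho>)"
    by (rule star_homomorphism_linear[OF star_homomorphism_unitize[OF \<rho>]])
  have P: "sublinear P"
    unfolding sublinear_def P_def by (auto simp: linear_add[OF lin] linear_scale[OF lin] norm_triangle_ineq)
  have "subspace S" using S by (simp add: subspace_def cstar_subalgebra_intros)
  then obtain g where g: "linear g" "\<And>x. g x \<le> P x" "\<And>x. x \<in> S \<Longrightarrow> g x = f x"
  proof (rule Hahn_Banach_sublinear[OF P, of S f])
    fix x assume x: "x \<in> S"
    have "Re (unitize_fun \<phi> x) \<le> cmod (unitize_fun \<phi> x)" by (rule complex_Re_le_cmod)
    also have "\<dots> \<le> P x"
      using unitize_fun_le_unitize_hom[OF M \<phi> mult \<rho> inj] x by (simp add: P_def S_def)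
    finally show "f x \<le> P x" by (simp add: f_def)
  qed (auto simp: f_def positive_functional_add[OF pos] positive_functional_scaleR[OF pos])
  \<comment> \<open>The complex-linear functional with real part \<open>g\<close>.\<close>
  define G where "G x = Complex (g x) (- g (scaleC \<i> x))" for x
  have G_add: "G (x + y) = G x + G y" for x y
    by (simp add: G_def complex_eq_iff linear_add[OF g(1)] scaleC_add_right)
  have G_scaleR: "G (r *\<^sub>R x) = of_real r * G x" for r x
    by (simp add: G_def complex_eq_iff linear_scale[OF g(1)] scaleC_scaleR)
  have G_i: "G (scaleC \<i> x) = \<i> * G x" for x
    using linear_neg[OF g(1)] by (simp add: G_def complex_eq_iff scaleC_scaleC scaleC_minus_left)
  have G_scale: "G (scaleC c x) = c * G x" for c x
  proof -
    have "scaleC c x = Re c *\<^sub>R x + Im c *\<^sub>R scaleC \<i> x"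
      by (simp add: scaleR_scaleC scaleC_scaleC mult.commute[of "of_real _"] flip: scaleC_add_left complex_eq)
    then have "G (scaleC c x) = (of_real (Re c) + of_real (Im c) * \<i>) * G x"
      by (simp add: G_add G_scaleR G_i algebra_simps)
    moreover have "of_real (Re c) + of_real (Im c) * \<i> = c" by (simp add: complex_eq_iff)
    ultimately show ?thesis by simp
  qed
  have G_S: "G x = unitize_fun \<phi> x" if "x \<in> S" for x
    using that by (simp add: G_def g(3) f_def complex_eq_iff cstar_subalgebra_scaleC[OF S]
        positive_functional_scaleC[OF pos])
  have G_le: "cmod (G x) \<le> P x" for x
  proof (cases "G x = 0")
    case False
    \<comment> \<open>This unimodular factor rotates G x to a nonnegative real number, so the bound
      on the real part \<open>g\<close> bounds the modulus.\<close>
    define c where "c = cnj (G x) / cmod (G x)"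
    have "G (scaleC c x) = of_real (cmod (G x))"
      using False by (simp add: G_scale c_def complex_norm_square[symmetric] power2_eq_square mult.commute[of "cnj _"])
    then have "cmod (G x) = g (scaleC c x)" by (simp add: G_def complex_eq_iff)
    also have "\<dots> \<le> P (scaleC c x)" by (rule g(2))
    also have "\<dots> = P x"
      using False star_homomorphism_scaleC[OF star_homomorphism_unitize[OF \<rho>], of c x]
      by (simp add: P_def norm_scaleC c_def norm_divide)
    finally show ?thesis .
  qed (simp add: P_def)
  have P_le: "P x \<le> norm x" for x
    unfolding P_def by (rule star_homomorphism_contractive[OF star_homomorphism_unitize[OF \<rho>]])
  have G1: "G 1 = 1"
    using G_S[of 1] one_in_unitize_set[OF M] positive_functional_zero[OF M states_positive[OF \<phi>]]
    by (simp add: S_def unitize_fun_def)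
  have G_pos: "G (star x * x) \<in> \<real>\<^sub>\<ge>\<^sub>0" for x
    using G_le P_le order_trans by (intro contractive_functional_positive G_add G_scale G1) blast
  define \<psi> where "\<psi> a = G (Unitize a 0)" for a
  have \<psi>_le: "cmod (\<psi> a) \<le> norm (\<rho> a)" for a
    using G_le[of "Unitize a 0"] by (simp add: \<psi>_def P_def unitize_hom_def)
  have \<psi>_M: "\<psi> m = \<phi> m" if "m \<in> M" for m
    using that G_S[of "Unitize m 0"] by (simp add: \<psi>_def S_def unitize_fun_def)
  have "\<psi> \<in> states UNIV"
  proof (rule states_extensionI[OF cstar_subalgebra_UNIV M subset_UNIV _ _ _ \<phi>])
    show "positive_functional UNIV \<psi>"
      unfolding positive_functional_def
    proof (intro conjI ballI allI)
      fix a b :: 'a and c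
      have "Unitize (a + b) 0 = Unitize a 0 + Unitize b 0" "Unitize (scaleC c a) 0 = scaleC c (Unitize a 0)"
        "Unitize (star a * a) 0 = star (Unitize a 0) * Unitize a 0"
        by (simp_all add: unitization_eq_iff)
      then show "\<psi> (a + b) = \<psi> a + \<psi> b" "\<psi> (scaleC c a) = c * \<psi> a" "\<psi> (star a * a) \<in> \<real>\<^sub>\<ge>\<^sub>0"
        by (simp_all add: \<psi>_def G_add G_scale G_pos)
    qed
    show "cmod (\<psi> a) \<le> norm a" for a
      using \<psi>_le[of a] star_homomorphism_contractive[OF \<rho>, of a] by simp
  qed (simp_all add: \<psi>_M)
  moreover have "restrict \<psi> M = \<phi>"
    using \<phi> \<psi>_M by (intro extensionalityI[of _ M]) (auto simp: states_def)
  ultimately have "extends_to_state M \<phi> \<psi>" by (simp add: extends_to_state_def)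
  moreover have "\<psi> a = 0" if "\<rho> a = 0" for a using \<psi>_le[of a] that by simp
  ultimately show thesis using that by blast
qed

section \<open>Unique extensions\<close>

text \<open>Vanishing of \<omega> on the kernel makes the GNS seminorm of \<open>x\<close> depend on
  \<rho> x only. Hence k * x n behaves like 0 in every seminorm distance and represents the zero
  class.\<close>

lemma gns_rep_eq_zero:
  assumes \<omega>: "\<omega> \<in> states UNIV" and \<rho>: "star_homomorphism \<rho>"
    and ker: "\<And>a. \<rho> a = 0 \<Longrightarrow> \<omega> a = 0" and k: "\<rho> k = 0"
  shows "gns_rep \<omega> k = zero_operator (gns_space \<omega>)"
proof -
  note \<rho>_simps = star_homomorphismD[OF \<rho>] star_homomorphism_zero[OF \<rho>] star_homomorphism_diff[OF \<rho>]
    linear_neg[OF star_homomorphism_linear[OF \<rho>]]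
  have norm_eq: "gns_seminorm \<omega> x = gns_seminorm \<omega> y" if "\<rho> x = \<rho> y" for x y
  proof -
    have "\<omega> (star x * x - star y * y) = 0" by (rule ker) (simp add: \<rho>_simps that)
    then have "\<omega> (star x * x) = \<omega> (star y * y)"
      by (simp add: positive_functional_diff[OF cstar_subalgebra_UNIV states_positive[OF \<omega>]])
    then show ?thesis by (simp add: gns_seminorm_def)
  qed
  have zero: "gns_seminorm \<omega> 0 = 0"
    using positive_functional_zero[OF cstar_subalgebra_UNIV states_positive[OF \<omega>]]
    by (simp add: gns_seminorm_def)
  have image: "gns_rel \<omega> `` {\<lambda>n. k * x n} = gns_rel \<omega> `` {\<lambda>_. 0}" for x
  proof -
    have "gns_seminorm \<omega> (k * x m - y) = gns_seminorm \<omega> (0 - y)" for m y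
      by (rule norm_eq) (simp add: \<rho>_simps k)
    moreover have "gns_seminorm \<omega> (k * x m - k * x n) = 0" for m n
      using norm_eq[of "k * x m - k * x n" 0] by (simp add: \<rho>_simps k zero)
    ultimately show ?thesis by (simp add: gns_rel_def gns_cauchy_def zero Image_def)
  qed
  show ?thesis
    unfolding gns_rep_def zero_operator_def
  proof (rule restrict_ext)
    fix X assume "X \<in> hcarrier (gns_space \<omega>)"
    then obtain x where x: "x \<in> gns_cauchy \<omega>" "X = gns_rel \<omega> `` {x}"
      by (auto simp: gns_space_def elim: quotientE)
    then have "x \<in> X" by (simp add: gns_rel_def zero)
    then show "(\<Union>x\<in>X. gns_rel \<omega> `` {\<lambda>n. k * x n}) = hzero (gns_space \<omega>)"
      unfolding image by (auto simp: gns_space_def)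
  qed
qed

section \<open>The unique extension on kernels and on the commutant\<close>

lemma state_extension_extends:
  assumes "\<exists>!\<psi>. extends_to_state M \<phi> \<psi>"
  shows "extends_to_state M \<phi> (state_extension M \<phi>)"
  unfolding state_extension_def by (rule theI'[OF assms])

lemma state_extension_eqI:
  assumes "\<exists>!\<psi>. extends_to_state M \<phi> \<psi>" "extends_to_state M \<phi> \<psi>"
  shows "state_extension M \<phi> = \<psi>"
  unfolding state_extension_def
  by (rule the1_equality[of "extends_to_state M \<phi>", OF assms])

lemma extends_to_stateD:
  assumes "extends_to_state M \<phi> \<psi>"
  shows "\<psi> \<in> states UNIV" "m \<in> M \<Longrightarrow> \<psi> m = \<phi> m"
  using assms by (auto simp: extends_to_state_def)

lemma state_extension_vanishes_on_kernel:
  assumes M: "abelian_cstar_subalgebra M" and \<phi>: "\<phi> \<in> pure_states M"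
    and uniq: "\<exists>!\<psi>. extends_to_state M \<phi> \<psi>"
    and \<rho>: "star_homomorphism \<rho>" "inj_on \<rho> M" and a: "\<rho> a = 0"
  shows "state_extension M \<phi> a = 0"
proof -
  have "cstar_subalgebra M" using M by (simp add: abelian_cstar_subalgebra_def)
  moreover have "\<phi> \<in> states M" using \<phi> by (simp add: pure_states_def)
  ultimately obtain \<psi> where \<psi>: "extends_to_state M \<phi> \<psi>" "\<And>a. \<rho> a = 0 \<Longrightarrow> \<psi> a = 0"
    using character_extension_vanishing_on_kernel[OF _ _ pure_state_multiplicative[OF M \<phi>] \<rho>] by blast
  then show ?thesis using state_extension_eqI[OF uniq \<psi>(1)] a by simp
qed

lemma cstar_subalgebra_commutant:
  assumes M: "\<And>a. a \<in> M \<Longrightarrow> star a \<in> M"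
  shows "cstar_subalgebra (commutant M)"
proof -
  have "closed {a. a * b = b * a}" for b :: 'a
    by (intro closed_Collect_eq continuous_intros)
  moreover have "commutant M = (\<Inter>b\<in>M. {a. a * b = b * a})" by (auto simp: commutant_def)
  ultimately have "closed (commutant M)" by (simp add: closed_INT)
  moreover have "star a \<in> commutant M" if a: "a \<in> commutant M" for a
  proof -
    have "star a * b = b * star a" if b: "b \<in> M" for b
    proof -
      have "a * star b = star b * a" using a M[OF b] by (simp add: commutant_def)
      then have "star (a * star b) = star (star b * a)" by simp
      then show ?thesis by (simp add: star_mult star_star)
    qed
    then show ?thesis by (simp add: commutant_def)
  qed
  moreover have "a * c \<in> commutant M" if "a \<in> commutant M" "c \<in> commutant M" for a c
  proof -
    have "a * c * b = b * (a * c)" if "b \<in> M" for b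
      using \<open>a \<in> commutant M\<close> \<open>c \<in> commutant M\<close> that by (simp add: commutant_def mult.assoc) (simp flip: mult.assoc)
    then show ?thesis by (simp add: commutant_def)
  qed
  ultimately show ?thesis
    by (auto simp: cstar_subalgebra_def commutant_def distrib_left distrib_right mult_scaleC_left mult_scaleC_right)
qed

text \<open>The functional \<open>x \<mapsto> \<omega> (star a * (x * a))\<close> restricts to a multiple of \<open>\<phi>\<close> on \<open>M\<close>, so by
  uniqueness of the extension it is a multiple of \<open>\<omega>\<close>.\<close>
lemma state_extension_commutant_mult:
  fixes M :: "'a::cstar_algebra set"
  assumes M: "abelian_cstar_subalgebra M" and \<phi>: "\<phi> \<in> pure_states M"
    and uniq: "\<exists>!\<psi>. extends_to_state M \<phi> \<psi>" and a: "a \<in> commutant M"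
  shows "state_extension M \<phi> (a * x) = state_extension M \<phi> a * state_extension M \<phi> x"
proof -
  define \<omega> where "\<omega> = state_extension M \<phi>"
  have N: "cstar_subalgebra M" and MM: "M \<subseteq> commutant M"
    using M by (auto simp: abelian_cstar_subalgebra_def commutant_def)
  have C: "cstar_subalgebra (commutant M)"
    using cstar_subalgebra_star[OF N] by (rule cstar_subalgebra_commutant)
  have st: "\<phi> \<in> states M" using \<phi> by (simp add: pure_states_def)
  have \<omega>: "\<omega> \<in> states UNIV" "\<And>m. m \<in> M \<Longrightarrow> \<omega> m = \<phi> m"
    using extends_to_stateD[OF state_extension_extends[OF uniq]] by (auto simp: \<omega>_def)
  note U = cstar_subalgebra_UNIV
  note pos = states_positive[OF \<omega>(1)]
  note upos = positive_functional_unitize[OF U \<omega>(1)]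
  \<comment> \<open>Cauchy-Schwarz with z = m - \<phi> m: \<phi> is a character, so star z * z has
    value 0 and x z has value 0 for every \<open>x\<close>.\<close>
  have right: "\<omega> (x * m) = \<omega> x * \<phi> m" if m: "m \<in> M" for x m
  proof -
    define z where "z = Unitize m (- \<phi> m)"
    have sm: "star m \<in> M" "star m * m \<in> M" by (intro cstar_subalgebra_intros[OF N] m)+
    have "\<phi> (star m * m) = cnj (\<phi> m) * \<phi> m"
      using pure_state_multiplicative[OF M \<phi> sm(1) m] states_star[OF N st m] by simp
    then have zz: "unitize_fun \<omega> (star z * z) = 0"
      using \<omega>(2)[OF sm(1)] \<omega>(2)[OF sm(2)] \<omega>(2)[OF m] states_star[OF N st m]
      by (simp add: unitize_fun_def z_def star_Unitize positive_functionalD[OF pos]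
          positive_functional_diff[OF U pos] scaleC_minus_left algebra_simps)
    have "(cmod (unitize_fun \<omega> (star (star (Unitize x 0)) * z)))\<^sup>2
        \<le> Re (unitize_fun \<omega> (star (star (Unitize x 0)) * star (Unitize x 0))) * Re (unitize_fun \<omega> (star z * z))"
      by (rule positive_functional_Cauchy_Schwarz[OF cstar_subalgebra_unitize_set[OF U] upos])
         (simp_all add: unitize_set_def)
    then have "unitize_fun \<omega> (Unitize x 0 * z) = 0" by (simp add: zz star_star)
    then show ?thesis
      by (simp add: unitize_fun_def z_def positive_functionalD[OF pos] positive_functional_diff[OF U pos]
          scaleC_minus_left)
  qed
  have diag: "\<omega> (star c * (x * c)) = \<omega> (star c * c) * \<omega> x" if c: "c \<in> commutant M" for c x
  proof -
    define t where "t = Re (\<omega> (star c * c))"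
    have t: "\<omega> (star c * c) = of_real t" "0 \<le> t"
      using positive_functional_nonneg[OF pos, of c] by (auto simp: t_def complex_nonneg_Reals_iff complex_eq_iff)
    have le: "cmod (\<omega> (star c * (y * c))) \<le> t * norm y" for y
      using state_compress_le[OF U \<omega>(1), of "Unitize c 0" y]
      by (simp add: star_Unitize Unitize_mult unitize_fun_def t_def)
    show ?thesis
    proof (cases "t = 0")
      case True
      then show ?thesis using le[of x] t by simp
    next
      case False
      then have t0: "t > 0" using t by simp
      define \<psi> where "\<psi> y = \<omega> (star c * (y * c)) / of_real t" for y
      have \<psi>M: "\<psi> m = \<phi> m" if m: "m \<in> M" for m
      proof -
        have "c * m = m * c" using c m by (simp add: commutant_def)
        then have "\<omega> (star c * (m * c)) = \<omega> (star c * c * m)" by (simp add: mult.assoc)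
        also have "\<dots> = of_real t * \<phi> m" using right[OF m] t by simp
        finally show ?thesis using t0 by (simp add: \<psi>_def)
      qed
      have "\<psi> \<in> states UNIV"
      proof (rule states_extensionI[OF U N subset_UNIV _ _ _ st])
        show "positive_functional UNIV \<psi>"
          unfolding positive_functional_def
        proof (intro conjI ballI allI)
          fix b :: 'a
          have "\<psi> (star b * b) = \<omega> (star (b * c) * (b * c)) * of_real (1 / t)"
            by (simp add: \<psi>_def star_mult mult.assoc)
          moreover have "complex_of_real (1 / t) \<in> \<real>\<^sub>\<ge>\<^sub>0"
            using t0 by (simp only: nonneg_Reals_of_real_iff) simp
          ultimately show "\<psi> (star b * b) \<in> \<real>\<^sub>\<ge>\<^sub>0"
            using positive_functional_nonneg[OF pos, of "b * c"] by (metis nonneg_Reals_mult_I UNIV_I)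
        qed (simp_all add: \<psi>_def distrib_left distrib_right mult_scaleC_left mult_scaleC_right
              positive_functionalD[OF pos] add_divide_distrib)
        show "cmod (\<psi> b) \<le> norm b" for b
          using le[of b] t0 by (simp add: \<psi>_def norm_divide field_simps)
      qed (simp_all add: \<psi>M)
      moreover have "restrict \<psi> M = \<phi>"
        using st \<psi>M by (intro extensionalityI[of _ M]) (auto simp: states_def)
      ultimately have "\<omega> = \<psi>"
        unfolding \<omega>_def by (intro state_extension_eqI[OF uniq]) (simp add: extends_to_state_def)
      then have "\<omega> x = \<omega> (star c * (x * c)) / of_real t" unfolding \<psi>_def by metis
      then show ?thesis using t t0 by (simp add: field_simps)
    qed
  qed
  obtain e where e: "e \<in> M" "\<phi> e = 1" using states_one[OF N st] .
  have sa: "star a \<in> commutant M" using a by (rule cstar_subalgebra_star[OF C])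
  \<comment> \<open>Polarization with entries \<open>star a\<close> and \<open>e\<close>; the factor
    \<open>e\<close> is then absorbed by \<open>right\<close>, since \<phi> e = 1.\<close>
  have "\<omega> (star (star a) * (x * e)) = \<omega> (star (star a) * e) * \<omega> x"
    by (rule compression_polarization[OF U pos C subset_UNIV UNIV_I diag sa]) (use e MM in auto)
  moreover have "\<omega> (a * (x * e)) = \<omega> (a * x)" "\<omega> (a * e) = \<omega> a"
    using right[OF e(1), of "a * x"] right[OF e(1), of a] e(2) by (simp_all add: mult.assoc)
  ultimately show ?thesis by (simp add: star_star \<omega>_def)
qed

text \<open>Being abelian and containing \<open>M\<close>, the algebra \<open>N\<close> lies in the
  commutant, on which the extension is multiplicative.\<close>

lemma restrict_state_extension_pure:
  assumes M: "abelian_cstar_subalgebra M" and \<phi>: "\<phi> \<in> pure_states M"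
    and uniq: "\<exists>!\<psi>. extends_to_state M \<phi> \<psi>"
    and N: "abelian_cstar_subalgebra N" "M \<subseteq> N"
  shows "restrict (state_extension M \<phi>) N \<in> pure_states N"
proof -
  define \<omega> where "\<omega> = state_extension M \<phi>"
  have CM: "cstar_subalgebra M" and CN: "cstar_subalgebra N" and NM: "N \<subseteq> commutant M"
    using M N by (auto simp: abelian_cstar_subalgebra_def commutant_def)
  have st: "\<phi> \<in> states M" using \<phi> by (simp add: pure_states_def)
  have \<omega>: "\<omega> \<in> states UNIV" "\<And>m. m \<in> M \<Longrightarrow> \<omega> m = \<phi> m"
    using extends_to_stateD[OF state_extension_extends[OF uniq]] by (auto simp: \<omega>_def)
  note pos = states_positive[OF \<omega>(1)]
  have "restrict \<omega> N \<in> states N"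
  proof (rule states_extensionI[OF CN CM N(2) _ _ _ st])
    show "positive_functional N (restrict \<omega> N)"
      using pos by (auto simp: positive_functional_def cstar_subalgebra_intros[OF CN])
    show "cmod (restrict \<omega> N a) \<le> norm a" if "a \<in> N" for a
      using that states_norm_le[OF cstar_subalgebra_UNIV \<omega>(1)] by simp
  qed (use \<omega>(2) N(2) in auto)
  moreover have "restrict \<omega> N (a * b) = restrict \<omega> N a * restrict \<omega> N b" if "a \<in> N" "b \<in> N" for a b
    using that NM state_extension_commutant_mult[OF M \<phi> uniq, of a b]
    by (auto simp: \<omega>_def cstar_subalgebra_mult[OF CN])
  ultimately show ?thesis unfolding \<omega>_def by (rule multiplicative_state_pure[OF CN])
qed

section \<open>Characters under functional calculus and density in the pure state space\<close>

lemma character_cfc: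
  assumes N: "cstar_subalgebra N" and \<theta>: "\<theta> \<in> states N"
    and mult: "\<And>a b. a \<in> N \<Longrightarrow> b \<in> N \<Longrightarrow> \<theta> (a * b) = \<theta> a * \<theta> b"
    and b: "b \<in> unitize_set N" "star b = b" "unitize_fun \<theta> b = of_real t"
    and f: "continuous_on {-norm b..norm b} f"
  shows "cfc b f \<in> unitize_set N \<and> unitize_fun \<theta> (cfc b f) = of_real (f t)"
proof -
  define \<Theta> where "\<Theta> = unitize_fun \<theta>"
  define S where "S = unitize_set N"
  have S: "cstar_subalgebra S" unfolding S_def by (rule cstar_subalgebra_unitize_set[OF N])
  note pos = positive_functional_unitize[OF N \<theta>, folded S_def \<Theta>_def]
  have le: "cmod (\<Theta> x) \<le> norm x" if "x \<in> S" for x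
    using unitize_fun_le[OF N \<theta>] that by (simp add: S_def \<Theta>_def)
  \<comment> \<open>Contractivity places \<open>t\<close> in the interval where the polynomials
    approximate \<open>f\<close>, so the same sequence controls f t and the norm limit.\<close>
  have t: "\<bar>t\<bar> \<le> norm b" using le[of b] b by (simp add: S_def \<Theta>_def)
  have \<Theta>_mult: "\<Theta> (x * y) = \<Theta> x * \<Theta> y" if "x \<in> S" "y \<in> S" for x y
    using that by (simp add: \<Theta>_def S_def unitize_fun_def unitize_set_def mult
        positive_functionalD[OF states_positive[OF \<theta>]] cstar_subalgebra_intros[OF N] algebra_simps)
  obtain q where q: "(\<lambda>n. peval (q n) b) \<longlonglongrightarrow> cfc b f"
    "\<forall>n x. \<bar>x\<bar> \<le> norm b \<longrightarrow> \<bar>f x - poly (q n) x\<bar> \<le> inverse (real (Suc n))"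
    using cfc_sequence[OF b(2) f] .
  have \<Theta>_1: "\<Theta> 1 = 1"
    by (simp add: \<Theta>_def unitize_fun_def positive_functional_zero[OF N states_positive[OF \<theta>]])
  have pv: "peval p b \<in> S" "\<Theta> (peval p b) = of_real (poly p t)" for p
  proof -
    have "peval p b \<in> S \<and> \<Theta> (peval p b) = peval p (\<Theta> b)"
    proof (rule peval_homomorphism[of S \<Theta>])
      show "1 \<in> S" unfolding S_def by (rule one_in_unitize_set[OF N])
    qed (use b in \<open>simp_all add: cstar_subalgebra_intros[OF S] \<Theta>_1 \<Theta>_mult positive_functional_add[OF pos]
          positive_functional_scaleR[OF pos] scaleR_conv_of_real[where 'a=complex] S_def[symmetric]\<close>)
    then show "peval p b \<in> S" "\<Theta> (peval p b) = of_real (poly p t)"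
      using b(3) by (simp_all add: \<Theta>_def peval_of_real)
  qed
  have mem: "cfc b f \<in> S"
    using closed_sequentially[OF cstar_subalgebra_closed[OF S] _ q(1)] pv(1) by blast
  have "cmod (\<Theta> (cfc b f) - of_real (f t)) \<le> 0"
  proof (rule LIMSEQ_le_const)
    show "(\<lambda>n. norm (cfc b f - peval (q n) b) + inverse (real (Suc n))) \<longlonglongrightarrow> 0"
      using tendsto_add[OF tendsto_norm[OF tendsto_diff[OF tendsto_const[of "cfc b f"] q(1)]] LIMSEQ_inverse_real_of_nat]
      by simp
    have "cmod (\<Theta> (cfc b f) - of_real (f t)) \<le> norm (cfc b f - peval (q n) b) + inverse (real (Suc n))" for n
    proof -
      have "\<Theta> (cfc b f) - of_real (f t) = \<Theta> (cfc b f - peval (q n) b) + of_real (poly (q n) t - f t)"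
        by (simp add: positive_functional_diff[OF S pos mem pv(1)] pv(2))
      also have "cmod \<dots> \<le> norm (cfc b f - peval (q n) b) + \<bar>poly (q n) t - f t\<bar>"
        using le[OF cstar_subalgebra_diff[OF S mem pv(1)]]
        by (intro order_trans[OF norm_triangle_ineq] add_mono) (simp_all flip: of_real_diff)
      also have "\<bar>poly (q n) t - f t\<bar> \<le> inverse (real (Suc n))"
        using q(2)[rule_format, OF t, of n] by (simp add: abs_minus_commute)
      finally show ?thesis by simp
    qed
    then show "\<exists>k. \<forall>n\<ge>k. cmod (\<Theta> (cfc b f) - of_real (f t))
        \<le> norm (cfc b f - peval (q n) b) + inverse (real (Suc n))" by blast
  qed
  then show ?thesis using mem by (simp add: \<Theta>_def S_def)
qed

text \<open>If no \<open>\<theta> \<in> T\<close> were close to \<open>\<xi>\<close>, a bump function at \<open>\<xi>\<close> applied to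
  \<open>b = \<Sum>i\<in>I. \<bar>i - \<xi> i\<bar>\<^sup>2\<close> would yield a nonzero element of \<open>N\<close> on which all of \<open>T\<close> vanishes.\<close>
lemma characters_dense:
  fixes N :: "'a::cstar_algebra set"
  assumes N: "abelian_cstar_subalgebra N" and T: "T \<subseteq> pure_states N"
    and sep: "\<And>a. a \<in> N \<Longrightarrow> (\<And>\<theta>. \<theta> \<in> T \<Longrightarrow> \<theta> a = 0) \<Longrightarrow> a = 0"
    and \<xi>: "\<xi> \<in> pure_states N" and I: "finite I" "I \<subseteq> N" and \<epsilon>: "\<epsilon> > 0"
  shows "\<exists>\<theta>\<in>T. \<forall>i\<in>I. cmod (\<theta> i - \<xi> i) < \<epsilon>"
proof (rule ccontr)
  assume far: "\<not> (\<exists>\<theta>\<in>T. \<forall>i\<in>I. cmod (\<theta> i - \<xi> i) < \<epsilon>)"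
  have CN: "cstar_subalgebra N" using N by (simp add: abelian_cstar_subalgebra_def)
  have S: "cstar_subalgebra (unitize_set N)" by (rule cstar_subalgebra_unitize_set[OF CN])
  \<comment> \<open>\<open>z i\<close> is i - \<xi> i, so a character \<theta> has the value
    \<bar>\<theta> i - \<xi> i\<bar>^2 on star (z i) * z i. Below, f 0 = 1, and f vanishes from
    \<epsilon>^2 on.\<close>
  define z where "z i = Unitize i (- \<xi> i)" for i
  define b where "b = (\<Sum>i\<in>I. star (z i) * z i)"
  define f where "f x = max 0 (1 - x / \<epsilon>\<^sup>2)" for x :: real
  define k where "k = cfc b f"
  define t where "t \<theta> = (\<Sum>i\<in>I. (cmod (\<theta> i - \<xi> i))\<^sup>2)" for \<theta>
  have f: "continuous_on X f" for X unfolding f_def using \<epsilon> by (intro continuous_intros) auto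
  have zS: "z i \<in> unitize_set N" if "i \<in> I" for i using that I by (auto simp: z_def)
  have b: "b \<in> unitize_set N" "star b = b"
    unfolding b_def by (auto intro!: cstar_subalgebra_intros[OF S] zS simp: star_sum star_mult star_star)
  have st: "\<theta> \<in> states N" if "\<theta> \<in> pure_states N" for \<theta> using that by (simp add: pure_states_def)
  have \<theta>b: "unitize_fun \<theta> b = of_real (t \<theta>)" if \<theta>: "\<theta> \<in> pure_states N" for \<theta>
  proof -
    note pos = positive_functional_unitize[OF CN st[OF \<theta>]]
    have sq: "unitize_fun \<theta> (star (z i) * z i) = of_real ((cmod (\<theta> i - \<xi> i))\<^sup>2)" if i: "i \<in> I" for i
    proof -
      have iN: "i \<in> N" "star i \<in> N" using i I cstar_subalgebra_star[OF CN] by auto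
      have "unitize_fun \<theta> (star (z i) * z i) = (cnj (\<theta> i) - cnj (\<xi> i)) * (\<theta> i - \<xi> i)"
        using iN pure_state_multiplicative[OF N \<theta> iN(2,1)] states_star[OF CN st[OF \<theta>] iN(1)]
        by (simp add: unitize_fun_def z_def star_Unitize cstar_subalgebra_intros[OF CN] scaleC_minus_left
            positive_functionalD[OF states_positive[OF st[OF \<theta>]]]
            positive_functional_diff[OF CN states_positive[OF st[OF \<theta>]]] algebra_simps)
      also have "\<dots> = of_real ((cmod (\<theta> i - \<xi> i))\<^sup>2)"
        unfolding complex_norm_square by (simp add: mult.commute)
      finally show ?thesis .
    qed
    have "unitize_fun \<theta> (\<Sum>i\<in>J. star (z i) * z i) = (\<Sum>i\<in>J. unitize_fun \<theta> (star (z i) * z i))" if "J \<subseteq> I" for J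
      using finite_subset[OF that I(1)] that
    proof (induction J)
      case empty
      then show ?case by (simp add: positive_functional_zero[OF S pos])
    next
      case (insert j J)
      have "star (z j) * z j \<in> unitize_set N" "(\<Sum>i\<in>J. star (z i) * z i) \<in> unitize_set N"
        using insert by (auto intro!: cstar_subalgebra_intros[OF S] zS)
      then show ?case using insert by (simp add: positive_functional_add[OF pos])
    qed
    then show ?thesis by (simp add: b_def t_def sq)
  qed
  have \<theta>k: "k \<in> unitize_set N" "unitize_fun \<theta> k = of_real (f (t \<theta>))" if \<theta>: "\<theta> \<in> pure_states N" for \<theta>
    using character_cfc[OF CN st[OF \<theta>] pure_state_multiplicative[OF N \<theta>] b \<theta>b[OF \<theta>] f]
    by (auto simp: k_def)
  obtain e where e: "e \<in> N" "\<xi> e = 1" using states_one[OF CN st[OF \<xi>]] .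
  \<comment> \<open>\<open>k\<close> may have a scalar part; multiplying by \<open>e\<close>, with
    \<xi> e = 1, returns to \<open>N\<close>, where \<open>sep\<close> applies.\<close>
  define w where "w = e * elem k + scaleC (scal k) e"
  have kN: "elem k \<in> N" using \<theta>k(1)[OF \<xi>] by (simp add: unitize_set_def)
  have wN: "w \<in> N" unfolding w_def by (intro cstar_subalgebra_intros[OF CN] e kN)
  have \<theta>w: "\<theta> w = \<theta> e * of_real (f (t \<theta>))" if \<theta>: "\<theta> \<in> pure_states N" for \<theta>
  proof -
    have "\<theta> w = \<theta> e * (\<theta> (elem k) + scal k)"
      using e kN pure_state_multiplicative[OF N \<theta> e(1) kN]
      by (simp add: w_def cstar_subalgebra_intros[OF CN] algebra_simps
          positive_functionalD[OF states_positive[OF st[OF \<theta>]]])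
    then show ?thesis using \<theta>k(2)[OF \<theta>] by (simp add: unitize_fun_def)
  qed
  have "w = 0"
  proof (rule sep[OF wN])
    fix \<theta> assume \<theta>: "\<theta> \<in> T"
    then obtain i where i: "i \<in> I" "\<epsilon> \<le> cmod (\<theta> i - \<xi> i)" using far by (auto simp: not_less)
    have "\<epsilon>\<^sup>2 \<le> (cmod (\<theta> i - \<xi> i))\<^sup>2" using i(2) \<epsilon> by (intro power_mono) auto
    also have "\<dots> \<le> t \<theta>" unfolding t_def using i(1) I(1) by (intro member_le_sum) auto
    finally have "f (t \<theta>) = 0" using \<epsilon> by (simp add: f_def)
    then show "\<theta> w = 0" using \<theta>w[of \<theta>] \<theta> T by auto
  qed
  moreover have "t \<xi> = 0" by (simp add: t_def)
  then have "\<xi> w = 1" using \<theta>w[OF \<xi>] e by (simp add: f_def)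
  ultimately show False using positive_functional_zero[OF CN states_positive[OF st[OF \<xi>]]] by simp
qed

text \<open>A basic neighbourhood in the product topology restricts finitely many coordinates, so
  \<open>characters_dense\<close> applies with the least of the radii.\<close>

lemma pure_state_space_dense:
  fixes N :: "'a::cstar_algebra set"
  assumes N: "abelian_cstar_subalgebra N" and T: "T \<subseteq> pure_states N"
    and sep: "\<And>a. a \<in> N \<Longrightarrow> (\<And>\<theta>. \<theta> \<in> T \<Longrightarrow> \<theta> a = 0) \<Longrightarrow> a = 0"
  shows "pure_state_space N closure_of T = pure_states N"
proof -
  have ext: "pure_states N \<subseteq> extensional N" by (auto simp: pure_states_def states_def)
  then have top: "topspace (pure_state_space N) = pure_states N"
    by (auto simp: pure_state_space_def PiE_def)
  have "\<xi> \<in> pure_state_space N closure_of T" if \<xi>: "\<xi> \<in> pure_states N" for \<xi>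
    unfolding in_closure_of
  proof (intro conjI allI impI)
    show "\<xi> \<in> topspace (pure_state_space N)" using \<xi> top by simp
    fix U assume U: "\<xi> \<in> U \<and> openin (pure_state_space N) U"
    then obtain V where V: "openin (product_topology (\<lambda>_. euclidean) N) V" "U = V \<inter> pure_states N" "\<xi> \<in> V"
      unfolding pure_state_space_def by (auto simp: openin_subtopology)
    obtain W where W: "finite {i \<in> N. W i \<noteq> UNIV}" "\<And>i. i \<in> N \<Longrightarrow> open (W i)" "\<xi> \<in> Pi\<^sub>E N W" "Pi\<^sub>E N W \<subseteq> V"
      using V(1,3) unfolding openin_product_topology_alt by (auto simp: open_openin[symmetric])
    define I where "I = {i \<in> N. W i \<noteq> UNIV}"
    have "\<exists>e>0. ball (\<xi> i) e \<subseteq> W i" if "i \<in> I" for i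
      using W(2,3) that open_contains_ball by (auto simp: I_def PiE_def Pi_def)
    then obtain r where r: "\<And>i. i \<in> I \<Longrightarrow> 0 < r i \<and> ball (\<xi> i) (r i) \<subseteq> W i" by metis
    \<comment> \<open>The added 1 covers a neighbourhood without restricted coordinates.\<close>
    define \<epsilon> where "\<epsilon> = Min (insert 1 (r ` I))"
    have \<epsilon>: "\<epsilon> > 0" "\<And>i. i \<in> I \<Longrightarrow> \<epsilon> \<le> r i"
      using W(1) r by (auto simp: \<epsilon>_def I_def[symmetric])
    obtain \<theta> where \<theta>: "\<theta> \<in> T" "\<And>i. i \<in> I \<Longrightarrow> cmod (\<theta> i - \<xi> i) < \<epsilon>"
      using characters_dense[OF N T sep \<xi>, of I \<epsilon>] W(1) \<epsilon>(1) by (auto simp: I_def)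
    have "\<theta> i \<in> W i" if "i \<in> N" for i
    proof (cases "i \<in> I")
      case True
      then have "\<theta> i \<in> ball (\<xi> i) (r i)"
        using \<theta>(2)[OF True] \<epsilon>(2)[OF True] by (simp add: dist_norm norm_minus_commute)
      then show ?thesis using r[OF True] by blast
    qed (use that in \<open>auto simp: I_def\<close>)
    then have "\<theta> \<in> Pi\<^sub>E N W" using \<theta>(1) T ext by (auto simp: PiE_def)
    then have "\<theta> \<in> V" using W(4) by blast
    then show "\<exists>y. y \<in> T \<and> y \<in> U" using \<theta>(1) T V(2) by auto
  qed
  then show ?thesis using closure_of_subset_topspace[of "pure_state_space N" T] top by auto
qed

theorem theorem3p3:
  fixes M :: "'a::cstar_algebra set" and F :: "('a \<Rightarrow> complex) set"
  assumes M: "abelian_cstar_subalgebra M"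
    and F_nonempty: "F \<noteq> {}"
    and F_pure: "F \<subseteq> pure_states M"
    and unique_ext: "\<forall>\<phi>\<in>F. \<exists>!\<psi>. extends_to_state M \<phi> \<psi>"
  shows
    "(jointly_faithful F (\<lambda>\<phi>. gns_rep (state_extension M \<phi>))
        (\<lambda>\<phi>. zero_operator (gns_space (state_extension M \<phi>))) \<longrightarrow>
      (\<forall>\<rho>::'a \<Rightarrow> 'b::cstar_algebra. star_homomorphism \<rho> \<longrightarrow> (inj \<rho> \<longleftrightarrow> inj_on \<rho> M)))
     \<and>
     (jointly_faithful F (\<lambda>\<phi>. state_extension M \<phi>) (\<lambda>_. 0) \<longrightarrow>
      (\<forall>\<rho>::'a \<Rightarrow> 'b::cstar_algebra. star_homomorphism \<rho> \<longrightarrow> (inj \<rho> \<longleftrightarrow> inj_on \<rho> M)) \<and>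
      masa (commutant M) \<and>
      (\<forall>N. abelian_cstar_subalgebra N \<and> M \<subseteq> N \<longrightarrow>
        (\<lambda>\<phi>. restrict (state_extension M \<phi>) N) ` F \<subseteq> pure_states N \<and>
        pure_state_space N closure_of ((\<lambda>\<phi>. restrict (state_extension M \<phi>) N) ` F)
          = pure_states N))"
proof -
  define \<omega> where "\<omega> = state_extension M"
  have pure: "\<phi> \<in> pure_states M" and uniq: "\<exists>!\<psi>. extends_to_state M \<phi> \<psi>" if "\<phi> \<in> F" for \<phi>
    using that F_pure unique_ext by auto
  have \<omega>_state: "\<omega> \<phi> \<in> states UNIV" if "\<phi> \<in> F" for \<phi>
    unfolding \<omega>_def by (rule extends_to_stateD[OF state_extension_extends[OF uniq[OF that]]])
  have vanish: "\<omega> \<phi> a = 0" if "star_homomorphism \<rho>" "inj_on \<rho> M" "\<phi> \<in> F" "\<rho> a = 0"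
    for \<rho> :: "'a \<Rightarrow> 'b" and \<phi> a
    using state_extension_vanishes_on_kernel[OF M pure uniq] that by (simp add: \<omega>_def)
  have injI: "inj \<rho>" if \<rho>: "star_homomorphism \<rho>" and ker: "\<And>a. \<rho> a = 0 \<Longrightarrow> a = 0" for \<rho> :: "'a \<Rightarrow> 'b"
    using star_homomorphism_diff[OF \<rho>] ker by (intro injI) (metis eq_iff_diff_eq_0)
  have ker_star: "\<rho> (star a * a) = 0" if "star_homomorphism \<rho>" "\<rho> a = 0" for \<rho> :: "'a \<Rightarrow> 'b" and a
    using that by (simp add: star_homomorphism_mult)
  have I: "inj \<rho> \<longleftrightarrow> inj_on \<rho> M"
    if jf: "jointly_faithful F (\<lambda>\<phi>. gns_rep (\<omega> \<phi>)) (\<lambda>\<phi>. zero_operator (gns_space (\<omega> \<phi>)))"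
      and \<rho>: "star_homomorphism \<rho>" for \<rho> :: "'a \<Rightarrow> 'b"
  proof
    assume inj: "inj_on \<rho> M"
    show "inj \<rho>"
    proof (rule injI[OF \<rho>])
      fix a assume "\<rho> a = 0"
      then have "gns_rep (\<omega> \<phi>) (star a * a) = zero_operator (gns_space (\<omega> \<phi>))" if "\<phi> \<in> F" for \<phi>
        using that by (intro gns_rep_eq_zero[OF \<omega>_state \<rho>] vanish[OF \<rho> inj] ker_star[OF \<rho>])
      then show "a = 0" using jf by (simp add: jointly_faithful_def)
    qed
  qed (auto intro: inj_on_subset)
  have II_i: "inj \<rho> \<longleftrightarrow> inj_on \<rho> M"
    if jf: "jointly_faithful F \<omega> (\<lambda>_. 0)" and \<rho>: "star_homomorphism \<rho>" for \<rho> :: "'a \<Rightarrow> 'b"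
  proof
    assume inj: "inj_on \<rho> M"
    show "inj \<rho>"
    proof (rule injI[OF \<rho>])
      fix a assume "\<rho> a = 0"
      then have "\<omega> \<phi> (star a * a) = 0" if "\<phi> \<in> F" for \<phi>
        using that by (intro vanish[OF \<rho> inj] ker_star[OF \<rho>])
      then show "a = 0" using jf by (simp add: jointly_faithful_def)
    qed
  qed (auto intro: inj_on_subset)
  have CM: "cstar_subalgebra M" and MM: "M \<subseteq> commutant M"
    using M by (auto simp: abelian_cstar_subalgebra_def commutant_def)
  have CC: "cstar_subalgebra (commutant M)"
    using cstar_subalgebra_star[OF CM] by (rule cstar_subalgebra_commutant)
  have \<omega>_mult: "\<omega> \<phi> (a * x) = \<omega> \<phi> a * \<omega> \<phi> x" if "\<phi> \<in> F" "a \<in> commutant M" for \<phi> a x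
    unfolding \<omega>_def by (rule state_extension_commutant_mult[OF M pure[OF that(1)] uniq[OF that(1)] that(2)])
  \<comment> \<open>Joint faithfulness tests star a * a; multiplicativity on the commutant reduces
    this to \<omega> \<phi> a = 0.\<close>
  have sep: "a = 0" if jf: "jointly_faithful F \<omega> (\<lambda>_. 0)" and a: "a \<in> commutant M"
    and 0: "\<And>\<phi>. \<phi> \<in> F \<Longrightarrow> \<omega> \<phi> a = 0" for a
    using jf \<omega>_mult[OF _ cstar_subalgebra_star[OF CC a], of _ a] 0 by (simp add: jointly_faithful_def)
  have II_ii: "masa (commutant M)" if jf: "jointly_faithful F \<omega> (\<lambda>_. 0)"
  proof -
    have "a * b = b * a" if ab: "a \<in> commutant M" "b \<in> commutant M" for a b
    proof -
      have "\<omega> \<phi> (a * b - b * a) = 0" if "\<phi> \<in> F" for \<phi>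
        using \<omega>_mult[OF that ab(1), of b] \<omega>_mult[OF that ab(2), of a]
        by (simp add: positive_functional_diff[OF cstar_subalgebra_UNIV states_positive[OF \<omega>_state[OF that]]])
      then have "a * b - b * a = 0"
        using ab by (intro sep[OF jf] cstar_subalgebra_intros[OF CC])
      then show ?thesis by simp
    qed
    then have "abelian_cstar_subalgebra (commutant M)" using CC by (simp add: abelian_cstar_subalgebra_def)
    \<comment> \<open>An abelian \<open>E\<close> above the commutant contains \<open>M\<close>, so
      its elements commute with \<open>M\<close>.\<close>
    moreover have "E = commutant M" if "abelian_cstar_subalgebra E" "commutant M \<subseteq> E" for E
      using that MM by (auto simp: abelian_cstar_subalgebra_def commutant_def)
    ultimately show ?thesis by (simp add: masa_def)
  qed
  have II_iii: "(\<lambda>\<phi>. restrict (\<omega> \<phi>) N) ` F \<subseteq> pure_states N \<and>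
      pure_state_space N closure_of ((\<lambda>\<phi>. restrict (\<omega> \<phi>) N) ` F) = pure_states N"
    if jf: "jointly_faithful F \<omega> (\<lambda>_. 0)" and N: "abelian_cstar_subalgebra N" "M \<subseteq> N" for N
  proof
    show sub: "(\<lambda>\<phi>. restrict (\<omega> \<phi>) N) ` F \<subseteq> pure_states N"
      unfolding \<omega>_def using restrict_state_extension_pure[OF M pure uniq N] by auto
    have "N \<subseteq> commutant M" using N by (auto simp: abelian_cstar_subalgebra_def commutant_def)
    show "pure_state_space N closure_of ((\<lambda>\<phi>. restrict (\<omega> \<phi>) N) ` F) = pure_states N"
    proof (rule pure_state_space_dense[OF N(1) sub])
      fix a assume a: "a \<in> N" and 0: "\<And>\<theta>. \<theta> \<in> (\<lambda>\<phi>. restrict (\<omega> \<phi>) N) ` F \<Longrightarrow> \<theta> a = 0"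
      have "\<omega> \<phi> a = 0" if "\<phi> \<in> F" for \<phi>
        using 0[of "restrict (\<omega> \<phi>) N"] that a by simp
      then show "a = 0" using a \<open>N \<subseteq> commutant M\<close> by (intro sep[OF jf]) auto
    qed
  qed
  show ?thesis using I II_i II_ii II_iii by (simp add: \<omega>_def)
qed

end
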